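(* For all partitions $\lambda,\mu$ of the same integer with $\mu\le\lambda$ in the dominance order, the coefficient $v_{\lambda\mu}(\alpha)\in\mathbb{Q}(\alpha)$ of the monomial symmetric function $m_\mu$ in the expansion $$J_\lambda=\sum_{\mu\le\lambda}v_{\lambda\mu}(\alpha)\,m_\mu$$ of the Jack polynomial $J_\lambda$ (normalized by $v_{\lambda,1^N}=N!$ for $N=|\lambda|$) is a polynomial in $\alpha$ with integer coefficients, i.e. $v_{\lambda\mu}(\alpha)\in\mathbb{Z}[\alpha]$.
   Context: Partitions. A partition is a sequence $\lambda=(\lambda_1,\lambda_2,\dots)$ of non-negative integers with $\lambda_1\ge\lambda_2\ge\cdots$ and finite sum $|\lambda|=\sum_i\lambda_i$; $\ell(\lambda)$ is the number of nonzero parts and $m_i(\lambda)$ is the number of parts equal to $i$. For partitions $\lambda,\mu$ of the same integer $N$, the dominance order is: $\lambda\ge\mu$ iff $\lambda_1+\dots+\lambda_i\ge\mu_1+\dots+\mu_i$ for all $i$. Put $z_\lambda=\prod_{i\ge1} i^{m_i(\lambda)}\,m_i(\lambda)!$. Jack polynomials. Let $\alpha$ be a parameter (indeterminate) and let $\Lambda$ be the ring of symmetric functions over $\mathbb{Q}(\alpha)$ in infinitely many variables $x_1,x_2,\dots$, with bases the power sums $p_\lambda=p_{\lambda_1}p_{\lambda_2}\cdots$, $p_i=\sum_k x_k^i$ (product over the nonzero parts), and the monomial symmetric functions $m_\lambda=\sum x_1^{\lambda_1}x_2^{\lambda_2}\cdots$ (sum over distinct permutations of the exponents). Define a scalar product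 on $\Lambda$ by $\langle p_\lambda,p_\mu\rangle=\delta_{\lambda\mu}z_\lambda\alpha^{\ell(\lambda)}$. The Jack symmetric functions $J_\lambda$ are the unique family in $\Lambda$, indexed by partitions, such that: (i) $\langle J_\lambda,J_\mu\rangle=0$ if $\lambda\neq\mu$; (ii) $J_\lambda=\sum_{\mu\le\lambda}v_{\lambda\mu}(\alpha)m_\mu$ with $v_{\lambda\mu}(\alpha)\in\mathbb{Q}(\alpha)$; (iii) if $|\lambda|=N$, then $v_{\lambda,1^N}=N!$, where $1^N=(1,\dots,1)$ ($N$ ones). (Existence and uniqueness of this family are known.) The Jack polynomial in $n$ variables is obtained by setting $x_{n+1}=x_{n+2}=\dots=0$; its coefficient on $m_\mu(x_1,\dots,x_n)$ with $\ell(\mu)\le n$ is the same $v_{\lambda\mu}(\alpha)$. *)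

theory Defs
  imports
    "HOL-Library.Poly_Mapping"
    "HOL-Computational_Algebra.Computational_Algebra"
begin

section \<open>Formal power series in countably many variables\<close>

text \<open>
  A monomial in the variables \<open>x\<^sub>0, x\<^sub>1, x\<^sub>2, \<dots>\<close> is a finitely supported exponent sequence
  \<^typ>\<open>nat \<Rightarrow>\<^sub>0 nat\<close>; a formal power series is an arbitrary assignment of coefficients to monomials.
  Symmetric functions such as \<open>\<Sum>\<^sub>k x\<^sub>k\<close> involve infinitely many monomials, so finitely
  supported coefficient functions would not do.
\<close>

typedef 'a mps = "UNIV :: ((nat \<Rightarrow>\<^sub>0 nat) \<Rightarrow> 'a) set"
  morphisms mps_coeff Abs_mps ..

lemma mps_coeff_Abs [simp]: "mps_coeff (Abs_mps f) = f"
  by (simp add: Abs_mps_inverse)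

lemma mps_eq_iff: "f = g \<longleftrightarrow> (\<forall>a. mps_coeff f a = mps_coeff g a)"
  by (metis ext mps_coeff_inject)

text \<open>The factorizations of a monomial into two monomials; there are finitely many.\<close>

definition monom_splits :: "(nat \<Rightarrow>\<^sub>0 nat) \<Rightarrow> ((nat \<Rightarrow>\<^sub>0 nat) \<times> (nat \<Rightarrow>\<^sub>0 nat)) set" where
  "monom_splits a = {(b, c). b + c = a}"

lemma finite_monom_splits [simp]: "finite (monom_splits a)"
proof -
  let ?K = "Poly_Mapping.keys a"
  let ?B = "{..Max (insert 0 (Poly_Mapping.lookup a ` ?K))}"
  let ?F = "{f. \<forall>x. (x \<in> ?K \<longrightarrow> f x \<in> ?B) \<and> (x \<notin> ?K \<longrightarrow> f x = (0::nat))}"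
  have fin: "finite ?F"
    by (rule finite_set_of_finite_funs) auto
  have le: "Poly_Mapping.lookup b \<in> ?F" if "b + c = a" for b c
  proof -
    have *: "Poly_Mapping.lookup b x \<le> Poly_Mapping.lookup a x" for x
      using that by (auto simp: lookup_add)
    show ?thesis
    proof (clarify, intro conjI impI)
      fix x assume "x \<in> ?K"
      then have "Poly_Mapping.lookup a x \<le> Max (insert 0 (Poly_Mapping.lookup a ` ?K))"
        by (intro Max_ge) auto
      with *[of x] show "Poly_Mapping.lookup b x \<in> ?B"
        unfolding atMost_iff by (rule order_trans)
    next
      fix x assume "x \<notin> ?K"
      with *[of x] show "Poly_Mapping.lookup b x = 0"
        by (simp add: in_keys_iff)
    qed
  qed
  have "inj (Poly_Mapping.lookup :: (nat \<Rightarrow>\<^sub>0 nat) \<Rightarrow> nat \<Rightarrow> nat)"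
    by (rule injI) (rule poly_mapping_eqI, simp)
  then have "finite (Poly_Mapping.lookup -` ?F)"
    using fin by (intro finite_vimageI)
  moreover have "monom_splits a \<subseteq> (\<lambda>b. (b, a - b)) ` (Poly_Mapping.lookup -` ?F)"
  proof
    fix p assume "p \<in> monom_splits a"
    then obtain b c where p: "p = (b, c)" and bc: "b + c = a"
      unfolding monom_splits_def by blast
    then have "p = (b, a - b)"
      by auto
    then show "p \<in> (\<lambda>b. (b, a - b)) ` (Poly_Mapping.lookup -` ?F)"
      by (rule image_eqI) (rule vimageI2, rule le[OF bc])
  qed
  ultimately show ?thesis
    by (blast intro: finite_surj)
qed

instantiation mps :: (comm_ring_1) comm_ring_1
begin

definition zero_mps :: "'a mps" where "0 = Abs_mps (\<lambda>_. 0)"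
definition one_mps :: "'a mps" where "1 = Abs_mps (\<lambda>a. if a = 0 then 1 else 0)"
definition plus_mps :: "'a mps \<Rightarrow> 'a mps \<Rightarrow> 'a mps" where
  "f + g = Abs_mps (\<lambda>a. mps_coeff f a + mps_coeff g a)"
definition uminus_mps :: "'a mps \<Rightarrow> 'a mps" where
  "- f = Abs_mps (\<lambda>a. - mps_coeff f a)"
definition minus_mps :: "'a mps \<Rightarrow> 'a mps \<Rightarrow> 'a mps" where
  "f - g = Abs_mps (\<lambda>a. mps_coeff f a - mps_coeff g a)"
definition times_mps :: "'a mps \<Rightarrow> 'a mps \<Rightarrow> 'a mps" where
  "f * g = Abs_mps (\<lambda>a. \<Sum>(b, c)\<in>monom_splits a. mps_coeff f b * mps_coeff g c)"

lemmas mps_defs = zero_mps_def one_mps_def plus_mps_def uminus_mps_def minus_mps_def times_mps_def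

instance
proof
  fix f g h :: "'a mps"
  show "f * g * h = f * (g * h)"
  proof -
    have "(\<Sum>(b, c)\<in>monom_splits a. (\<Sum>(d, e)\<in>monom_splits b. mps_coeff f d * mps_coeff g e) * mps_coeff h c)
        = (\<Sum>(b, c)\<in>monom_splits a. mps_coeff f b * (\<Sum>(d, e)\<in>monom_splits c. mps_coeff g d * mps_coeff h e))"
      for a
    proof -
      let ?L = "SIGMA x:monom_splits a. monom_splits (fst x)"
      let ?R = "SIGMA x:monom_splits a. monom_splits (snd x)"
      have "(\<Sum>(b, c)\<in>monom_splits a. (\<Sum>(d, e)\<in>monom_splits b. mps_coeff f d * mps_coeff g e) * mps_coeff h c)
          = (\<Sum>(x, y)\<in>?L. mps_coeff f (fst y) * mps_coeff g (snd y) * mps_coeff h (snd x))"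
        by (subst sum.Sigma[symmetric]) (auto simp: sum_distrib_right case_prod_unfold)
      also have "\<dots> = (\<Sum>(x, y)\<in>?R. mps_coeff f (fst x) * (mps_coeff g (fst y) * mps_coeff h (snd y)))"
        by (rule sum.reindex_bij_witness[of _
              "\<lambda>(x, y). ((fst x + fst y, snd y), (fst x, fst y))"
              "\<lambda>(x, y). ((fst y, snd y + snd x), (snd y, snd x))"])
           (auto simp: monom_splits_def ac_simps)
      also have "\<dots> = (\<Sum>(b, c)\<in>monom_splits a. mps_coeff f b * (\<Sum>(d, e)\<in>monom_splits c. mps_coeff g d * mps_coeff h e))"
        by (subst sum.Sigma[symmetric]) (auto simp: sum_distrib_left case_prod_unfold)
      finally show ?thesis .
    qed
    then show ?thesis by (simp add: times_mps_def)
  qed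
  show "f * g = g * f"
  proof -
    have "(\<Sum>(b, c)\<in>monom_splits a. mps_coeff f b * mps_coeff g c)
        = (\<Sum>(b, c)\<in>monom_splits a. mps_coeff g b * mps_coeff f c)" for a
      by (rule sum.reindex_bij_witness[of _ prod.swap prod.swap])
         (auto simp: monom_splits_def ac_simps)
    then show ?thesis by (simp add: times_mps_def)
  qed
  show "1 * f = f"
  proof -
    have "(\<Sum>(b, c)\<in>monom_splits a. (if b = 0 then 1 else 0) * mps_coeff f c) = mps_coeff f a" for a
    proof -
      have "(\<Sum>(b, c)\<in>monom_splits a. (if b = 0 then 1 else 0) * mps_coeff f c)
          = (\<Sum>(b, c)\<in>{(0 :: nat \<Rightarrow>\<^sub>0 nat, a)}. (if b = 0 then 1 else 0) * mps_coeff f c)"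
        by (rule sum.mono_neutral_right[OF finite_monom_splits])
           (auto simp: monom_splits_def split: if_splits)
      then show ?thesis by simp
    qed
    then show ?thesis by (simp add: mps_eq_iff one_mps_def times_mps_def)
  qed
  show "(f + g) * h = f * h + g * h"
    by (simp add: plus_mps_def times_mps_def mps_eq_iff case_prod_unfold
        distrib_right sum.distrib)
  show "(0::'a mps) \<noteq> 1"
    by (auto simp: mps_eq_iff mps_defs)
qed (auto simp: mps_eq_iff mps_defs)

end

definition mps_scale :: "'a::comm_ring_1 \<Rightarrow> 'a mps \<Rightarrow> 'a mps" where
  "mps_scale c f = Abs_mps (\<lambda>a. c * mps_coeff f a)"

global_interpretation mps: vector_space "mps_scale :: 'a::field \<Rightarrow> 'a mps \<Rightarrow> 'a mps"
  by unfold_locales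
    (simp_all add: mps_eq_iff mps_scale_def plus_mps_def algebra_simps)


section \<open>Partitions\<close>

text \<open>
  Partitions are exponent sequences too, indexed from 0: the part written \<open>\<lambda>\<^sub>i\<close> (with \<open>i \<ge> 1\<close>)
  is \<open>lookup \<lambda> (i - 1)\<close>.
\<close>

definition partitions :: "(nat \<Rightarrow>\<^sub>0 nat) set" where
  "partitions = {l. antimono (Poly_Mapping.lookup l)}"

definition psize :: "(nat \<Rightarrow>\<^sub>0 nat) \<Rightarrow> nat" where
  "psize l = (\<Sum>k\<in>Poly_Mapping.keys l. Poly_Mapping.lookup l k)"

definition plength :: "(nat \<Rightarrow>\<^sub>0 nat) \<Rightarrow> nat" where
  "plength l = card (Poly_Mapping.keys l)"

definition pmult :: "nat \<Rightarrow> (nat \<Rightarrow>\<^sub>0 nat) \<Rightarrow> nat" where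
  "pmult i l = card {k. Poly_Mapping.lookup l k = i}"

text \<open>Every part is at most \<^term>\<open>psize l\<close>, so the remaining factors of the product over all
  \<open>i \<ge> 1\<close> are 1.\<close>

definition pzee :: "(nat \<Rightarrow>\<^sub>0 nat) \<Rightarrow> nat" where
  "pzee l = (\<Prod>i=1..psize l. i ^ pmult i l * fact (pmult i l))"

definition dominated :: "(nat \<Rightarrow>\<^sub>0 nat) \<Rightarrow> (nat \<Rightarrow>\<^sub>0 nat) \<Rightarrow> bool" where
  "dominated m l \<longleftrightarrow> psize m = psize l \<and>
     (\<forall>i. (\<Sum>k<i. Poly_Mapping.lookup m k) \<le> (\<Sum>k<i. Poly_Mapping.lookup l k))"

definition pones :: "nat \<Rightarrow> (nat \<Rightarrow>\<^sub>0 nat)" where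
  "pones N = (\<Sum>k<N. Poly_Mapping.single k 1)"


section \<open>Symmetric functions\<close>

text \<open>
  Power series that are invariant under all permutations of the variables and of bounded degree
  (\<^const>\<open>psize\<close> of an exponent sequence is the total degree of the monomial).
\<close>

definition symmetric_functions :: "'a::comm_ring_1 mps set" where
  "symmetric_functions = {f.
     (\<forall>\<pi> a. bij \<pi> \<longrightarrow> mps_coeff f (Poly_Mapping.map_key \<pi> a) = mps_coeff f a) \<and>
     (\<exists>d. \<forall>a. mps_coeff f a \<noteq> 0 \<longrightarrow> psize a \<le> d)}"

definition monomial_sym :: "(nat \<Rightarrow>\<^sub>0 nat) \<Rightarrow> 'a::comm_ring_1 mps" where
  "monomial_sym m = Abs_mps (\<lambda>a. if \<exists>\<pi>. bij \<pi> \<and> a = Poly_Mapping.map_key \<pi> m then 1 else 0)"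

text \<open>\<open>p\<^sub>i = \<Sum>\<^sub>k x\<^sub>k\<^sup>i\<close>; meaningful for \<open>i \<ge> 1\<close> only.\<close>

definition power_sum :: "nat \<Rightarrow> 'a::comm_ring_1 mps" where
  "power_sum i = Abs_mps (\<lambda>a. if \<exists>k. a = Poly_Mapping.single k i then 1 else 0)"

definition power_sum_part :: "(nat \<Rightarrow>\<^sub>0 nat) \<Rightarrow> 'a::comm_ring_1 mps" where
  "power_sum_part l = (\<Prod>k\<in>Poly_Mapping.keys l. power_sum (Poly_Mapping.lookup l k))"


section \<open>Jack symmetric functions\<close>

type_synonym ratfun = "rat poly fract"

definition jack_alpha :: ratfun where
  "jack_alpha = Fraction_Field.Fract [:0, 1:] 1"

text \<open>
  \<open>power_sum_coeff f l\<close> is the coefficient of \<open>p\<^sub>l\<close> in the expansion of the symmetric function \<open>f\<close>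
  in the power sum basis.
\<close>

definition power_sum_coeff :: "ratfun mps \<Rightarrow> (nat \<Rightarrow>\<^sub>0 nat) \<Rightarrow> ratfun" where
  "power_sum_coeff f l = mps.representation (power_sum_part ` partitions) f (power_sum_part l)"

text \<open>
  The bilinear form with \<open>\<langle>p\<^sub>l, p\<^sub>m\<rangle> = \<delta>\<^sub>l\<^sub>m z\<^sub>l \<alpha>\<^bsup>\<ell>(l)\<^esup>\<close>; the sum is over the finitely many \<open>l\<close> that
  occur in the expansion of \<open>f\<close>.
\<close>

definition jack_inner :: "ratfun mps \<Rightarrow> ratfun mps \<Rightarrow> ratfun" where
  "jack_inner f g =
     (\<Sum>l\<in>{l \<in> partitions. power_sum_coeff f l \<noteq> 0}.
        power_sum_coeff f l * power_sum_coeff g l * of_nat (pzee l) * jack_alpha ^ plength l)"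

text \<open>
  \<open>J\<close> is the family of Jack symmetric functions and \<open>v l m\<close> is the coefficient of \<open>m\<^sub>m\<close> in \<open>J\<^sub>l\<close>.
  These conditions determine \<open>J l\<close> for every partition \<open>l\<close>, and \<open>v l m\<close> for all
  partitions \<open>m \<le> l\<close>; other values are irrelevant.  Dominance includes equality
  of sizes, so the sum ranges over finitely many partitions.
\<close>

definition jack_family ::
  "((nat \<Rightarrow>\<^sub>0 nat) \<Rightarrow> ratfun mps) \<Rightarrow> ((nat \<Rightarrow>\<^sub>0 nat) \<Rightarrow> (nat \<Rightarrow>\<^sub>0 nat) \<Rightarrow> ratfun) \<Rightarrow> bool" where
  "jack_family J v \<longleftrightarrow>
     (\<forall>l\<in>partitions. J l \<in> symmetric_functions) \<and>
     (\<forall>l\<in>partitions. \<forall>m\<in>partitions. l \<noteq> m \<longrightarrow> jack_inner (J l) (J m) = 0) \<and>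
     (\<forall>l\<in>partitions. J l =
        (\<Sum>m\<in>{m \<in> partitions. dominated m l}. mps_scale (v l m) (monomial_sym m))) \<and>
     (\<forall>l\<in>partitions. v l (pones (psize l)) = fact (psize l))"

end

theory Submission
  imports Defs "HOL-Combinatorics.Permutations"
begin

text \<open>
  The argument follows Knop and Sahi. In \<open>n > N\<close> variables the Cherednik operators \<open>xi n i\<close> have
  joint eigenfunctions \<open>F\<^sub>\<eta>\<close> indexed by compositions \<open>\<eta>\<close>. Suitably normalized, they satisfy a recursion
  on \<open>|\<eta>|\<close> whose coefficients lie in \<open>\<int>[\<alpha>]\<close>. Lowering every part of a partition \<open>\<lambda>\<close> with \<open>m\<close> parts by
  one gives a composition \<open>\<eta>\<close>, and symmetrizing \<open>x\<^sub>1 \<cdots> x\<^sub>m F\<^sub>\<eta>\<close> over the choices of the first \<open>m\<close>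
  variables gives a symmetric polynomial with coefficients in \<open>\<int>[\<alpha>]\<close> whose coefficient at
  \<open>x\<^sub>1 \<cdots> x\<^sub>N\<close> is \<open>N!\<close>.

  This polynomial is an eigenfunction of the Laplace-Beltrami operator, which is triangular on monomial
  symmetric functions and, by its expression in power sums, self-adjoint for the Jack scalar product.
  Together with the shape of the expansion this forces it to be a multiple of \<open>J\<^sub>\<lambda>\<close>, and the
  normalization makes the factor 1. Instead of the dominance order it suffices to compare
  \<open>\<Sum> \<lambda>\<^sub>i\<^sup>2\<close>, which is strictly monotone in dominance and is read off from the leading
  coefficient in \<open>\<alpha>\<close> of the Laplace-Beltrami eigenvalue.
\<close>

text \<open>Integrality is at risk wherever a scalar has to be divided out: intertwiners produce
  factors in \<alpha>, and full symmetrization overcounts. Both are avoided by carrying along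
  symmetry in the variables not yet used. A chain of intertwiners through zero entries then
  collapses to a sum, and summing over coset representatives replaces averaging.

  A single Cherednik operator does not survive symmetrization, but the sum of their squares commutes
  with permutations and reduces to the Laplace-Beltrami operator on symmetric polynomials. Sums of
  squares need not separate two partitions; this is harmless because the polynomial has only one
  orbit of monomials at its top level.

  Q(\<alpha>) is treated as an ordered field in which \<alpha> is infinitely large, so that
  comparing coefficients in \<alpha> and proving the scalar product definite both become matters of
  inequalities.\<close>

type_synonym mon = "nat \<Rightarrow>\<^sub>0 nat"

abbreviation lookup :: "('a \<Rightarrow>\<^sub>0 'b::zero) \<Rightarrow> 'a \<Rightarrow> 'b" where
  "lookup \<equiv> Poly_Mapping.lookup"

abbreviation keys :: "('a \<Rightarrow>\<^sub>0 'b::zero) \<Rightarrow> 'a set" where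
  "keys \<equiv> Poly_Mapping.keys"

abbreviation single :: "'a \<Rightarrow> 'b::zero \<Rightarrow> ('a \<Rightarrow>\<^sub>0 'b)" where
  "single \<equiv> Poly_Mapping.single"

abbreviation map_key :: "('b \<Rightarrow> 'a) \<Rightarrow> ('a \<Rightarrow>\<^sub>0 'c::zero) \<Rightarrow> ('b \<Rightarrow>\<^sub>0 'c)" where
  "map_key \<equiv> Poly_Mapping.map_key"

abbreviation update :: "'a \<Rightarrow> 'b::zero \<Rightarrow> ('a \<Rightarrow>\<^sub>0 'b) \<Rightarrow> ('a \<Rightarrow>\<^sub>0 'b)" where
  "update \<equiv> Poly_Mapping.update"

abbreviation adj :: "nat \<Rightarrow> nat \<Rightarrow> nat" where
  "adj i \<equiv> Transposition.transpose i (Suc i)"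

lemma lookup_map_key: "bij \<pi> \<Longrightarrow> lookup (map_key \<pi> a) i = lookup a (\<pi> i)"
  by (simp add: map_key.rep_eq bij_is_inj)

lemma mps_eqI: "(\<And>a. mps_coeff f a = mps_coeff g a) \<Longrightarrow> f = g"
  by (simp add: mps_eq_iff)

section \<open>Operators on power series\<close>

lemma coeff_simps [simp]:
  "mps_coeff 0 a = 0"
  "mps_coeff (f + g) a = mps_coeff f a + mps_coeff g a"
  "mps_coeff (f - g) a = mps_coeff f a - mps_coeff g a"
  "mps_coeff (- f) a = - mps_coeff f a"
  by (simp_all add: zero_mps_def plus_mps_def minus_mps_def uminus_mps_def)

lemma coeff_one: "mps_coeff 1 a = (if a = 0 then 1 else 0)"
  by (simp add: one_mps_def)

lemma coeff_scale [simp]: "mps_coeff (mps_scale c f) a = c * mps_coeff f a"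
  by (simp add: mps_scale_def)

lemma coeff_sum: "mps_coeff (sum f A) a = (\<Sum>x\<in>A. mps_coeff (f x) a)"
  by (induction A rule: infinite_finite_induct) auto

lemma coeff_mult: "mps_coeff (f * g) a = (\<Sum>(b, c)\<in>monom_splits a. mps_coeff f b * mps_coeff g c)"
  by (simp add: times_mps_def)

definition cst :: "'a::comm_ring_1 \<Rightarrow> 'a mps" where
  "cst c = mps_scale c 1"

definition X :: "nat \<Rightarrow> 'a::comm_ring_1 mps" where
  "X i = Abs_mps (\<lambda>a. if a = single i 1 then 1 else 0)"

lemma mps_scale_mult_left: "mps_scale c f * g = mps_scale c (f * g)"
  by (rule mps_eqI) (simp add: coeff_mult sum_distrib_left case_prod_unfold mult.assoc)

lemma cst_mult: "cst c * f = mps_scale c f"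
  by (simp add: cst_def mps_scale_mult_left)

lemma coeff_cst_mult [simp]: "mps_coeff (cst c * f) a = c * mps_coeff f a"
  by (simp add: cst_mult)

lemma cst_hom:
  "cst 0 = 0" "cst 1 = 1" "cst (a + b) = cst a + cst b" "cst (a - b) = cst a - cst b"
  "cst (a * b) = cst a * cst b" "cst (- a) = - cst a"
  by (rule mps_eqI; simp add: cst_def coeff_one algebra_simps mps_scale_mult_left)+

lemma cst_of_nat: "cst (of_nat n) = of_nat n"
  by (induction n) (simp_all add: cst_hom)

lemma coeff_X_mult:
  "mps_coeff (X i * f) b = (if lookup b i = 0 then 0 else mps_coeff f (b - single i 1))"
proof -
  have eq: "(\<Sum>(c, d)\<in>monom_splits b. mps_coeff (X i) c * mps_coeff f d)
      = (\<Sum>(c, d)\<in>{p \<in> monom_splits b. fst p = single i 1}. mps_coeff f d)"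
    by (rule sum.mono_neutral_cong_right) (auto simp: X_def split: if_splits)
  show ?thesis
  proof (cases "lookup b i = 0")
    case True
    then have empty: "{p \<in> monom_splits b. fst p = single i 1} = {}"
      by (auto simp: monom_splits_def lookup_add lookup_single)
    show ?thesis
      unfolding coeff_mult eq empty using True by simp
  next
    case False
    then have "single i 1 + (b - single i 1) = b"
      by (intro poly_mapping_eqI) (auto simp: lookup_add lookup_minus lookup_single when_def)
    then have sing: "{p \<in> monom_splits b. fst p = single i 1} = {(single i 1, b - single i 1)}"
      by (auto simp: monom_splits_def)
    show ?thesis
      unfolding coeff_mult eq sing using False by simp
  qed
qed

lemma coeff_X_mult_add: "mps_coeff (X i * f) (b + single i 1) = mps_coeff f b"
  by (simp add: coeff_X_mult lookup_add)

text \<open>Comparing coefficients along the ray \<open>b, b + e\<^sub>i - e\<^sub>j, b + 2 e\<^sub>i - 2 e\<^sub>j, \<dots>\<close>, which leaves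
  the exponent sequences after finitely many steps.\<close>

lemma X_diff_mult_eq_0:
  assumes "i \<noteq> j" and eq: "(X i - X j) * f = 0"
  shows "f = 0"
proof (rule mps_eqI)
  have step: "mps_coeff f b = (if lookup b j = 0 then 0 else mps_coeff f (b + single i 1 - single j 1))" for b
  proof -
    have "mps_coeff ((X i - X j) * f) (b + single i 1) = 0"
      by (simp add: eq)
    then show ?thesis
      using \<open>i \<noteq> j\<close> by (simp add: left_diff_distrib coeff_X_mult_add)
         (simp add: coeff_X_mult lookup_add lookup_single)
  qed
  show "mps_coeff f b = mps_coeff 0 b" for b
  proof (induction "lookup b j" arbitrary: b)
    case 0
    then show ?case by (simp add: step[of b])
  next
    case (Suc x)
    then have "x = lookup (b + single i 1 - single j 1) j"
      using \<open>i \<noteq> j\<close> by (simp add: lookup_add lookup_minus lookup_single)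
    then show ?case
      using Suc.hyps by (simp add: step[of b])
  qed
qed

lemma X_diff_cancel:
  assumes "i \<noteq> j" and "(X i - X j) * f = (X i - X j) * g"
  shows "f = g"
  using X_diff_mult_eq_0[OF assms(1), of "f - g"] assms(2) by (simp add: right_diff_distrib)

section \<open>Relabelling of the variables: x_i becomes x_{\<pi> i}\<close>

definition pm :: "(nat \<Rightarrow> nat) \<Rightarrow> 'a mps \<Rightarrow> 'a mps" where
  "pm \<pi> f = Abs_mps (\<lambda>a. mps_coeff f (map_key \<pi> a))"

lemma coeff_pm: "mps_coeff (pm \<pi> f) a = mps_coeff f (map_key \<pi> a)"
  by (simp add: pm_def)

lemma pm_simps [simp]:
  "pm \<pi> 0 = 0" "pm \<pi> (f + g) = pm \<pi> f + pm \<pi> g" "pm \<pi> (f - g) = pm \<pi> f - pm \<pi> g"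
  "pm \<pi> (- f) = - pm \<pi> f"
  by (rule mps_eqI; simp add: coeff_pm)+

lemma pm_sum: "pm \<pi> (sum f A) = (\<Sum>x\<in>A. pm \<pi> (f x))"
  by (induction A rule: infinite_finite_induct) auto

lemma pm_id: "pm id f = f" "pm (\<lambda>x. x) f = f"
  by (simp_all add: mps_eq_iff coeff_pm id_def map_key_id)

lemma pm_comp:
  assumes "bij \<pi>" "bij \<sigma>"
  shows "pm \<pi> (pm \<sigma> f) = pm (\<pi> \<circ> \<sigma>) f"
  using assms by (simp add: mps_eq_iff coeff_pm map_key_compose bij_is_inj)

lemma map_key_comp: "bij \<pi> \<Longrightarrow> bij \<sigma> \<Longrightarrow> map_key \<sigma> (map_key \<pi> a) = map_key (\<pi> \<circ> \<sigma>) a"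
  by (simp add: map_key_compose bij_is_inj)

lemma map_key_inv [simp]:
  assumes "bij \<pi>"
  shows "map_key (inv \<pi>) (map_key \<pi> a) = a" "map_key \<pi> (map_key (inv \<pi>) b) = b"
  using assms by (simp_all add: map_key_comp bij_imp_bij_inv surj_iff[THEN iffD1, OF bij_is_surj]
      inj_iff[THEN iffD1, OF bij_is_inj] map_key_id id_def)

lemma map_key_eq_iff:
  assumes "bij \<pi>"
  shows "map_key \<pi> a = map_key \<pi> b \<longleftrightarrow> a = b"
proof
  assume "map_key \<pi> a = map_key \<pi> b"
  then have "map_key (inv \<pi>) (map_key \<pi> a) = map_key (inv \<pi>) (map_key \<pi> b)"
    by (rule arg_cong)
  then show "a = b"
    using assms by simp
qed simp

lemma map_key_single_bij:
  assumes "bij \<pi>"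
  shows "map_key \<pi> (single i c) = single (inv \<pi> i) c"
  using map_key_single[of \<pi> "inv \<pi> i" c] assms by (simp add: bij_is_inj bij_is_surj surj_f_inv_f)

lemma map_key_add: "bij \<pi> \<Longrightarrow> map_key \<pi> (a + b) = map_key \<pi> a + map_key \<pi> b"
  by (simp add: map_key_plus bij_is_inj)

lemma pm_mult:
  assumes "bij \<pi>"
  shows "pm \<pi> (f * g) = pm \<pi> f * pm \<pi> g"
proof (rule mps_eqI)
  fix a
  have inv: "bij (inv \<pi>)"
    using assms by (rule bij_imp_bij_inv)
  show "mps_coeff (pm \<pi> (f * g)) a = mps_coeff (pm \<pi> f * pm \<pi> g) a"
    unfolding coeff_pm coeff_mult
    by (rule sum.reindex_bij_witness[of _ "map_prod (map_key \<pi>) (map_key \<pi>)"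
          "map_prod (map_key (inv \<pi>)) (map_key (inv \<pi>))"])
      (use assms inv in \<open>auto simp: monom_splits_def map_key_add[symmetric]\<close>)
qed

lemma pm_one: "bij \<pi> \<Longrightarrow> pm \<pi> 1 = 1"
  using map_key_eq_iff[of \<pi> _ "0 :: mon"]
  by (intro mps_eqI) (simp add: coeff_pm coeff_one map_key_zero bij_is_inj)

lemma pm_scale: "pm \<pi> (mps_scale c f) = mps_scale c (pm \<pi> f)"
  by (rule mps_eqI) (simp add: coeff_pm)

lemma pm_cst: "bij \<pi> \<Longrightarrow> pm \<pi> (cst c) = cst c"
  by (simp add: cst_def pm_scale pm_one)

lemma pm_X: "bij \<pi> \<Longrightarrow> pm \<pi> (X i) = X (\<pi> i)"
  by (rule mps_eqI)
    (simp add: coeff_pm X_def map_key_eq_iff flip: map_key_single[of \<pi> i, OF bij_is_inj])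

lemma pm_prod: "bij \<pi> \<Longrightarrow> pm \<pi> (prod f A) = (\<Prod>x\<in>A. pm \<pi> (f x))"
  by (induction A rule: infinite_finite_induct) (auto simp: pm_one pm_mult)

lemma pm_power: "bij \<pi> \<Longrightarrow> pm \<pi> (f ^ n) = pm \<pi> f ^ n"
  by (induction n) (auto simp: pm_one pm_mult)

lemma pm_inv: "bij \<pi> \<Longrightarrow> pm (inv \<pi>) (pm \<pi> f) = f" "bij \<pi> \<Longrightarrow> pm \<pi> (pm (inv \<pi>) f) = f"
  by (simp_all add: mps_eq_iff coeff_pm)

section \<open>The Euler operators x_i d/dx_i\<close>

definition Eu :: "nat \<Rightarrow> 'a::comm_ring_1 mps \<Rightarrow> 'a mps" where
  "Eu i f = Abs_mps (\<lambda>a. of_nat (lookup a i) * mps_coeff f a)"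

lemma coeff_Eu [simp]: "mps_coeff (Eu i f) a = of_nat (lookup a i) * mps_coeff f a"
  by (simp add: Eu_def)

lemma Eu_add [simp]: "Eu i (f + g) = Eu i f + Eu i g"
  by (rule mps_eqI) (simp add: distrib_left)

lemma Eu_zero [simp]: "Eu i 0 = 0"
  by (rule mps_eqI) simp

lemma Eu_sum: "Eu i (sum f A) = (\<Sum>x\<in>A. Eu i (f x))"
  by (induction A rule: infinite_finite_induct) auto

lemma Eu_mult: "Eu i (f * g) = Eu i f * g + f * Eu i g"
proof (rule mps_eqI)
  fix a
  have "mps_coeff (Eu i f * g + f * Eu i g) a =
     (\<Sum>(b, c)\<in>monom_splits a. of_nat (lookup b i + lookup c i) * (mps_coeff f b * mps_coeff g c))"
    unfolding coeff_simps coeff_mult sum.distrib[symmetric]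
    by (rule sum.cong) (auto simp: algebra_simps)
  also have "\<dots> = (\<Sum>(b, c)\<in>monom_splits a. of_nat (lookup a i) * (mps_coeff f b * mps_coeff g c))"
    by (rule sum.cong) (auto simp: monom_splits_def lookup_add)
  finally show "mps_coeff (Eu i (f * g)) a = mps_coeff (Eu i f * g + f * Eu i g) a"
    by (simp add: coeff_mult sum_distrib_left case_prod_unfold)
qed

lemma Eu_cst [simp]: "Eu i (cst c) = 0"
  by (rule mps_eqI) (simp add: cst_def coeff_one)

lemma Eu_one [simp]: "Eu i 1 = 0"
  using Eu_cst[of i 1] by (simp add: cst_hom)

lemma Eu_cst_mult [simp]: "Eu i (cst c * f) = cst c * Eu i f"
  by (simp add: Eu_mult)

lemma Eu_X: "Eu i (X j) = (if i = j then X j else 0)"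
  by (rule mps_eqI) (auto simp: X_def lookup_single)

lemma Eu_X_power: "Eu i (X j ^ k) = (if i = j then of_nat k * X j ^ k else 0)"
  by (induction k) (auto simp: Eu_mult Eu_X algebra_simps)

lemma pm_Eu: "bij \<pi> \<Longrightarrow> pm \<pi> (Eu i f) = Eu (\<pi> i) (pm \<pi> f)"
  by (rule mps_eqI) (simp add: coeff_pm lookup_map_key)

text \<open>The divided difference \<open>(f - s\<^sub>i\<^sub>j f) / (x\<^sub>i - x\<^sub>j)\<close>; see \<open>dd_mult\<close>.\<close>

definition dd :: "nat \<Rightarrow> nat \<Rightarrow> 'a::comm_ring_1 mps \<Rightarrow> 'a mps" where
  "dd i j f = Abs_mps (\<lambda>b. let s = lookup b i + lookup b j + 1 in
     \<Sum>q\<le>min (lookup b i) (lookup b j).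
       mps_coeff f (update i (s - q) (update j q b)) - mps_coeff f (update i q (update j (s - q) b)))"

lemma map_key_transpose:
  "map_key (Transposition.transpose i j) b = update i (lookup b j) (update j (lookup b i) b)"
  by (rule poly_mapping_eqI)
    (simp add: lookup_map_key lookup_update Transposition.transpose_def)

lemma update_minus_single: "update i p (b - single i c) = update i p b"
  by (rule poly_mapping_eqI) (simp add: lookup_update lookup_minus lookup_single)

lemma update_lookup: "update i (lookup b i) b = b"
  by (rule poly_mapping_eqI) (simp add: lookup_update)

lemma update_minus_single2: "i \<noteq> j \<Longrightarrow> update i p (update j q (b - single i c)) = update i p (update j q b)"
  by (rule poly_mapping_eqI) (auto simp: lookup_update lookup_minus lookup_single)

lemma coeff_X_dd_left:
  assumes "i \<noteq> j"
  shows "mps_coeff (X i * dd i j f) b = (if lookup b i = 0 then 0 else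
    let s = lookup b i + lookup b j in \<Sum>q\<le>min (lookup b i - 1) (lookup b j).
      mps_coeff f (update i (s - q) (update j q b)) - mps_coeff f (update i q (update j (s - q) b)))"
  using assms
  by (auto simp: coeff_X_mult dd_def Let_def lookup_minus lookup_single update_minus_single2
      intro!: sum.cong)

lemma coeff_X_dd:
  assumes "i \<noteq> j"
  shows "mps_coeff (X j * dd i j f) b = (if lookup b j = 0 then 0 else
    let s = lookup b i + lookup b j in \<Sum>q\<le>min (lookup b i) (lookup b j - 1).
      mps_coeff f (update i (s - q) (update j q b)) - mps_coeff f (update i q (update j (s - q) b)))"
  using assms
  by (auto simp: coeff_X_mult dd_def Let_def lookup_minus lookup_single update_minus_single
      intro!: sum.cong)

text \<open>Multiplying by \<open>X i\<close> or by \<open>X j\<close> lowers one argument of the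
  \<open>min\<close> that bounds the sum in \<open>dd\<close>. The two resulting sums therefore
  differ by at most one term, which by antisymmetry of \<open>h\<close> is \<open>h v\<close> in
  every case.\<close>

lemma dd_mult:
  fixes f :: "'a::comm_ring_1 mps"
  assumes "i \<noteq> j"
  shows "(X i - X j) * dd i j f = f - pm (Transposition.transpose i j) f"
proof (rule mps_eqI)
  fix b :: mon
  define u v where "u = lookup b i" and "v = lookup b j"
  define h where "h q = mps_coeff f (update i (u + v - q) (update j q b))
      - mps_coeff f (update i q (update j (u + v - q) b))" for q
  have bi: "mps_coeff (X i * dd i j f) b = (if u = 0 then 0 else \<Sum>q\<le>min (u - 1) v. h q)"
    using coeff_X_dd_left[OF assms, of f b] by (simp add: Let_def h_def u_def v_def)
  have bj: "mps_coeff (X j * dd i j f) b = (if v = 0 then 0 else \<Sum>q\<le>min u (v - 1). h q)"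
    using coeff_X_dd[OF assms, of f b] by (simp add: Let_def h_def u_def v_def)
  have hu: "h v = mps_coeff f b - mps_coeff f (map_key (Transposition.transpose i j) b)"
    by (simp add: h_def map_key_transpose u_def v_def update_lookup)
  have hv: "h u = mps_coeff f (map_key (Transposition.transpose i j) b) - mps_coeff f b"
    by (simp add: h_def map_key_transpose u_def v_def update_lookup)
  have "mps_coeff ((X i - X j) * dd i j f) b = h v"
  proof (cases u v rule: linorder_cases)
    case less
    then obtain v' where v': "v = Suc v'" "u \<le> v'"
      by (cases v) auto
    have "sum h {..u} = (if u = 0 then 0 else sum h {..u - 1}) + h u"
      by (cases u) auto
    then show ?thesis
      using v' hu hv by (auto simp: left_diff_distrib bi bj min_def)
  next
    case equal
    then show ?thesis
      using hu hv by (auto simp: left_diff_distrib bi bj h_def min_def)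
  next
    case greater
    then obtain u' where u': "u = Suc u'" "v \<le> u'"
      by (cases u) auto
    have "sum h {..v} = (if v = 0 then 0 else sum h {..v - 1}) + h v"
      by (cases v) auto
    then show ?thesis
      using u' by (auto simp: left_diff_distrib bi bj min_def)
  qed
  then show "mps_coeff ((X i - X j) * dd i j f) b = mps_coeff (f - pm (Transposition.transpose i j) f) b"
    by (simp add: hu coeff_pm)
qed

text \<open>As x_i - x_j is not a zero divisor, identities for divided differences can be checked
  after clearing the denominator.\<close>

lemma dd_unique:
  assumes "i \<noteq> j" "(X i - X j) * g = f - pm (Transposition.transpose i j) f"
  shows "dd i j f = g"
  using assms dd_mult[OF assms(1), of f] X_diff_cancel[OF assms(1)] by metis

lemma dd_zero [simp]: "dd i j 0 = 0"
  by (rule mps_eqI) (simp add: dd_def)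

lemma dd_add [simp]: "dd i j (f + g) = dd i j f + dd i j g"
  by (rule mps_eqI) (simp add: dd_def Let_def sum.distrib[symmetric] algebra_simps)

lemma dd_mult_sym:
  assumes "i \<noteq> j" "pm (Transposition.transpose i j) g = g"
  shows "dd i j (g * f) = g * dd i j f"
proof (rule dd_unique[OF assms(1)])
  have "(X i - X j) * (g * dd i j f) = g * ((X i - X j) * dd i j f)"
    by (simp add: mult.left_commute)
  also have "\<dots> = g * f - pm (Transposition.transpose i j) (g * f)"
    by (simp add: dd_mult[OF assms(1)] pm_mult assms right_diff_distrib)
  finally show "(X i - X j) * (g * dd i j f) = g * f - pm (Transposition.transpose i j) (g * f)" .
qed

lemma dd_cst_mult: "i \<noteq> j \<Longrightarrow> dd i j (cst c * f) = cst c * dd i j f"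
  by (simp add: dd_mult_sym pm_cst)

lemma dd_eq_0:
  assumes "i \<noteq> j" "pm (Transposition.transpose i j) f = f"
  shows "dd i j f = 0"
  by (rule dd_unique) (use assms in auto)

lemma dd_X_left:
  assumes "i \<noteq> j"
  shows "dd i j (X i * f) = X i * dd i j f + pm (Transposition.transpose i j) f"
proof (rule dd_unique[OF assms])
  let ?s = "pm (Transposition.transpose i j) f"
  have "(X i - X j) * (X i * dd i j f + ?s) = X i * ((X i - X j) * dd i j f) + (X i - X j) * ?s"
    by (simp only: distrib_left mult.left_commute)
  also have "\<dots> = X i * (f - ?s) + (X i - X j) * ?s"
    by (simp only: dd_mult[OF assms])
  also have "\<dots> = X i * f - X j * ?s"
    by (simp only: left_diff_distrib right_diff_distrib) simp
  finally show "(X i - X j) * (X i * dd i j f + ?s) = X i * f - pm (Transposition.transpose i j) (X i * f)"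
    by (simp add: pm_mult pm_X)
qed

lemma dd_X_right:
  assumes "i \<noteq> j"
  shows "dd i j (X j * f) = X j * dd i j f - pm (Transposition.transpose i j) f"
proof (rule dd_unique[OF assms])
  let ?s = "pm (Transposition.transpose i j) f"
  have "(X i - X j) * (X j * dd i j f - ?s) = X j * ((X i - X j) * dd i j f) - (X i - X j) * ?s"
    by (simp only: right_diff_distrib mult.left_commute)
  also have "\<dots> = X j * (f - ?s) - (X i - X j) * ?s"
    by (simp only: dd_mult[OF assms])
  also have "\<dots> = X j * f - X i * ?s"
    by (simp only: left_diff_distrib right_diff_distrib) simp
  finally show "(X i - X j) * (X j * dd i j f - ?s) = X j * f - pm (Transposition.transpose i j) (X j * f)"
    by (simp add: pm_mult pm_X)
qed

lemma transpose_conj: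
  assumes "bij \<pi>"
  shows "\<pi> \<circ> Transposition.transpose i j = Transposition.transpose (\<pi> i) (\<pi> j) \<circ> \<pi>"
  using assms by (auto simp: fun_eq_iff Transposition.transpose_def bij_def inj_eq)

lemma pm_transpose_conj:
  assumes "bij \<pi>"
  shows "pm \<pi> (pm (Transposition.transpose i j) f) = pm (Transposition.transpose (\<pi> i) (\<pi> j)) (pm \<pi> f)"
  using assms by (simp add: pm_comp transpose_conj)

lemma pm_dd:
  assumes "bij \<pi>" "i \<noteq> j"
  shows "pm \<pi> (dd i j f) = dd (\<pi> i) (\<pi> j) (pm \<pi> f)"
proof -
  have ne: "\<pi> i \<noteq> \<pi> j"
    using assms by (simp add: bij_is_inj inj_eq)
  have "(X (\<pi> i) - X (\<pi> j)) * pm \<pi> (dd i j f) = pm \<pi> ((X i - X j) * dd i j f)"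
    by (simp add: pm_mult pm_X assms)
  also have "\<dots> = pm \<pi> f - pm (Transposition.transpose (\<pi> i) (\<pi> j)) (pm \<pi> f)"
    by (simp add: dd_mult assms pm_transpose_conj)
  finally show ?thesis
    using dd_unique[OF ne] by metis
qed

section \<open>Exponent sequences and partitions\<close>

text \<open>A complete invariant of exponent sequences under permutation of the variables
  (\<open>ms_eq_iff\<close>). Partitions are mostly handled through it, which avoids
  sorting.\<close>

definition ms :: "mon \<Rightarrow> nat multiset" where
  "ms a = image_mset (lookup a) (mset_set (keys a))"

definition norm2 :: "mon \<Rightarrow> nat" where
  "norm2 a = (\<Sum>k\<in>keys a. (lookup a k)\<^sup>2)"

text \<open>Exponents of the squarefree monomial with variable set \<open>S\<close>.\<close>

definition ind :: "nat set \<Rightarrow> mon" where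
  "ind S = (\<Sum>k\<in>S. single k 1)"

lemma sum_keys_superset:
  assumes "finite A" "keys a \<subseteq> A" "g 0 = 0"
  shows "(\<Sum>k\<in>keys a. g (lookup a k)) = (\<Sum>k\<in>A. g (lookup a k))"
  by (rule sum.mono_neutral_left) (use assms in \<open>auto simp: in_keys_iff\<close>)

lemma psize_superset:
  assumes "finite A" "keys a \<subseteq> A"
  shows "psize a = (\<Sum>k\<in>A. lookup a k)"
  unfolding psize_def by (rule sum_keys_superset) (use assms in auto)

lemma norm2_superset:
  assumes "finite A" "keys a \<subseteq> A"
  shows "norm2 a = (\<Sum>k\<in>A. (lookup a k)\<^sup>2)"
  unfolding norm2_def by (rule sum_keys_superset) (use assms in auto)

lemma zero_notin_ms [simp]: "0 \<notin># ms a"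
  by (auto simp: ms_def in_keys_iff)

lemma psize_eq_sum_ms: "psize a = sum_mset (ms a)"
  by (simp add: psize_def ms_def sum_unfold_sum_mset)

lemma norm2_eq_sum_ms: "norm2 a = (\<Sum>x\<in>#ms a. x\<^sup>2)"
  by (simp add: norm2_def ms_def sum_unfold_sum_mset image_mset.compositionality comp_def)

lemma size_filter_ms:
  assumes "\<not> P 0"
  shows "size (filter_mset P (ms a)) = card {k. P (lookup a k)}"
proof -
  have "{k \<in> keys a. P (lookup a k)} = {k. P (lookup a k)}"
    using assms by (auto simp: in_keys_iff) (metis gr0I)
  then show ?thesis
    by (simp add: ms_def filter_mset_image_mset)
qed

lemma count_ms: "0 < i \<Longrightarrow> count (ms a) i = card {k. lookup a k = i}"
  using size_filter_ms[of "\<lambda>x. x = i" a]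
  by (simp add: filter_eq_replicate_mset)

lemma image_mset_lookup_superset:
  assumes "finite A" "keys a \<subseteq> A"
  shows "image_mset (lookup a) (mset_set A) = ms a + replicate_mset (card A - size (ms a)) 0"
proof -
  have "A = keys a \<union> (A - keys a)"
    using assms by auto
  then have "mset_set A = mset_set (keys a) + mset_set (A - keys a)"
    using assms by (metis Diff_disjoint finite_Diff finite_keys mset_set_Union)
  moreover have "image_mset (lookup a) (mset_set (A - keys a)) = image_mset (\<lambda>_. 0) (mset_set (A - keys a))"
    by (rule image_mset_cong) (use assms in \<open>auto simp: in_keys_iff\<close>)
  ultimately show ?thesis
    using assms by (simp add: ms_def image_mset_const_eq card_Diff_subset)
qed

lemma ms_map_key:
  assumes "bij \<pi>"
  shows "ms (map_key \<pi> a) = ms a"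
proof -
  have "keys a = \<pi> ` keys (map_key \<pi> a)"
    using assms by (simp add: keys_map_key bij_is_inj bij_is_surj)
  then have "mset_set (keys a) = image_mset \<pi> (mset_set (keys (map_key \<pi> a)))"
    using assms by (metis bij_is_inj image_mset_mset_set inj_on_subset top_greatest)
  moreover have "lookup (map_key \<pi> a) = (\<lambda>x. lookup a (\<pi> x))"
    using assms by (simp add: fun_eq_iff lookup_map_key)
  ultimately show ?thesis
    by (simp add: ms_def image_mset.compositionality comp_def)
qed

text \<open>Padding both multisets with zeros up to the size of \<open>A\<close> keeps the
  permutation inside \<open>A\<close>; this is the version for polynomials that are symmetric in n
  variables only.\<close>

lemma ms_eq_imp_permutes:
  assumes "ms a = ms b" "finite A" "keys a \<subseteq> A" "keys b \<subseteq> A"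
  obtains \<pi> where "\<pi> permutes A" "a = map_key \<pi> b"
proof -
  have "image_mset (lookup a) (mset_set A) = image_mset (lookup b) (mset_set A)"
    using assms by (simp add: image_mset_lookup_superset)
  then obtain \<pi> where \<pi>: "\<pi> permutes A" "\<forall>x\<in>A. lookup a x = lookup b (\<pi> x)"
    using image_mset_eq_implies_permutes[OF \<open>finite A\<close>] by metis
  have "lookup a x = 0" "lookup b x = 0" if "x \<notin> A" for x
    using that assms by (metis in_keys_iff subsetD)+
  then have "lookup a x = lookup b (\<pi> x)" for x
    using \<pi> by (cases "x \<in> A") (auto simp: permutes_not_in)
  then have "a = map_key \<pi> b"
    using \<pi> by (intro poly_mapping_eqI) (simp add: lookup_map_key permutes_bij)
  then show ?thesis
    using \<pi> that by blast
qed

lemma ms_eq_iff: "ms a = ms b \<longleftrightarrow> (\<exists>\<pi>. bij \<pi> \<and> a = map_key \<pi> b)"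
proof
  assume "ms a = ms b"
  then obtain \<pi> where "\<pi> permutes (keys a \<union> keys b)" "a = map_key \<pi> b"
    by (rule ms_eq_imp_permutes[of a b "keys a \<union> keys b"]) auto
  then show "\<exists>\<pi>. bij \<pi> \<and> a = map_key \<pi> b"
    using permutes_bij by blast
qed (auto simp: ms_map_key)

lemma psize_map_key: "bij \<pi> \<Longrightarrow> psize (map_key \<pi> a) = psize a"
  by (simp add: psize_eq_sum_ms ms_map_key)

lemma psize_add: "psize (a + b) = psize a + psize b"
proof -
  let ?K = "keys a \<union> keys b"
  have "keys (a + b) \<subseteq> ?K"
    by (rule Poly_Mapping.keys_add)
  then show ?thesis
    by (simp add: psize_superset[of ?K] lookup_add sum.distrib)
qed

lemma psize_single [simp]: "psize (single i c) = c"
  by (simp add: psize_def)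

lemma psize_zero [simp]: "psize 0 = 0"
  by (simp add: psize_def)

lemma lookup_le_psize: "lookup a i \<le> psize a"
  by (cases "i \<in> keys a") (auto simp: psize_def in_keys_iff intro: member_le_sum)

lemma psize_eq_0_iff: "psize a = 0 \<longleftrightarrow> a = 0"
  by (metis bot_nat_0.extremum_uniqueI lookup_le_psize lookup_zero poly_mapping_eqI psize_zero)

lemma minus_single_add:
  assumes "k \<le> lookup b i"
  shows "(b - single i k) + single i k = (b :: mon)"
  using assms by (intro poly_mapping_eqI) (auto simp: lookup_add lookup_minus lookup_single when_def)

lemma keys_update_subset: "keys (update i p b) \<subseteq> insert i (keys b)"
  by (auto simp: keys_update)

lemma norm2_update2:
  assumes "i \<noteq> j"
  shows "norm2 (update i p (update j q b)) + (lookup b i)\<^sup>2 + (lookup b j)\<^sup>2 = norm2 b + p\<^sup>2 + q\<^sup>2"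
proof -
  let ?A = "insert i (insert j (keys b))"
  let ?c = "update i p (update j q b)"
  have "?A = insert i (insert j (?A - {i, j}))" by auto
  then have split: "sum g ?A = g i + (g j + sum g (?A - {i, j}))" for g :: "nat \<Rightarrow> nat"
    using assms by (metis (no_types, lifting) Diff_iff finite_Diff finite_insert finite_keys insertCI insertE sum.insert)
  have sub: "keys ?c \<subseteq> ?A" "keys b \<subseteq> ?A"
    using keys_update_subset[of i p] keys_update_subset[of j q b] by fastforce+
  have rest: "(\<Sum>k\<in>?A - {i, j}. g (lookup ?c k)) = (\<Sum>k\<in>?A - {i, j}. g (lookup b k))" for g :: "nat \<Rightarrow> nat"
    by (rule sum.cong) (auto simp: lookup_update)
  have look: "lookup ?c i = p" "lookup ?c j = q"
    using assms by (auto simp: lookup_update)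
  have fin: "finite ?A" by simp
  show "norm2 ?c + (lookup b i)\<^sup>2 + (lookup b j)\<^sup>2 = norm2 b + p\<^sup>2 + q\<^sup>2"
    unfolding norm2_superset[OF fin sub(1)] norm2_superset[OF fin sub(2)] split look
      rest[of "\<lambda>x. x\<^sup>2"] by simp
qed

lemma lookup_ind: "finite S \<Longrightarrow> lookup (ind S) k = (if k \<in> S then 1 else 0)"
  unfolding ind_def by (induction S rule: finite_induct) (auto simp: lookup_add lookup_single when_def)

lemma keys_ind: "finite S \<Longrightarrow> keys (ind S) = S"
  by (auto simp: in_keys_iff lookup_ind split: if_splits)

lemma psize_ind: "finite S \<Longrightarrow> psize (ind S) = card S"
  by (simp add: psize_def keys_ind lookup_ind)

lemma map_key_ind:
  assumes "bij \<pi>" "finite S"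
  shows "map_key \<pi> (ind S) = ind (\<pi> -` S)"
  using assms by (intro poly_mapping_eqI) (simp add: lookup_map_key lookup_ind finite_vimageI bij_is_inj)

lemma pones_eq_ind: "pones N = ind {..<N}"
  by (simp add: pones_def ind_def)

lemma initial_segment_eq_card:
  fixes D :: "nat set"
  assumes "finite D" "\<And>i j. i \<le> j \<Longrightarrow> j \<in> D \<Longrightarrow> i \<in> D"
  shows "D = {..<card D}"
proof -
  define m where "m = (LEAST i. i \<notin> D)"
  have "\<exists>i. i \<notin> D"
    using assms(1) ex_new_if_finite infinite_UNIV_nat by blast
  then have "m \<notin> D"
    unfolding m_def by (rule LeastI_ex)
  then have "D = {..<m}"
    using assms(2) not_less_Least[of _ "\<lambda>i. i \<notin> D"] unfolding m_def
    by (metis lessThan_iff linorder_not_le set_eqI)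
  then show ?thesis by simp
qed

lemma finite_lookup_ge: "0 < t \<Longrightarrow> finite {k. (t::nat) \<le> lookup l k}"
  by (rule finite_subset[of _ "keys l"]) (auto simp: in_keys_iff)

text \<open>For a decreasing sequence the level set is an initial segment. Its length is a part of
  the conjugate partition and depends on the multiset of parts alone.\<close>

lemma partition_level_set:
  assumes "l \<in> partitions" "0 < t"
  shows "t \<le> lookup l k \<longleftrightarrow> k < size (filter_mset (\<lambda>x. t \<le> x) (ms l))"
proof -
  have "antimono (lookup l)"
    using assms by (simp add: partitions_def)
  then have "{k. t \<le> lookup l k} = {..<card {k. t \<le> lookup l k}}"
    using assms by (intro initial_segment_eq_card finite_lookup_ge)
      (auto dest: antimonoD intro: order_trans)
  then show ?thesis
    using assms size_filter_ms[of "\<lambda>x. t \<le> x" l] by auto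
qed

lemma partition_ms_inj:
  assumes "l \<in> partitions" "l' \<in> partitions" "ms l = ms l'"
  shows "l = l'"
proof (rule poly_mapping_eqI)
  fix k
  have "t \<le> lookup l k \<longleftrightarrow> t \<le> lookup l' k" for t
    using assms by (cases "t = 0") (simp_all add: partition_level_set)
  then show "lookup l k = lookup l' k"
    by (metis order_antisym order_refl)
qed

lemma keys_partition:
  assumes "l \<in> partitions"
  shows "keys l = {..<plength l}"
proof -
  have "keys l = {k. 1 \<le> lookup l k}"
    by (auto simp: in_keys_iff)
  then show ?thesis
    unfolding plength_def
    using assms by (intro initial_segment_eq_card finite_keys) (auto simp: partitions_def dest: antimonoD intro: order_trans)
qed

lemma plength_le_psize: "plength l \<le> psize l"
proof -
  have "plength l = (\<Sum>k\<in>keys l. 1)"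
    by (simp add: plength_def)
  also have "\<dots> \<le> psize l"
    unfolding psize_def by (rule sum_mono) (auto simp: in_keys_iff)
  finally show ?thesis .
qed

lemma plength_eq_size: "plength l = size (ms l)"
  by (simp add: plength_def ms_def)

lemma ex_partition:
  assumes "0 \<notin># M"
  obtains l where "l \<in> partitions" "ms l = M"
proof
  define xs where "xs = rev (sorted_list_of_multiset M)"
  define l where "l = Poly_Mapping.nth xs"
  have mset: "mset xs = M"
    by (simp add: xs_def)
  have sorted: "sorted_wrt (\<ge>) xs"
    by (simp add: xs_def sorted_wrt_rev)
  have look: "lookup l k = (if k < length xs then xs ! k else 0)" for k
    by (simp add: l_def nth.rep_eq nth_default_def)
  have "xs ! k \<noteq> 0" if "k < length xs" for k
    using that assms mset by (metis nth_mem_mset)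
  then have keys: "keys l = {..<length xs}"
    by (auto simp: in_keys_iff look split: if_splits)
  show "l \<in> partitions"
    using sorted unfolding partitions_def mem_Collect_eq
    by (intro antimonoI) (auto simp: look sorted_wrt_iff_nth_less le_less)
  have "ms l = image_mset (\<lambda>k. xs ! k) (mset_set {..<length xs})"
    by (auto simp: ms_def keys look intro!: image_mset_cong)
  also have "\<dots> = mset xs"
    by (metis atLeast_upt map_nth mset_map mset_upt lessThan_atLeast0)
  finally show "ms l = M"
    using mset by simp
qed

section \<open>Partitions of N as multisets of positive parts\<close>

definition mpartitions :: "nat \<Rightarrow> nat multiset set" where
  "mpartitions N = {M. sum_mset M = N \<and> 0 \<notin># M}"

definition part :: "nat multiset \<Rightarrow> mon" where
  "part M = (THE l. l \<in> partitions \<and> ms l = M)"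

lemma part_ms [simp]: "l \<in> partitions \<Longrightarrow> part (ms l) = l"
  unfolding part_def using partition_ms_inj by blast

lemma
  assumes "0 \<notin># M"
  shows part_in_partitions: "part M \<in> partitions" and ms_part: "ms (part M) = M"
  using ex_partition[OF assms] by force+

lemma ms_in_mpartitions [simp]: "ms a \<in> mpartitions N \<longleftrightarrow> psize a = N"
  by (auto simp: mpartitions_def psize_eq_sum_ms)

lemma finite_mpartitions [simp]: "finite (mpartitions N)"
proof -
  have "mpartitions N \<subseteq> mset ` {xs. set xs \<subseteq> {..N} \<and> length xs \<le> N}"
  proof
    fix M assume M: "M \<in> mpartitions N"
    then obtain l where l: "l \<in> partitions" "ms l = M"
      using ex_partition by (auto simp: mpartitions_def)
    obtain xs where xs: "mset xs = M"
      using ex_mset by blast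
    have "x \<le> N" if "x \<in># M" for x
      using that M sum_mset.remove[OF that] by (simp add: mpartitions_def)
    moreover have "size M \<le> N"
      using l M plength_le_psize[of l] by (auto simp: plength_eq_size)
    ultimately have "xs \<in> {xs. set xs \<subseteq> {..N} \<and> length xs \<le> N}"
      using xs by (auto simp flip: set_mset_mset size_mset)
    then show "M \<in> mset ` {xs. set xs \<subseteq> {..N} \<and> length xs \<le> N}"
      using xs by blast
  qed
  then show ?thesis
    by (rule finite_subset) (intro finite_imageI finite_lists_length_le, simp)
qed

lemma bij_betw_ms: "bij_betw ms {l \<in> partitions. psize l = N} (mpartitions N)"
  by (rule bij_betw_byWitness[where f' = part])
    (auto simp: ms_part part_in_partitions mpartitions_def psize_eq_sum_ms)

lemma finite_partitions_psize [simp]: "finite {l \<in> partitions. psize l = N}"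
  using bij_betw_finite[OF bij_betw_ms] by simp

text \<open>With d = l - m, |l|^2 = |m|^2 + 2 <m, d> + |d|^2. The middle term is nonnegative by
  summation by parts, since m decreases and d has nonnegative partial sums.\<close>

lemma norm2_less_if_dominated:
  assumes "m \<in> partitions" "dominated m l" "m \<noteq> l"
  shows "norm2 m < norm2 l"
proof -
  define n where "n = Suc (Max (insert 0 (keys m \<union> keys l)))"
  have sub: "keys m \<union> keys l \<subseteq> {..<n}"
    by (auto simp: n_def less_Suc_eq_le intro!: Max_ge)
  define d where "d k = int (lookup l k) - int (lookup m k)" for k
  have dom: "0 \<le> (\<Sum>k<i. d k)" for i
    using assms(2) by (simp add: dominated_def d_def sum_subtractf flip: of_nat_sum)
  \<comment> \<open>Summation by parts in the form of an inequality that goes through induction: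
    replacing the factor m_i by the smaller m_{i+1} can only decrease the left-hand side.\<close>
  have abel: "int (lookup m i) * (\<Sum>k<i. d k) \<le> (\<Sum>k<i. int (lookup m k) * d k)" for i
  proof (induction i)
    case (Suc i)
    have "lookup m (Suc i) \<le> lookup m i"
      using assms(1) by (simp add: partitions_def antimonoD)
    then have "int (lookup m (Suc i)) * (\<Sum>k<Suc i. d k) \<le> int (lookup m i) * (\<Sum>k<Suc i. d k)"
      using dom[of "Suc i"] by (intro mult_right_mono) auto
    then show ?case
      using Suc by (simp add: distrib_left)
  qed simp
  have nonneg: "0 \<le> (\<Sum>k<n. int (lookup m k) * d k)"
    using abel[of n] dom[of n] by (meson mult_nonneg_nonneg of_nat_0_le_iff order_trans)
  obtain k where "lookup m k \<noteq> lookup l k"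
    using assms(3) by (meson poly_mapping_eqI)
  then have k: "d k \<noteq> 0" "k < n"
    using sub by (auto simp: d_def in_keys_iff subset_iff) (metis gr0I)
  have "0 < (\<Sum>k<n. (d k)\<^sup>2)"
    by (rule sum_pos2[of _ k]) (use k in auto)
  moreover have "int (norm2 l) = int (norm2 m) + 2 * (\<Sum>k<n. int (lookup m k) * d k) + (\<Sum>k<n. (d k)\<^sup>2)"
    using sub by (simp add: norm2_superset[of "{..<n}"] sum_distrib_left flip: sum.distrib)
      (auto simp: d_def power2_eq_square algebra_simps intro!: sum.cong)
  ultimately show ?thesis
    using nonneg by linarith
qed

section \<open>Cherednik operators\<close>

text \<open>The part of the Cherednik operator that does not depend on the order of the variables
  (\<open>pm_Zop\<close>). The Laplace-Beltrami operator \<open>LB\<close> is built from it as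
  well.\<close>

definition Zop :: "nat \<Rightarrow> nat \<Rightarrow> ratfun mps \<Rightarrow> ratfun mps" where
  "Zop n i f = cst jack_alpha * Eu i f + (\<Sum>j\<in>{..<n} - {i}. X j * dd i j f)"

text \<open>Since x_j \<open>dd i j f\<close> - s_ij f = x_i \<open>dd i j f\<close> - f, this is
  the usual Cherednik operator, with coefficient x_i for j < i, coefficient x_j for j > i, and the
  constant -i.\<close>

definition xi :: "nat \<Rightarrow> nat \<Rightarrow> ratfun mps \<Rightarrow> ratfun mps" where
  "xi n i f = Zop n i f - (\<Sum>j<i. pm (Transposition.transpose i j) f)"

lemma Zop_add: "Zop n i (f + g) = Zop n i f + Zop n i g"
  by (simp add: Zop_def distrib_left sum.distrib algebra_simps)

lemma Zop_zero [simp]: "Zop n i 0 = 0"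
  by (simp add: Zop_def)

lemma Zop_sum: "Zop n i (sum f A) = (\<Sum>x\<in>A. Zop n i (f x))"
  by (induction A rule: infinite_finite_induct) (auto simp: Zop_add)

lemma Zop_cst_mult: "Zop n i (cst c * f) = cst c * Zop n i f"
  by (simp add: Zop_def distrib_left sum_distrib_left dd_cst_mult mult.left_commute)

lemma xi_add: "xi n i (f + g) = xi n i f + xi n i g"
  by (simp add: xi_def Zop_add sum.distrib algebra_simps)

lemma xi_cst_mult: "xi n i (cst c * f) = cst c * xi n i f"
  by (simp add: xi_def Zop_cst_mult right_diff_distrib sum_distrib_left pm_mult pm_cst)

lemma xi_minus: "xi n i (f - g) = xi n i f - xi n i g"
  using xi_add[of n i "f - g" g] by simp

lemma pm_Zop:
  assumes "\<pi> permutes {..<n}"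
  shows "pm \<pi> (Zop n i f) = Zop n (\<pi> i) (pm \<pi> f)"
proof -
  have bij: "bij \<pi>" and inj: "inj \<pi>"
    using assms by (simp_all add: permutes_bij permutes_inj)
  have "(\<Sum>j\<in>{..<n} - {\<pi> i}. X j * dd (\<pi> i) j (pm \<pi> f))
      = (\<Sum>j\<in>\<pi> ` ({..<n} - {i}). X j * dd (\<pi> i) j (pm \<pi> f))"
    using assms inj by (simp add: image_set_diff permutes_image)
  also have "\<dots> = (\<Sum>j\<in>{..<n} - {i}. X (\<pi> j) * dd (\<pi> i) (\<pi> j) (pm \<pi> f))"
    using inj by (subst sum.reindex) (auto intro: inj_on_subset)
  also have "\<dots> = (\<Sum>j\<in>{..<n} - {i}. pm \<pi> (X j * dd i j f))"
    using bij by (intro sum.cong) (auto simp: pm_mult pm_X pm_dd)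
  finally show ?thesis
    using bij by (simp add: Zop_def pm_mult pm_cst pm_Eu pm_sum)
qed

lemma adj_permutes: "Suc i < n \<Longrightarrow> adj i permutes {..<n}"
  by (rule permutes_swap_id) auto

lemma pm_adj_adj [simp]: "pm (adj i) (pm (adj i) f) = f"
  by (simp add: pm_comp pm_id)

text \<open>The degenerate Hecke relation. Conjugation by s_i matches all transpositions of
  \<open>xi n i\<close> with those of \<open>xi n (Suc i)\<close> except the last, j = i, which
  contributes s_i s_i f = f.\<close>

lemma pm_adj_xi:
  assumes "Suc i < n"
  shows "pm (adj i) (xi n i f) = xi n (Suc i) (pm (adj i) f) + f"
proof -
  have "pm (adj i) (\<Sum>j<i. pm (Transposition.transpose i j) f)
      = (\<Sum>j<i. pm (Transposition.transpose (Suc i) j) (pm (adj i) f))"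
    unfolding pm_sum by (rule sum.cong) (auto simp: pm_transpose_conj[of "adj i"])
  then show ?thesis
    using pm_Zop[OF adj_permutes[OF assms], of i f]
    by (simp add: xi_def transpose_commute[of "Suc i" i])
qed

lemma pm_adj_xi_Suc:
  assumes "Suc i < n"
  shows "pm (adj i) (xi n (Suc i) f) = xi n i (pm (adj i) f) - f"
proof -
  have "pm (adj i) (pm (adj i) (xi n i (pm (adj i) f))) = pm (adj i) (xi n (Suc i) f) + f"
    by (simp add: pm_adj_xi[OF assms] pm_comp pm_id)
  then show ?thesis by simp
qed

lemma pm_adj_xi_other:
  assumes "Suc i < n" "l \<noteq> i" "l \<noteq> Suc i"
  shows "pm (adj i) (xi n l f) = xi n l (pm (adj i) f)"
proof -
  have l: "adj i l = l"
    using assms by simp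
  have im: "adj i ` {..<l} = {..<l}"
  proof (cases "l < i")
    case True
    then have "adj i ` {..<l} = (\<lambda>x. x) ` {..<l}"
      by (intro image_cong) (auto simp: Transposition.transpose_def)
    then show ?thesis by simp
  next
    case False
    then show ?thesis
      using assms by (intro permutes_image adj_permutes) auto
  qed
  have "pm (adj i) (\<Sum>j<l. pm (Transposition.transpose l j) f)
      = (\<Sum>j<l. pm (Transposition.transpose l (adj i j)) (pm (adj i) f))"
    unfolding pm_sum by (rule sum.cong) (auto simp: pm_transpose_conj[of "adj i"] l)
  also have "\<dots> = (\<Sum>j\<in>adj i ` {..<l}. pm (Transposition.transpose l j) (pm (adj i) f))"
    by (subst sum.reindex) (auto intro: inj_on_subset[OF inj_transpose])
  finally show ?thesis
    using pm_Zop[OF adj_permutes[OF assms(1)], of l f] by (simp add: xi_def l im)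
qed

section \<open>The affine raising operator\<close>

definition cyc :: "nat \<Rightarrow> nat \<Rightarrow> nat" where
  "cyc j i = (if i = 0 then j else if i \<le> j then i - 1 else i)"

lemma cyc_simps [simp]:
  "cyc j 0 = j" "i < j \<Longrightarrow> cyc j (Suc i) = i" "j < i \<Longrightarrow> cyc j i = i"
  by (auto simp: cyc_def)

lemma cyc_permutes: "cyc j permutes {..j}"
proof (rule bij_imp_permutes)
  show "bij_betw (cyc j) {..j} {..j}"
    by (rule bij_betw_byWitness[where f' = "\<lambda>i. if i = j then 0 else Suc i"])
      (auto simp: cyc_def)
qed auto

lemma bij_cyc [simp]: "bij (cyc j)"
  using cyc_permutes permutes_bij by blast

lemma cyc_permutes_lessThan: "j < n \<Longrightarrow> cyc j permutes {..<n}"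
  by (rule permutes_subset[OF cyc_permutes]) auto

text \<open>The operator of Knop and Sahi taking f(x_0, ..., x_L) to x_L f(x_L, x_0, ..., x_{L-1}).
  It raises the degree by one and shifts the Cherednik operators cyclically.\<close>

definition Phi :: "nat \<Rightarrow> 'a::comm_ring_1 mps \<Rightarrow> 'a mps" where
  "Phi L f = X L * pm (cyc L) f"

lemma Zop_X_mult:
  assumes "i < L"
  shows "Zop (Suc L) i (X L * g) = X L * (Zop (Suc L) i g - pm (Transposition.transpose i L) g)"
proof -
  have set: "{..<Suc L} - {i} = insert L ({..<L} - {i})"
    using assms by auto
  have "(\<Sum>j\<in>{..<L} - {i}. X j * dd i j (X L * g)) = X L * (\<Sum>j\<in>{..<L} - {i}. X j * dd i j g)"
    unfolding sum_distrib_left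
    using assms by (intro sum.cong) (auto simp: dd_mult_sym pm_X mult.left_commute)
  then show ?thesis
    using assms by (simp add: Zop_def set Eu_mult Eu_X dd_X_right distrib_left right_diff_distrib mult.left_commute)
qed

lemma Zop_X_mult_last:
  "Zop (Suc L) L (X L * g) = X L * (Zop (Suc L) L g + cst jack_alpha * g)
     + (\<Sum>j<L. pm (Transposition.transpose L j) (X L * g))"
proof -
  have set: "{..<Suc L} - {L} = {..<L}"
    by auto
  have "(\<Sum>j<L. X j * dd L j (X L * g))
      = X L * (\<Sum>j<L. X j * dd L j g) + (\<Sum>j<L. pm (Transposition.transpose L j) (X L * g))"
    unfolding sum_distrib_left sum.distrib[symmetric]
    by (rule sum.cong) (auto simp: dd_X_left pm_mult pm_X distrib_left mult.left_commute)
  then show ?thesis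
    by (simp add: Zop_def set Eu_mult Eu_X distrib_left mult.left_commute)
qed

lemma pm_cyc_Zop: "pm (cyc L) (Zop (Suc L) i f) = Zop (Suc L) (cyc L i) (pm (cyc L) f)"
  by (rule pm_Zop) (simp add: cyc_permutes_lessThan)

text \<open>The cycle sends 0 to L, so the transposition with j = 0 in
  \<open>xi (Suc L) (Suc i)\<close> becomes the one of i and L. This is exactly the correction term
  in \<open>Zop_X_mult\<close>.\<close>

lemma xi_Phi:
  assumes "i < L"
  shows "xi (Suc L) i (Phi L f) = Phi L (xi (Suc L) (Suc i) f)"
proof -
  let ?g = "pm (cyc L) f"
  have "pm (cyc L) (\<Sum>j<Suc i. pm (Transposition.transpose (Suc i) j) f)
      = pm (Transposition.transpose i L) ?g + (\<Sum>j<i. pm (Transposition.transpose i j) ?g)"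
    using assms unfolding sum.lessThan_Suc_shift pm_simps pm_sum
    by (intro arg_cong2[where f = "(+)"] sum.cong) (auto simp: pm_transpose_conj[of "cyc L"])
  moreover have "(\<Sum>j<i. pm (Transposition.transpose i j) (X L * ?g))
      = X L * (\<Sum>j<i. pm (Transposition.transpose i j) ?g)"
    unfolding sum_distrib_left using assms by (intro sum.cong) (auto simp: pm_mult pm_X)
  ultimately show ?thesis
    using assms by (simp add: xi_def Phi_def Zop_X_mult pm_cyc_Zop algebra_simps)
qed

text \<open>Here the transpositions in \<open>xi\<close> cancel all those created by moving the
  factor x_L through the divided differences; what remains is the \<alpha> from differentiating
  x_L.\<close>

lemma xi_Phi_last:
  "xi (Suc L) L (Phi L f) = Phi L (xi (Suc L) 0 f + cst jack_alpha * f)"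
  by (simp add: xi_def Phi_def Zop_X_mult_last pm_cyc_Zop pm_mult pm_cst)

text \<open>On the span of f and s_i f the Hecke relations make \<open>xi n i\<close> triangular; a
  - z is the coefficient for which the combination becomes an eigenvector with the two eigenvalues
  exchanged.\<close>

lemma xi_intertwiner:
  assumes "Suc i < n" "xi n i f = cst z * f" "xi n (Suc i) f = cst a * f"
    and "\<And>l. l < n \<Longrightarrow> l \<noteq> i \<Longrightarrow> l \<noteq> Suc i \<Longrightarrow> xi n l f = cst (u l) * f"
    and g: "g = cst (a - z) * pm (adj i) f + f"
  shows "xi n i g = cst a * g" "xi n (Suc i) g = cst z * g"
    "\<And>l. l < n \<Longrightarrow> l \<noteq> i \<Longrightarrow> l \<noteq> Suc i \<Longrightarrow> xi n l g = cst (u l) * g"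
proof -
  have 1: "xi n i (pm (adj i) f) = cst a * pm (adj i) f + f"
    using pm_adj_xi_Suc[OF assms(1), of f] assms(3) by (simp add: pm_mult pm_cst)
  have 2: "xi n (Suc i) (pm (adj i) f) = cst z * pm (adj i) f - f"
    using pm_adj_xi[OF assms(1), of f] assms(2) by (simp add: pm_mult pm_cst)
  show "xi n i g = cst a * g"
    unfolding g xi_add xi_cst_mult 1 assms(2) by (simp add: cst_hom algebra_simps)
  show "xi n (Suc i) g = cst z * g"
    unfolding g xi_add xi_cst_mult 2 assms(3) by (simp add: cst_hom algebra_simps)
  fix l assume l: "l < n" "l \<noteq> i" "l \<noteq> Suc i"
  have 3: "xi n l (pm (adj i) f) = cst (u l) * pm (adj i) f"
    using pm_adj_xi_other[OF assms(1) l(2,3), of f] assms(4)[OF l] by (simp add: pm_mult pm_cst)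
  show "xi n l g = cst (u l) * g"
    unfolding g xi_add xi_cst_mult 3 assms(4)[OF l] by (simp add: cst_hom algebra_simps)
qed

text \<open>Positivity in the ordered field \<open>rat poly fract\<close> is decided by leading
  coefficients, so \<alpha> exceeds every integer. Expressions in \<alpha> with integer coefficients
  are compared below through this fact.\<close>

lemma of_nat_less_jack_alpha: "of_nat c < jack_alpha"
proof -
  have "(of_nat c :: rat poly) < [:0, 1:]"
    by (simp add: less_poly_def of_nat_poly pos_poly_pCons)
  then show ?thesis
    unfolding jack_alpha_def Fract_of_nat_eq[symmetric] by (simp add: less_fract)
qed

lemma jack_alpha_pos: "0 < jack_alpha"
  using of_nat_less_jack_alpha[of 0] by simp

lemma jack_alpha_linear_inj:
  assumes "jack_alpha * of_nat a + of_nat c = jack_alpha * of_nat a' + of_nat c'"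
  shows "a = a'"
proof -
  have *: False if "jack_alpha * of_nat a + of_nat c = jack_alpha * of_nat a' + of_nat c'" "a < a'" for a c a' c'
  proof -
    have "jack_alpha * (of_nat a + 1) \<le> jack_alpha * of_nat a'"
      using that(2) jack_alpha_pos of_nat_mono[of "Suc a" a', where 'a = ratfun]
      by (intro mult_left_mono) auto
    then show False
      using that(1) of_nat_less_jack_alpha[of c] of_nat_0_le_iff[of c', where 'a = ratfun]
      by (simp add: distrib_left)
  qed
  then show ?thesis
    using assms by (metis linorder_neqE_nat)
qed

lemma jack_alpha_linear_inj':
  assumes "jack_alpha * of_nat a - of_nat c = jack_alpha * of_nat a' - of_nat c'"
  shows "a = a'"
  using assms jack_alpha_linear_inj[of a c' a' c] by (simp add: algebra_simps)

lemma jack_alpha_linear_neq_0: "0 < a \<Longrightarrow> jack_alpha * of_nat a + of_int c \<noteq> 0"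
  using jack_alpha_linear_inj[of a "nat c" 0 "nat (- c)"]
  by (cases c rule: int_cases2) auto

text \<open>The zero-based rank of entry i when the first n entries are sorted decreasingly, with
  ties kept in order. It is the constant term, up to sign, of the joint eigenvalue
  \<open>bar\<close>.\<close>

definition cbar :: "nat \<Rightarrow> mon \<Rightarrow> nat \<Rightarrow> nat" where
  "cbar n \<eta> i = card {j. j < n \<and>
     (j < i \<and> lookup \<eta> i \<le> lookup \<eta> j \<or> i < j \<and> lookup \<eta> i < lookup \<eta> j)}"

definition bar :: "nat \<Rightarrow> mon \<Rightarrow> nat \<Rightarrow> ratfun" where
  "bar n \<eta> i = jack_alpha * of_nat (lookup \<eta> i) - of_nat (cbar n \<eta> i)"

lemma bar_inj: "bar n \<eta> i = bar n \<eta>' i \<Longrightarrow> lookup \<eta> i = lookup \<eta>' i"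
  unfolding bar_def by (rule jack_alpha_linear_inj')

lemma cbar_adj:
  assumes "Suc i < n" "lookup \<eta> i < lookup \<eta> (Suc i)"
  shows "cbar n (map_key (adj i) \<eta>) (adj i l) = cbar n \<eta> l"
proof -
  let ?C = "\<lambda>\<eta> l j. j < n \<and>
     (j < l \<and> lookup \<eta> l \<le> lookup \<eta> j \<or> l < j \<and> lookup \<eta> l < lookup \<eta> j)"
  have less: "adj i j < adj i l \<longleftrightarrow> j < l" if "\<not> (l \<in> {i, Suc i} \<and> j \<in> {i, Suc i} \<and> l \<noteq> j)" for j l
    using that by (auto simp: Transposition.transpose_def)
  have n: "adj i j < n \<longleftrightarrow> j < n" for j
    using assms(1) by (auto simp: Transposition.transpose_def)
  have C: "?C (map_key (adj i) \<eta>) (adj i l) (adj i j) \<longleftrightarrow> ?C \<eta> l j" for j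
  proof (cases "l \<in> {i, Suc i} \<and> j \<in> {i, Suc i} \<and> l \<noteq> j")
    case True
    then show ?thesis
      using assms by (auto simp: lookup_map_key)
  next
    case False
    then have "adj i j < adj i l \<longleftrightarrow> j < l" "adj i l < adj i j \<longleftrightarrow> l < j"
      using less[of j l] less[of l j] by blast+
    then show ?thesis
      using n[of j] by (simp only: lookup_map_key bij_transpose transpose_involutory)
  qed
  have "Collect (?C (map_key (adj i) \<eta>) (adj i l)) = adj i ` Collect (?C \<eta> l)"
  proof (intro equalityI subsetI)
    fix x assume "x \<in> Collect (?C (map_key (adj i) \<eta>) (adj i l))"
    then have "adj i x \<in> Collect (?C \<eta> l)"
      using C[of "adj i x"] by simp
    then show "x \<in> adj i ` Collect (?C \<eta> l)"
      by (rule image_eqI[rotated]) simp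
  qed (use C in blast)
  then show ?thesis
    unfolding cbar_def by (simp add: card_image)
qed

lemma bar_adj:
  assumes "Suc i < n" "lookup \<eta> i < lookup \<eta> (Suc i)"
  shows "bar n (map_key (adj i) \<eta>) (adj i l) = bar n \<eta> l"
  using assms by (simp add: bar_def cbar_adj lookup_map_key)

text \<open>At position 0 an entry precedes all entries equal to it. Moved to the end it would lose
  these ties, but the added 1 restores them, so no rank changes.\<close>

lemma cbar_cyc:
  assumes "\<And>i. i < L \<Longrightarrow> lookup \<eta>' i = lookup \<eta> (Suc i)" "lookup \<eta>' L = Suc (lookup \<eta> 0)" "l \<le> L"
  shows "cbar (Suc L) \<eta>' (cyc L l) = cbar (Suc L) \<eta> l"
proof -
  let ?C = "\<lambda>\<eta> l j. j < Suc L \<and>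
     (j < l \<and> lookup \<eta> l \<le> lookup \<eta> j \<or> l < j \<and> lookup \<eta> l < lookup \<eta> j)"
  have C: "?C \<eta>' (cyc L l) (cyc L j) \<longleftrightarrow> ?C \<eta> l j" for j
    using assms by (cases l; cases j) (auto simp: cyc_def)
  have "Collect (?C \<eta>' (cyc L l)) = cyc L ` Collect (?C \<eta> l)"
  proof (intro equalityI subsetI)
    fix x assume x: "x \<in> Collect (?C \<eta>' (cyc L l))"
    obtain y where y: "x = cyc L y"
      using bij_cyc by (metis bij_pointE)
    then show "x \<in> cyc L ` Collect (?C \<eta> l)"
      using x C[of y] by blast
  qed (use C in blast)
  moreover have "inj (cyc L)"
    by (simp add: bij_is_inj)
  ultimately show ?thesis
    unfolding cbar_def by (simp add: card_image inj_on_subset)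
qed

section \<open>Triangularity of the Cherednik operators\<close>

definition wt :: "nat \<Rightarrow> mon \<Rightarrow> nat" where
  "wt n a = (\<Sum>k<n. (n - k) * lookup a k)"

lemma wt_swap_less:
  assumes "i < j" "j < n" "lookup b i < lookup b j"
  shows "wt n b < wt n (map_key (Transposition.transpose i j) b)"
proof -
  let ?c = "map_key (Transposition.transpose i j) b"
  have "{..<n} = insert i (insert j ({..<n} - {i, j}))"
    using assms by auto
  then have split: "sum g {..<n} = g i + (g j + sum g ({..<n} - {i, j}))" for g :: "nat \<Rightarrow> nat"
    using assms by (metis (no_types, lifting) Diff_iff finite_Diff finite_insert finite_lessThan insertCI insertE less_irrefl sum.insert)
  have rest: "(\<Sum>k\<in>{..<n} - {i, j}. (n - k) * lookup ?c k) = (\<Sum>k\<in>{..<n} - {i, j}. (n - k) * lookup b k)"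
    by (rule sum.cong) (auto simp: lookup_map_key)
  obtain d where d: "n - i = (n - j) + Suc d"
    using assms by (intro that[of "j - i - 1"]) auto
  obtain e where e: "lookup b j = lookup b i + Suc e"
    using assms by (metis add_Suc_right less_imp_Suc_add)
  show ?thesis
    unfolding wt_def split rest by (simp add: lookup_map_key d e algebra_simps)
qed

lemma wt_le: "wt n a \<le> n * psize a"
proof -
  have "(\<Sum>k<n. lookup a k) = (\<Sum>k\<in>keys a \<inter> {..<n}. lookup a k)"
    by (rule sum.mono_neutral_right) (auto simp: in_keys_iff)
  also have "\<dots> \<le> psize a"
    unfolding psize_def by (rule sum_mono2) auto
  finally have "(\<Sum>k<n. lookup a k) \<le> psize a" .
  moreover have "wt n a \<le> (\<Sum>k<n. n * lookup a k)"
    unfolding wt_def by (rule sum_mono) auto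
  ultimately show ?thesis
    by (metis le_trans mult_le_mono2 sum_distrib_left)
qed

lemma norm2_le: "norm2 a \<le> psize a * psize a"
proof -
  have "norm2 a \<le> (\<Sum>k\<in>keys a. psize a * lookup a k)"
    unfolding norm2_def by (rule sum_mono) (auto simp: power2_eq_square lookup_le_psize)
  then show ?thesis
    by (simp add: psize_def sum_distrib_left)
qed

lemma spread_square_less:
  fixes q u v :: nat
  assumes "q < u" "q < v"
  shows "u\<^sup>2 + v\<^sup>2 < (u + v - q)\<^sup>2 + q\<^sup>2"
proof -
  obtain s t where "u = q + Suc s" "v = q + Suc t"
    using assms by (metis add_Suc_right less_imp_Suc_add)
  then show ?thesis
    by (simp add: power2_eq_square algebra_simps)
qed

text \<open>Every term of the divided difference with q below both exponents comes from a more
  unequal pair with the same sum, hence from larger \<open>norm2\<close>, where f vanishes. At most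
  the term with q equal to the exponent of x_i survives.\<close>

lemma coeff_X_dd_maximal:
  assumes "i \<noteq> j" and max: "\<And>a. norm2 b < norm2 a \<Longrightarrow> mps_coeff f a = 0"
  shows "mps_coeff (X j * dd i j f) b =
    (if lookup b i < lookup b j
     then mps_coeff f (map_key (Transposition.transpose i j) b) - mps_coeff f b else 0)"
proof -
  define u v where "u = lookup b i" and "v = lookup b j"
  define h where "h q = mps_coeff f (update i (u + v - q) (update j q b))
      - mps_coeff f (update i q (update j (u + v - q) b))" for q
  have h0: "h q = 0" if "q < u" "q < v" for q
  proof -
    note * = spread_square_less[OF that]
    have "norm2 b < norm2 (update i (u + v - q) (update j q b))"
      using norm2_update2[OF assms(1), of "u + v - q" q b] * by (simp add: u_def v_def)
    moreover have "norm2 b < norm2 (update i q (update j (u + v - q) b))"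
      using norm2_update2[OF assms(1), of q "u + v - q" b] * by (simp add: u_def v_def)
    ultimately show ?thesis
      by (simp add: h_def max)
  qed
  have hu: "h u = mps_coeff f (map_key (Transposition.transpose i j) b) - mps_coeff f b"
    by (simp add: h_def map_key_transpose u_def v_def update_lookup)
  have eq: "mps_coeff (X j * dd i j f) b = (if v = 0 then 0 else \<Sum>q\<le>min u (v - 1). h q)"
    using coeff_X_dd[OF assms(1), of f b] by (simp add: Let_def h_def u_def v_def)
  show ?thesis
  proof (cases "u < v")
    case True
    have "(\<Sum>q\<le>min u (v - 1). h q) = (\<Sum>q\<in>{u}. h q)"
      using True h0 by (intro sum.mono_neutral_right) auto
    then show ?thesis
      using True hu by (simp add: eq flip: u_def v_def)
  next
    case False
    have "v = 0 \<or> (\<Sum>q\<le>min u (v - 1). h q) = 0"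
    proof (cases "v = 0")
      case False
      then have "q < v" if "q \<le> min u (v - 1)" for q
        using that by arith
      then show ?thesis
        using \<open>\<not> u < v\<close> h0 by (intro disjI2 sum.neutral) (auto simp: not_less less_le_trans)
    qed simp
    then show ?thesis
      using False by (auto simp add: eq simp flip: u_def v_def)
  qed
qed

text \<open>The operators \<open>xi n i\<close> are triangular; \<open>norm2\<close> stands in for the dominance order on the
  sorted exponents, and \<open>wt\<close> orders the rearrangements of a fixed partition.\<close>

lemma coeff_xi_maximal:
  assumes "i < n"
    and max: "\<And>a. norm2 b < norm2 a \<or> ms a = ms b \<and> wt n b < wt n a \<Longrightarrow> mps_coeff f a = 0"
  shows "mps_coeff (xi n i f) b = bar n b i * mps_coeff f b"
proof -
  define t where "t j = mps_coeff f (map_key (Transposition.transpose i j) b)" for j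
  define C where "C = {j. j < n \<and> (j < i \<and> lookup b i \<le> lookup b j \<or> i < j \<and> lookup b i < lookup b j)}"
  \<comment> \<open>In both cases the swap moves the larger entry to the front and so increases
    \<open>wt\<close>.\<close>
  have t0: "t j = 0" if "i < j \<and> lookup b i < lookup b j \<or> j < i \<and> lookup b j < lookup b i" "j < n" for j
  proof -
    have "wt n b < wt n (map_key (Transposition.transpose i j) b)"
      using that wt_swap_less[of i j n b] wt_swap_less[of j i n b] \<open>i < n\<close>
      by (auto simp: transpose_commute)
    then show ?thesis
      unfolding t_def by (intro max) (simp add: ms_map_key)
  qed
  have same: "t j = mps_coeff f b" if "lookup b i = lookup b j" for j
    unfolding t_def by (metis map_key_transpose that update_lookup)
  have set: "({..<n} - {i}) \<inter> {j. j < i} = {..<i}"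
    using \<open>i < n\<close> by auto
  \<comment> \<open>The transposition sum is distributed over the j of the divided differences. Then
    each j contributes minus the coefficient of f exactly when it is counted in
    \<open>cbar\<close>.\<close>
  have "(\<Sum>j\<in>{..<n} - {i}. mps_coeff (X j * dd i j f) b) - (\<Sum>j<i. t j)
      = (\<Sum>j\<in>{..<n} - {i}. mps_coeff (X j * dd i j f) b - (if j < i then t j else 0))"
    unfolding sum_subtractf sum.inter_restrict[symmetric, OF finite_Diff[OF finite_lessThan]]
    using set by (simp add: Int_def conj_commute sum.If_cases)
  also have "\<dots> = (\<Sum>j\<in>{..<n} - {i}. if j \<in> C then - mps_coeff f b else 0)"
  proof (rule sum.cong)
    fix j assume j: "j \<in> {..<n} - {i}"
    then have *: "mps_coeff (X j * dd i j f) b = (if lookup b i < lookup b j then t j - mps_coeff f b else 0)"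
      unfolding t_def by (intro coeff_X_dd_maximal) (auto intro: max)
    have "j < n" "j \<noteq> i"
      using j by auto
    consider "lookup b i < lookup b j" | "lookup b i = lookup b j" | "lookup b j < lookup b i"
      by linarith
    then show "mps_coeff (X j * dd i j f) b - (if j < i then t j else 0)
        = (if j \<in> C then - mps_coeff f b else 0)"
    proof cases
      case 1
      then show ?thesis
        using \<open>j < n\<close> \<open>j \<noteq> i\<close> * t0[of j] by (simp add: C_def)
    next
      case 2
      then show ?thesis
        using \<open>j < n\<close> \<open>j \<noteq> i\<close> * same[of j] by (simp add: C_def)
    next
      case 3
      then show ?thesis
        using \<open>j < n\<close> \<open>j \<noteq> i\<close> * t0[of j] by (simp add: C_def)
    qed
  qed auto
  also have "\<dots> = - of_nat (card C) * mps_coeff f b"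
  proof -
    have "({..<n} - {i}) \<inter> C = C"
      by (auto simp: C_def)
    then show ?thesis
      by (simp add: sum.If_cases)
  qed
  finally show ?thesis
    by (simp add: xi_def Zop_def coeff_sum coeff_pm bar_def cbar_def C_def t_def algebra_simps)
qed

text \<open>At a maximal offending exponent c the operators act diagonally with eigenvalues
  \<open>bar n c i\<close>. Comparison with the eigenvalues of f gives c = \<eta>, which does not
  offend.\<close>

lemma xi_eigenvector_support:
  assumes supp: "\<And>b. mps_coeff f b \<noteq> 0 \<Longrightarrow> keys b \<subseteq> {..<n} \<and> psize b = N"
    and \<eta>: "keys \<eta> \<subseteq> {..<n}"
    and eig: "\<And>i. i < n \<Longrightarrow> xi n i f = cst (bar n \<eta> i) * f"
    and b: "mps_coeff f b \<noteq> 0"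
  shows "norm2 b < norm2 \<eta> \<or> ms b = ms \<eta>"
proof (rule ccontr)
  let ?bad = "\<lambda>b. mps_coeff f b \<noteq> 0 \<and> \<not> (norm2 b < norm2 \<eta> \<or> ms b = ms \<eta>)"
  \<comment> \<open>Encodes the lexicographic order on (\<open>norm2\<close>, \<open>wt\<close>): on
    the support \<open>wt\<close> is at most n * N, so the factor Suc (n * N) lets
    \<open>norm2\<close> dominate.\<close>
  define \<mu> where "\<mu> b = norm2 b * Suc (n * N) + wt n b" for b
  assume "\<not> ?thesis"
  then have "?bad b"
    using b by simp
  moreover have "\<forall>b. ?bad b \<longrightarrow> \<mu> b < Suc ((N * N) * Suc (n * N) + n * N)"
    using supp norm2_le wt_le unfolding \<mu>_def less_Suc_eq_le by (metis add_mono mult_le_mono1)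
  ultimately obtain c where c: "?bad c" and max: "\<And>a. ?bad a \<Longrightarrow> \<mu> a \<le> \<mu> c"
    using ex_has_greatest_nat[of ?bad b \<mu>] by blast
  have c_supp: "keys c \<subseteq> {..<n}" "psize c = N"
    using supp c by auto
  have wt_c: "wt n c \<le> n * N"
    using wt_le[of n c] c_supp by simp
  have top: "mps_coeff f a = 0" if a: "norm2 c < norm2 a \<or> ms a = ms c \<and> wt n c < wt n a" for a
  proof (rule ccontr)
    assume nz: "mps_coeff f a \<noteq> 0"
    have "norm2 c \<le> norm2 a"
      using a by (auto simp: norm2_eq_sum_ms)
    moreover have "norm2 a \<noteq> norm2 \<eta>" if "norm2 c < norm2 a"
      using that c by simp
    ultimately have "?bad a"
      using nz a c by (auto simp: norm2_eq_sum_ms)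
    then have le: "\<mu> a \<le> \<mu> c"
      by (rule max)
    show False
    proof (cases "norm2 c < norm2 a")
      case True
      then have "Suc (norm2 c) * Suc (n * N) \<le> norm2 a * Suc (n * N)"
        by (intro mult_le_mono1) simp
      then show False
        using le wt_c by (simp add: \<mu>_def)
    next
      case False
      then show False
        using le a by (auto simp: \<mu>_def norm2_eq_sum_ms)
    qed
  qed
  have "lookup c i = lookup \<eta> i" for i
  proof (cases "i < n")
    case True
    have "bar n c i * mps_coeff f c = mps_coeff (xi n i f) c"
      using coeff_xi_maximal[OF True top] by simp
    also have "\<dots> = bar n \<eta> i * mps_coeff f c"
      by (simp add: eig True)
    finally show ?thesis
      using c by (intro bar_inj) auto
  next
    case False
    then show ?thesis
      using c_supp \<eta> by (metis in_keys_iff lessThan_iff subsetD)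
  qed
  then have "c = \<eta>"
    by (rule poly_mapping_eqI)
  then show False
    using c by simp
qed

section \<open>Integral nonsymmetric Jack polynomials\<close>

text \<open>Its range is Z[\<alpha>]; integrality below means membership in this range.\<close>

definition eval_alpha :: "int poly \<Rightarrow> ratfun" where
  "eval_alpha q = poly (map_poly of_int q) jack_alpha"

lemma eval_alpha_pCons [simp]: "eval_alpha (pCons a q) = of_int a + jack_alpha * eval_alpha q"
  by (simp add: eval_alpha_def map_poly_pCons)

lemma eval_alpha_0 [simp]: "eval_alpha 0 = 0"
  by (simp add: eval_alpha_def)

lemma eval_alpha_add: "eval_alpha (p + q) = eval_alpha p + eval_alpha q"
proof -
  have "map_poly of_int (p + q) = (map_poly of_int p + map_poly of_int q :: ratfun poly)"
    by (rule poly_eqI) (simp add: coeff_map_poly)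
  then show ?thesis by (simp add: eval_alpha_def)
qed

lemma eval_alpha_smult: "eval_alpha (smult a q) = of_int a * eval_alpha q"
  by (induction q) (simp_all add: algebra_simps)

lemma eval_alpha_mult: "eval_alpha (p * q) = eval_alpha p * eval_alpha q"
  by (induction p) (simp_all add: eval_alpha_add eval_alpha_smult algebra_simps)

lemma integral_add: "x \<in> range eval_alpha \<Longrightarrow> y \<in> range eval_alpha \<Longrightarrow> x + y \<in> range eval_alpha"
  by (auto simp flip: eval_alpha_add)

lemma integral_mult: "x \<in> range eval_alpha \<Longrightarrow> y \<in> range eval_alpha \<Longrightarrow> x * y \<in> range eval_alpha"
  by (auto simp flip: eval_alpha_mult)

lemma integral_of_int: "of_int a \<in> range eval_alpha"
  using rangeI[of eval_alpha "[:a:]"] by simp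

lemma integral_0: "0 \<in> range eval_alpha" and integral_1: "1 \<in> range eval_alpha"
  using integral_of_int[of 0] integral_of_int[of 1] by simp_all

lemma integral_jack_alpha: "jack_alpha \<in> range eval_alpha"
  using rangeI[of eval_alpha "[:0, 1:]"] by simp

lemma integral_sum: "(\<And>x. x \<in> A \<Longrightarrow> g x \<in> range eval_alpha) \<Longrightarrow> sum g A \<in> range eval_alpha"
  by (induction A rule: infinite_finite_induct) (auto simp: integral_0 intro: integral_add)

lemma integral_linear: "jack_alpha * of_nat a - of_nat b \<in> range eval_alpha"
  using integral_add[OF integral_mult[OF integral_jack_alpha integral_of_int[of "int a"]] integral_of_int[of "- int b"]]
  by simp

definition nonsym_jack :: "nat \<Rightarrow> mon \<Rightarrow> ratfun mps \<Rightarrow> bool" where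
  "nonsym_jack n \<eta> F \<longleftrightarrow>
     (\<forall>b. mps_coeff F b \<noteq> 0 \<longrightarrow> keys b \<subseteq> {..<n} \<and> psize b = psize \<eta>) \<and>
     (\<forall>b. mps_coeff F b \<in> range eval_alpha) \<and>
     (\<forall>i<n. xi n i F = cst (bar n \<eta> i) * F) \<and>
     (\<forall>m. keys \<eta> \<subseteq> {..<m} \<longrightarrow>
        (\<forall>\<pi>. \<pi> permutes {m..<n} \<longrightarrow> pm \<pi> F = F) \<and>
        (\<forall>S. S \<subseteq> {m..<n} \<longrightarrow> card S = psize \<eta> \<longrightarrow> mps_coeff F (ind S) = fact (psize \<eta>)))"

lemma nonsym_jack_0: "nonsym_jack n 0 1"
  unfolding nonsym_jack_def
proof (intro conjI allI impI)
  fix i assume "i < n"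
  then have "{j. j < n \<and> j < i} = {..<i}"
    by auto
  then have "bar n 0 i = - of_nat i"
    by (simp add: bar_def cbar_def)
  moreover have "xi n i 1 = - of_nat i"
    by (simp add: xi_def Zop_def dd_eq_0 pm_one)
  ultimately show "xi n i 1 = cst (bar n 0 i) * 1"
    by (simp add: cst_hom cst_of_nat)
next
  fix m :: nat and S assume "S \<subseteq> {m..<n}" "card S = psize 0"
  then have "S = {}"
    by (metis card_eq_0_iff finite_atLeastLessThan finite_subset psize_zero)
  then show "mps_coeff 1 (ind S) = fact (psize 0)"
    by (simp add: coeff_one ind_def)
qed (auto simp: coeff_one integral_0 integral_1 pm_one permutes_bij split: if_splits)

lemma cst_mult_cancel:
  fixes c :: "'a::field"
  assumes "c \<noteq> 0" "cst c * f = cst c * g"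
  shows "f = g"
  using assms by (simp add: mps_eq_iff)

lemma Phi_eigenvector:
  assumes eig: "\<And>i. i \<le> L \<Longrightarrow> xi (Suc L) i f = cst (bar (Suc L) \<eta> i) * f"
    and shift: "\<And>i. i < L \<Longrightarrow> lookup \<eta>' i = lookup \<eta> (Suc i)" "lookup \<eta>' L = Suc (lookup \<eta> 0)"
    and "i \<le> L"
  shows "xi (Suc L) i (Phi L f) = cst (bar (Suc L) \<eta>' i) * Phi L f"
proof -
  have scal: "Phi L (cst c * f) = cst c * Phi L f" for c
    by (simp add: Phi_def pm_mult pm_cst mult.left_commute)
  note cb = cbar_cyc[of L \<eta>' \<eta>, OF shift]
  show ?thesis
  proof (cases "i = L")
    case True
    have "bar (Suc L) \<eta>' L = bar (Suc L) \<eta> 0 + jack_alpha"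
      using cb[of 0] by (simp add: bar_def shift(2) algebra_simps)
    then show ?thesis
      using eig[of 0] by (simp add: True xi_Phi_last scal flip: cst_hom distrib_right)
  next
    case False
    then have "i < L"
      using \<open>i \<le> L\<close> by simp
    then have "bar (Suc L) \<eta>' i = bar (Suc L) \<eta> (Suc i)"
      using cb[of "Suc i"] by (simp add: bar_def shift(1))
    then show ?thesis
      using \<open>i < L\<close> eig[of "Suc i"] by (simp add: xi_Phi scal)
  qed
qed

text \<open>The move from \<open>\<eta>\<close> with its last nonzero entry at position \<open>k\<close> to \<open>pred_comp k \<eta>\<close> is the
  inverse of the affine move \<open>Phi\<close>, up to transporting an entry through zeros.\<close>

definition pred_comp :: "nat \<Rightarrow> mon \<Rightarrow> mon" where
  "pred_comp k \<eta> = map_key (cyc k) (\<eta> - single k 1)"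

definition moved :: "nat \<Rightarrow> nat \<Rightarrow> mon \<Rightarrow> mon" where
  "moved k j \<eta> = update j (lookup \<eta> k) (update k 0 \<eta>)"

lemma psize_pred_comp:
  assumes "0 < lookup \<eta> k"
  shows "psize \<eta> = Suc (psize (pred_comp k \<eta>))"
proof -
  have "psize \<eta> = psize (\<eta> - single k 1) + 1"
    using minus_single_add[of 1 \<eta> k] assms by (metis One_nat_def Suc_leI psize_add psize_single)
  then show ?thesis
    by (simp add: pred_comp_def psize_map_key)
qed

locale raising_step =
  fixes L k :: nat and \<eta> :: mon and F :: "ratfun mps"
  assumes k: "k \<le> L" and pos: "0 < lookup \<eta> k" and zeros: "\<And>j. k < j \<Longrightarrow> lookup \<eta> j = 0"
    and F: "nonsym_jack (Suc L) (pred_comp k \<eta>) F"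
begin

text \<open>The affine operator with its new variable placed at position j instead of L;
  \<open>G L\<close> is \<open>Phi L F\<close>. Permutations of the variables from k on merely
  permute these functions (\<open>pm_G\<close>).\<close>

definition G :: "nat \<Rightarrow> ratfun mps" where
  "G j = X j * pm (cyc j) F"

text \<open>The eigenvalue difference a - z of the intertwiner that carries the entry from j + 1 to
  j: the zero entry at position j has eigenvalue -(j + 1) (\<open>bar_zero_before\<close>).\<close>

definition r :: "nat \<Rightarrow> ratfun" where
  "r j = bar (Suc L) \<eta> k + of_nat (Suc j)"

text \<open>Up to a scalar, \<open>H j\<close> arises from \<open>G L = Phi L F\<close> by the intertwiners that carry the last
  nonzero entry from position \<open>L\<close> down to position \<open>j\<close>. Each of them involves a division, but since
  \<open>F\<close> is symmetric in the variables belonging to zero entries, the product collapses to this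
  integral expression.\<close>

definition H :: "nat \<Rightarrow> ratfun mps" where
  "H j = cst (r j) * G j + (\<Sum>i\<in>{j<..L}. G i)"

lemma pos_imp_le: "0 < lookup \<eta> x \<Longrightarrow> x \<le> k"
  using zeros[of x] by (cases "k < x") auto

lemma lookup_pred_comp: "lookup (pred_comp k \<eta>) i = (if i = 0 then lookup \<eta> k - 1
    else if i \<le> k then lookup \<eta> (i - 1) else 0)"
  using zeros[of i] by (auto simp: pred_comp_def lookup_map_key lookup_minus lookup_single cyc_def)

lemma keys_pred_comp: "keys (pred_comp k \<eta>) \<subseteq> {..<Suc k}"
  by (auto simp: in_keys_iff lookup_pred_comp less_Suc_eq_le split: if_splits)

lemma lookup_moved: "lookup (moved k j \<eta>) i = (if i = j then lookup \<eta> k else if i = k then 0 else lookup \<eta> i)"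
  by (auto simp: moved_def lookup_update)

lemma moved_k: "moved k k \<eta> = \<eta>"
  by (rule poly_mapping_eqI) (simp add: lookup_moved)

lemma F_eig: "i \<le> L \<Longrightarrow> xi (Suc L) i F = cst (bar (Suc L) (pred_comp k \<eta>) i) * F"
  using F by (simp add: nonsym_jack_def)

lemma F_sym: "\<pi> permutes {Suc k..<Suc L} \<Longrightarrow> pm \<pi> F = F"
  using F keys_pred_comp unfolding nonsym_jack_def by blast

lemma pm_G:
  assumes \<pi>: "\<pi> permutes {k..<Suc L}" and j: "k \<le> j" "j \<le> L"
  shows "pm \<pi> (G j) = G (\<pi> j)"
proof -
  \<comment> \<open>The defect between relabelling first and inserting first. It moves only
    variables of index above k, and F is symmetric in those.\<close>
  define \<rho> where "\<rho> = inv (cyc (\<pi> j)) \<circ> \<pi> \<circ> cyc j"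
  have bij: "bij \<pi>" "bij \<rho>"
    using \<pi> by (auto simp: \<rho>_def permutes_bij intro!: bij_comp bij_imp_bij_inv)
  have pj: "k \<le> \<pi> j" "\<pi> j \<le> L"
    using permutes_in_image[OF \<pi>, of j] j by auto
  have "\<rho> x = x" if "x \<notin> {Suc k..<Suc L}" for x
  proof -
    have "cyc (\<pi> j) x = \<pi> (cyc j x)"
      using that j pj permutes_not_in[OF \<pi>, of "cyc j x"]
      by (cases x) (auto simp: cyc_def not_le less_Suc_eq_le)
    then show ?thesis
      by (simp add: \<rho>_def) (metis bij_cyc bij_is_inj inv_f_f)
  qed
  then have "\<rho> permutes {Suc k..<Suc L}"
    using bij by (auto simp: permutes_def bij_iff)
  then have "pm (cyc (\<pi> j)) F = pm (cyc (\<pi> j)) (pm \<rho> F)"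
    by (simp add: F_sym)
  also have "\<dots> = pm \<pi> (pm (cyc j) F)"
    using bij by (simp add: pm_comp \<rho>_def bij_comp bij_imp_bij_inv flip: comp_assoc)
      (metis bij_cyc bij_is_surj comp_assoc comp_id surj_iff id_comp)
  finally show ?thesis
    using bij by (simp add: G_def pm_mult pm_X)
qed

lemma adj_permutes_tail: "k \<le> i \<Longrightarrow> i < L \<Longrightarrow> adj i permutes {k..<Suc L}"
  by (rule permutes_swap_id) auto

lemma cbar_moved:
  assumes "k \<le> j" "j \<le> L"
  shows "cbar (Suc L) (moved k j \<eta>) j = card {i. i < k \<and> lookup \<eta> k \<le> lookup \<eta> i}"
proof -
  have "x < k \<and> x < j \<and> x < Suc L" if "lookup \<eta> k \<le> lookup \<eta> x" "x \<noteq> k" for x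
    using that pos pos_imp_le[of x] assms by auto
  then show ?thesis
    unfolding cbar_def using assms pos zeros k
    by (intro arg_cong[where f = card]) (auto simp: lookup_moved split: if_splits)
qed

lemma bar_moved: "k \<le> j \<Longrightarrow> j \<le> L \<Longrightarrow> bar (Suc L) (moved k j \<eta>) j = bar (Suc L) \<eta> k"
  using cbar_moved[of j] cbar_moved[of k] k by (simp add: bar_def lookup_moved moved_k)

text \<open>The zero at position j is outranked by the j entries before it, zeros included, and by
  the moved entry at j + 1; everything after that is zero.\<close>

lemma bar_zero_before:
  assumes "k \<le> j" "j < L"
  shows "bar (Suc L) (moved k (Suc j) \<eta>) j = - of_nat (Suc j)"
proof -
  have "lookup (moved k (Suc j) \<eta>) j = 0"
    using assms zeros[of j] by (auto simp: lookup_moved)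
  moreover have "{i. i < Suc L \<and> (i < j \<or> j < i \<and> 0 < lookup (moved k (Suc j) \<eta>) i)} = insert (Suc j) {..<j}"
    using assms pos zeros by (auto simp: lookup_moved split: if_splits)
  ultimately show ?thesis
    by (simp add: bar_def cbar_def)
qed

lemma r_nonzero: "r j \<noteq> 0"
  using jack_alpha_linear_neq_0[OF pos, of "int (Suc j) - int (cbar (Suc L) \<eta> k)"]
  by (simp add: r_def bar_def algebra_simps)

text \<open>Descending induction on j: at j = L the function is a multiple of
  \<open>Phi L F\<close>, and each intertwiner lowers j by one. The factor that it produces is
  nonzero and is cancelled.\<close>

lemma H_eigenvector:
  assumes "k \<le> j" "j \<le> L" "i \<le> L"
  shows "xi (Suc L) i (H j) = cst (bar (Suc L) (moved k j \<eta>) i) * H j"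
  using assms(2,1,3)
proof (induction j arbitrary: i rule: inc_induct)
  case base
  have "xi (Suc L) i (Phi L F) = cst (bar (Suc L) (moved k L \<eta>) i) * Phi L F"
  proof (rule Phi_eigenvector)
    show "lookup (moved k L \<eta>) l = lookup (pred_comp k \<eta>) (Suc l)" if "l < L" for l
      using that zeros k by (auto simp: lookup_moved lookup_pred_comp)
    show "lookup (moved k L \<eta>) L = Suc (lookup (pred_comp k \<eta>) 0)"
      using pos by (simp add: lookup_moved lookup_pred_comp)
  qed (use F_eig base in auto)
  then have "xi (Suc L) i (G L) = cst (bar (Suc L) (moved k L \<eta>) i) * G L"
    by (simp add: G_def Phi_def)
  then show ?case
    by (simp add: H_def xi_cst_mult mult.left_commute)
next
  case (step j)
  let ?\<mu> = "moved k (Suc j) \<eta>"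
  define g where "g = cst (bar (Suc L) \<eta> k - - of_nat (Suc j)) * pm (adj j) (H (Suc j)) + H (Suc j)"
  have kj: "k \<le> j" "j < L"
    using step by auto
  have adj: "moved k j \<eta> = map_key (adj j) ?\<mu>"
    using kj zeros[of j] zeros[of "Suc j"]
    by (intro poly_mapping_eqI) (auto simp: lookup_moved lookup_map_key Transposition.transpose_def)
  have less: "lookup ?\<mu> j < lookup ?\<mu> (Suc j)"
    using kj pos zeros[of j] by (auto simp: lookup_moved)
  note bars = bar_adj[of j "Suc L" ?\<mu>, OF _ less, folded adj]
  have IH: "xi (Suc L) i (H (Suc j)) = cst (bar (Suc L) ?\<mu> i) * H (Suc j)" if "i \<le> L" for i
    using that step.IH kj by simp
  have "Suc j < Suc L"
    using kj by simp
  moreover have "xi (Suc L) j (H (Suc j)) = cst (- of_nat (Suc j)) * H (Suc j)"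
    using IH[of j] kj by (simp only: bar_zero_before less_imp_le)
  moreover have "xi (Suc L) (Suc j) (H (Suc j)) = cst (bar (Suc L) \<eta> k) * H (Suc j)"
    using IH[of "Suc j"] kj bar_moved[of "Suc j"] by simp
  moreover have "xi (Suc L) l (H (Suc j)) = cst (bar (Suc L) ?\<mu> l) * H (Suc j)"
    if "l < Suc L" "l \<noteq> j" "l \<noteq> Suc j" for l
    using IH[of l] that by simp
  ultimately have g1: "xi (Suc L) j g = cst (bar (Suc L) \<eta> k) * g"
    and g2: "xi (Suc L) (Suc j) g = cst (- of_nat (Suc j)) * g"
    and g3: "\<And>l. l < Suc L \<Longrightarrow> l \<noteq> j \<Longrightarrow> l \<noteq> Suc j \<Longrightarrow> xi (Suc L) l g = cst (bar (Suc L) ?\<mu> l) * g"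
    using xi_intertwiner[OF _ _ _ _ g_def] by blast+
  have "xi (Suc L) i g = cst (bar (Suc L) (moved k j \<eta>) i) * g"
  proof -
    consider "i = j" | "i = Suc j" | "i \<noteq> j" "i \<noteq> Suc j" by blast
    then show ?thesis
    proof cases
      case 1
      then show ?thesis
        using g1 bar_moved[of j] kj by simp
    next
      case 2
      then show ?thesis
        using g2 bars[of j] bar_zero_before[of j] kj by simp
    next
      case 3
      then show ?thesis
        using g3[of i] bars[of i] step.prems kj by simp
    qed
  qed
  \<comment> \<open>The reflection sends \<open>G (Suc j)\<close> to \<open>G j\<close> and fixes
    the sum of the later \<open>G i\<close>. That sum thus gets the coefficient r j + 1 = r (j + 1),
    which is also the coefficient of the other two terms up to the factor r j of \<open>G j\<close>;
    so r (j + 1) factors out.\<close>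
  moreover have "g = cst (r (Suc j)) * H j"
  proof -
    have set: "{j<..L} = insert (Suc j) {Suc j<..L}"
      using kj by auto
    have "pm (adj j) (\<Sum>i\<in>{Suc j<..L}. G i) = (\<Sum>i\<in>{Suc j<..L}. G i)"
      unfolding pm_sum using kj by (intro sum.cong) (auto simp: pm_G[OF adj_permutes_tail])
    moreover have "pm (adj j) (G (Suc j)) = G j"
      using kj by (simp add: pm_G[OF adj_permutes_tail])
    moreover have "bar (Suc L) \<eta> k - - of_nat (Suc j) = r j"
      by (simp add: r_def)
    moreover have "r (Suc j) = r j + 1"
      by (simp add: r_def)
    ultimately show ?thesis
      by (simp add: g_def H_def set pm_mult pm_cst cst_hom algebra_simps)
  qed
  ultimately have "cst (r (Suc j)) * xi (Suc L) i (H j)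
      = cst (r (Suc j)) * (cst (bar (Suc L) (moved k j \<eta>) i) * H j)"
    by (simp add: xi_cst_mult mult.left_commute)
  then show ?case
    by (rule cst_mult_cancel[OF r_nonzero])
qed

lemma coeff_G: "mps_coeff (G j) b = (if lookup b j = 0 then 0 else mps_coeff F (map_key (cyc j) (b - single j 1)))"
  by (simp add: G_def coeff_X_mult coeff_pm)

lemma G_support:
  assumes "j \<le> L" "mps_coeff (G j) b \<noteq> 0"
  shows "keys b \<subseteq> {..<Suc L}" "psize b = psize \<eta>"
proof -
  define c where "c = b - single j 1"
  have j: "lookup b j \<noteq> 0" and nz: "mps_coeff F (map_key (cyc j) c) \<noteq> 0"
    using assms(2) by (auto simp: coeff_G c_def split: if_splits)
  have b: "b = c + single j 1"
    using j unfolding c_def by (intro minus_single_add[symmetric]) simp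
  have *: "keys (map_key (cyc j) c) \<subseteq> {..<Suc L}" "psize (map_key (cyc j) c) = psize (pred_comp k \<eta>)"
    using F nz unfolding nonsym_jack_def by blast+
  then show "psize b = psize \<eta>"
    by (simp add: b psize_add psize_map_key psize_pred_comp[OF pos])
  have "keys c \<subseteq> {..<Suc L}"
  proof
    fix x assume "x \<in> keys c"
    then have "inv (cyc j) x \<in> keys (map_key (cyc j) c)"
      by (simp add: in_keys_iff lookup_map_key bij_is_surj surj_f_inv_f)
    then have "inv (cyc j) x \<in> {..<Suc L}"
      using * by blast
    then show "x \<in> {..<Suc L}"
      using permutes_in_image[OF cyc_permutes_lessThan, of j "Suc L" "inv (cyc j) x"] assms(1)
      by (simp add: bij_is_surj surj_f_inv_f)
  qed
  then show "keys b \<subseteq> {..<Suc L}"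
    using assms(1) Poly_Mapping.keys_add[of c "single j 1"] by (auto simp: b)
qed

lemma nonsym_jack_raise: "nonsym_jack (Suc L) \<eta> (H k)"
  unfolding nonsym_jack_def
proof (intro conjI allI impI)
  fix b assume "mps_coeff (H k) b \<noteq> 0"
  then have "\<exists>j\<le>L. mps_coeff (G j) b \<noteq> 0"
    using k by (rule_tac ccontr) (simp add: H_def coeff_sum)
  then show "keys b \<subseteq> {..<Suc L}" "psize b = psize \<eta>"
    using G_support by blast+
next
  fix b
  have "mps_coeff (G j) b \<in> range eval_alpha" for j
    using F by (auto simp: coeff_G nonsym_jack_def integral_0)
  moreover have "r k \<in> range eval_alpha"
    using integral_add[OF integral_linear integral_of_int[of "int (Suc k)"]] by (simp add: r_def bar_def)
  ultimately show "mps_coeff (H k) b \<in> range eval_alpha"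
    by (auto simp: H_def coeff_sum intro!: integral_add integral_mult integral_sum)
next
  fix i assume "i < Suc L"
  then show "xi (Suc L) i (H k) = cst (bar (Suc L) \<eta> i) * H k"
    using H_eigenvector[of k i] k by (simp add: moved_k)
next
  fix m \<pi> assume "keys \<eta> \<subseteq> {..<m}" and \<pi>: "\<pi> permutes {m..<Suc L}"
  then have m: "k < m"
    using pos by (auto simp: in_keys_iff subset_iff)
  have \<pi>': "\<pi> permutes {k..<Suc L}" and \<pi>'': "\<pi> permutes {k<..L}"
    by (rule permutes_subset[OF \<pi>]; use m in auto)+
  have "pm \<pi> (\<Sum>i\<in>{k<..L}. G i) = (\<Sum>i\<in>{k<..L}. G (\<pi> i))"
    unfolding pm_sum by (rule sum.cong) (auto simp: pm_G[OF \<pi>'])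
  also have "\<dots> = (\<Sum>i\<in>{k<..L}. G i)"
    using sum.permute[OF \<pi>'', of G] by (simp add: comp_def)
  finally have "pm \<pi> (\<Sum>i\<in>{k<..L}. G i) = (\<Sum>i\<in>{k<..L}. G i)" .
  moreover have "pm \<pi> (G k) = G k"
    using pm_G[OF \<pi>', of k] k m \<pi> by (simp add: permutes_not_in)
  ultimately show "pm \<pi> (H k) = H k"
    using \<pi> by (simp add: H_def pm_mult pm_cst permutes_bij)
next
  fix m S assume m: "keys \<eta> \<subseteq> {..<m}" and S: "S \<subseteq> {m..<Suc L}" "card S = psize \<eta>"
  then have "k < m"
    using pos by (auto simp: in_keys_iff subset_iff)
  then have Sk: "S \<subseteq> {k<..L}"
    using S by auto
  have fin: "finite S"
    using S finite_subset by blast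
  have in_S: "mps_coeff (G j) (ind S) = fact (psize (pred_comp k \<eta>))" if "j \<in> S" for j
  proof -
    have j: "k < j" "j \<le> L"
      using that Sk by auto
    have "ind S - single j 1 = ind (S - {j})"
      using that fin by (intro poly_mapping_eqI) (auto simp: lookup_minus lookup_ind lookup_single)
    then have "map_key (cyc j) (ind S - single j 1) = ind (cyc j -` (S - {j}))"
      using fin by (simp add: map_key_ind)
    moreover have "cyc j -` (S - {j}) \<subseteq> {Suc k..<Suc L}"
    proof
      fix x assume "x \<in> cyc j -` (S - {j})"
      then have "k < cyc j x" "cyc j x \<le> L" "cyc j x \<noteq> j"
        using Sk by auto
      then show "x \<in> {Suc k..<Suc L}"
        using j by (auto simp: cyc_def split: if_splits)
    qed
    moreover have "card (cyc j -` (S - {j})) = psize (pred_comp k \<eta>)"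
      using that fin S psize_pred_comp[OF pos]
      by (subst card_vimage_inj) (auto simp: bij_is_inj bij_is_surj)
    ultimately have "mps_coeff F (map_key (cyc j) (ind S - single j 1)) = fact (psize (pred_comp k \<eta>))"
      using F keys_pred_comp unfolding nonsym_jack_def by metis
    then show ?thesis
      using that fin by (simp add: coeff_G lookup_ind)
  qed
  have notin_S: "mps_coeff (G j) (ind S) = 0" if "j \<notin> S" for j
    using that fin by (simp add: coeff_G lookup_ind)
  \<comment> \<open>This removes the only term with a factor involving \<alpha>. Each of the
    |\<eta>| indices in \<open>S\<close> then contributes (|\<eta>| - 1)!.\<close>
  have "k \<notin> S"
    using Sk by auto
  then have "mps_coeff (H k) (ind S) = (\<Sum>j\<in>{k<..L}. mps_coeff (G j) (ind S))"
    by (simp add: H_def coeff_sum notin_S)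
  also have "\<dots> = (\<Sum>j\<in>S. mps_coeff (G j) (ind S))"
    using Sk by (intro sum.mono_neutral_right) (auto simp: notin_S)
  also have "\<dots> = fact (psize \<eta>)"
    using in_S S psize_pred_comp[OF pos] by simp
  finally show "mps_coeff (H k) (ind S) = fact (psize \<eta>)" .
qed

end

theorem ex_nonsym_jack:
  assumes "keys \<eta> \<subseteq> {..<Suc L}"
  shows "\<exists>F. nonsym_jack (Suc L) \<eta> F"
  using assms
proof (induction "psize \<eta>" arbitrary: \<eta>)
  case 0
  then show ?case
    using nonsym_jack_0 by (metis psize_eq_0_iff)
next
  case (Suc N)
  define k where "k = Max (keys \<eta>)"
  have "keys \<eta> \<noteq> {}"
    using Suc.hyps(2) by auto
  then have k_in: "k \<in> keys \<eta>"
    by (simp add: k_def)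
  have zeros: "lookup \<eta> j = 0" if "k < j" for j
    using that unfolding k_def by (metis Max_ge finite_keys in_keys_iff not_le)
  have k: "k \<le> L" "0 < lookup \<eta> k"
    using k_in Suc.prems by (auto simp: in_keys_iff subset_iff less_Suc_eq_le)
  have pred: "lookup (pred_comp k \<eta>) i = 0" if "k < i" for i
    using that zeros by (simp add: pred_comp_def lookup_map_key lookup_minus lookup_single)
  have "keys (pred_comp k \<eta>) \<subseteq> {..<Suc L}"
  proof
    fix x assume "x \<in> keys (pred_comp k \<eta>)"
    then show "x \<in> {..<Suc L}"
      using pred[of x] k by (cases "k < x") (auto simp: in_keys_iff)
  qed
  moreover have "psize \<eta> = Suc (psize (pred_comp k \<eta>))"
    using k by (intro psize_pred_comp) simp
  ultimately obtain F where F: "nonsym_jack (Suc L) (pred_comp k \<eta>) F"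
    using Suc.hyps by auto
  interpret raising_step L k \<eta> F
    by unfold_locales (use k zeros F in auto)
  show ?case
    using nonsym_jack_raise by blast
qed

section \<open>Symmetrization\<close>

text \<open>The sum of the \<open>xi\<close> would only see the degree; the sum of squares is the
  simplest symmetric expression that also sees the sum of squares of the parts.\<close>

definition casimir :: "nat \<Rightarrow> ratfun mps \<Rightarrow> ratfun mps" where
  "casimir n f = (\<Sum>i<n. xi n i (xi n i f))"

lemma casimir_add: "casimir n (f + g) = casimir n f + casimir n g"
  by (simp add: casimir_def xi_add sum.distrib)

lemma casimir_zero [simp]: "casimir n 0 = 0"
  using casimir_add[of n 0 0] by simp

lemma casimir_sum: "casimir n (sum f A) = (\<Sum>x\<in>A. casimir n (f x))"
  by (induction A rule: infinite_finite_induct) (auto simp: casimir_add)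

text \<open>Moving s_i past the squares of \<open>xi n i\<close> and \<open>xi n (Suc i)\<close>
  produces the corrections \<open>xi n i f\<close> + \<open>xi n (Suc i) f\<close> with opposite
  signs.\<close>

lemma pm_adj_casimir:
  assumes "Suc i < n"
  shows "pm (adj i) (casimir n f) = casimir n (pm (adj i) f)"
proof -
  let ?R = "{..<n} - {i, Suc i}"
  have "{..<n} = insert i (insert (Suc i) ?R)"
    using assms by auto
  then have split: "sum g {..<n} = g i + (g (Suc i) + sum g ?R)" for g :: "nat \<Rightarrow> ratfun mps"
    by (metis (no_types, lifting) Diff_iff finite_Diff finite_insert finite_lessThan insertCI insertE n_not_Suc_n sum.insert)
  have "pm (adj i) (\<Sum>l\<in>?R. xi n l (xi n l f)) = (\<Sum>l\<in>?R. xi n l (xi n l (pm (adj i) f)))"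
    unfolding pm_sum by (rule sum.cong) (auto simp: pm_adj_xi_other[OF assms])
  then show ?thesis
    unfolding casimir_def split
    by (simp add: pm_adj_xi[OF assms] pm_adj_xi_Suc[OF assms] xi_add xi_minus)
qed

lemma pm_transpose_casimir:
  assumes "a < b" "b < n"
  shows "pm (Transposition.transpose a b) (casimir n f) = casimir n (pm (Transposition.transpose a b) f)"
  using assms
proof (induction b arbitrary: f)
  case (Suc b)
  show ?case
  proof (cases "a = b")
    case True
    then show ?thesis
      using Suc.prems by (simp add: pm_adj_casimir)
  next
    case False
    \<comment> \<open>The transposition (a, b+1) is the conjugate of (a, b) by the adjacent
      transposition of b and b + 1.\<close>
    have conj: "pm (Transposition.transpose a (Suc b)) g
        = pm (adj b) (pm (Transposition.transpose a b) (pm (adj b) g))" for g :: "ratfun mps"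
      using False Suc.prems pm_transpose_conj[of "adj b" a b "pm (adj b) g"] by simp
    show ?thesis
      using False Suc.prems unfolding conj by (simp add: Suc.IH pm_adj_casimir)
  qed
qed simp

lemma pm_casimir:
  assumes "\<pi> permutes {..<n}"
  shows "pm \<pi> (casimir n f) = casimir n (pm \<pi> f)"
proof -
  have "finite {..<n}" by simp
  with assms show ?thesis
  proof (induction \<pi> arbitrary: f rule: permutes_induct)
    case id
    then show ?case by (simp add: pm_id)
  next
    case (swap a b p)
    have "pm (Transposition.transpose a b) (casimir n g) = casimir n (pm (Transposition.transpose a b) g)" for g
      using swap pm_transpose_casimir[of a b n g] pm_transpose_casimir[of b a n g]
      by (cases a b rule: linorder_cases) (auto simp: transpose_commute pm_id)
    moreover have "pm (Transposition.transpose a b \<circ> p) g = pm (Transposition.transpose a b) (pm p g)"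
      for g :: "ratfun mps"
      using swap by (simp add: pm_comp permutes_bij)
    ultimately show ?case
      using swap by (simp add: comp_def)
  qed
qed

lemma keys_map_key_permutes:
  assumes "\<pi> permutes A"
  shows "keys (map_key \<pi> a) \<subseteq> A \<longleftrightarrow> keys a \<subseteq> A"
proof -
  have "keys (map_key \<pi> a) \<subseteq> A \<longleftrightarrow> \<pi> -` keys a \<subseteq> \<pi> -` A"
    using assms by (simp add: keys_map_key permutes_inj permutes_vimage)
  also have "\<dots> \<longleftrightarrow> keys a \<subseteq> A"
    using permutes_surj[OF assms] by (auto simp: subset_iff) (metis surjD)
  finally show ?thesis .
qed

lemma norm2_map_key: "bij \<pi> \<Longrightarrow> norm2 (map_key \<pi> a) = norm2 a"
  by (simp add: norm2_eq_sum_ms ms_map_key)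

lemma coeff_prod_X_mult:
  assumes "finite S"
  shows "mps_coeff ((\<Prod>i\<in>S. X i) * f) b =
    (if \<forall>i\<in>S. lookup b i \<noteq> 0 then mps_coeff f (b - ind S) else 0)"
  using assms
proof (induction S arbitrary: b rule: finite_induct)
  case empty
  then show ?case by (simp add: ind_def)
next
  case (insert i S)
  have "b - single i 1 - ind S = b - ind (insert i S)"
    using insert by (intro poly_mapping_eqI) (auto simp: lookup_minus lookup_ind lookup_single when_def)
  moreover have "(\<forall>j\<in>S. lookup (b - single i 1) j \<noteq> 0) \<longleftrightarrow> (\<forall>j\<in>S. lookup b j \<noteq> 0)"
    using insert(2) by (intro ball_cong) (auto simp: lookup_minus lookup_single when_def)
  ultimately show ?case
    using insert by (auto simp: mult.assoc coeff_X_mult)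
qed

lemma funpow_cyc: "s + d \<le> L \<Longrightarrow> (cyc L ^^ s) (s + d) = d"
  by (induction s arbitrary: d) (simp_all add: funpow_Suc_right del: funpow.simps)

lemma bij_funpow_cyc [simp]: "bij (cyc L ^^ t)"
  by (simp add: bij_fn)

lemma funpow_cyc_permutes: "cyc L ^^ t permutes {..<Suc L}"
proof (induction t)
  case 0
  show ?case by (simp only: funpow.simps permutes_id)
next
  case (Suc t)
  then show ?case
    by (simp only: funpow.simps) (rule permutes_compose, simp_all add: cyc_permutes_lessThan)
qed

text \<open>The t-fold iterate of \<open>Phi\<close> on F is x_0 ... x_{t-1} F rotated by t steps.
  Multiplication by these variables therefore preserves joint eigenfunctions up to a
  rotation.\<close>

lemma Phi_iterate_eigenvector:
  fixes F :: "ratfun mps"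
  assumes eig: "\<And>i. i \<le> L \<Longrightarrow> xi (Suc L) i F = cst (bar (Suc L) \<eta> i) * F"
    and "t \<le> Suc L" "i \<le> L"
  shows "xi (Suc L) i (pm (cyc L ^^ t) ((\<Prod>i<t. X i) * F))
    = cst (bar (Suc L) (map_key (inv (cyc L ^^ t)) (\<eta> + ind {..<t})) i)
      * pm (cyc L ^^ t) ((\<Prod>i<t. X i) * F)"
  using assms(2,3)
proof (induction t arbitrary: i)
  case 0
  have eta: "map_key (inv (cyc L ^^ 0)) (\<eta> + ind {..<0}) = \<eta>"
    by (simp only: funpow.simps inv_id) (simp add: ind_def id_def map_key_id)
  have f: "pm (cyc L ^^ 0) ((\<Prod>i<0. X i) * F) = F"
    by (simp only: funpow.simps pm_id) simp
  show ?case
    unfolding eta f using eig 0 by simp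
next
  case (Suc t)
  let ?\<sigma> = "cyc L ^^ t"
  let ?f = "pm ?\<sigma> ((\<Prod>i<t. X i) * F)"
  let ?\<eta> = "\<lambda>t. map_key (inv (cyc L ^^ t)) (\<eta> + ind {..<t})"
  \<comment> \<open>After t rotations the new factor x_t has become x_0, and one more rotation makes
    it the factor x_L of \<open>Phi\<close>.\<close>
  have \<sigma>t: "?\<sigma> t = 0"
    using funpow_cyc[of t 0 L] Suc.prems by simp
  have "pm (cyc L ^^ Suc t) ((\<Prod>i<Suc t. X i) * F) = pm (cyc L) (pm ?\<sigma> (X t * ((\<Prod>i<t. X i) * F)))"
    by (simp add: pm_comp mult_ac)
  also have "\<dots> = Phi L ?f"
    by (simp add: pm_mult pm_X \<sigma>t Phi_def)
  finally have eq: "pm (cyc L ^^ Suc t) ((\<Prod>i<Suc t. X i) * F) = Phi L ?f" .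
  have look': "lookup (?\<eta> (Suc t)) (cyc L x) = lookup (?\<eta> t) x + (if x = 0 then 1 else 0)" for x
  proof -
    obtain y where y: "x = ?\<sigma> y"
      using bij_pointE[OF bij_funpow_cyc] by metis
    have "y = t \<longleftrightarrow> x = 0"
      using \<sigma>t y by (metis bij_funpow_cyc bij_is_inj inj_eq)
    moreover have "lookup (?\<eta> (Suc t)) ((cyc L ^^ Suc t) y) = lookup \<eta> y + (if y < Suc t then 1 else 0)"
      by (simp add: lookup_map_key bij_imp_bij_inv lookup_add lookup_ind bij_is_inj del: funpow.simps)
    moreover have "lookup (?\<eta> t) (?\<sigma> y) = lookup \<eta> y + (if y < t then 1 else 0)"
      by (simp add: lookup_map_key bij_imp_bij_inv lookup_add lookup_ind bij_is_inj)
    ultimately show ?thesis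
      using y by auto
  qed
  show ?case
    unfolding eq
  proof (rule Phi_eigenvector)
    show "xi (Suc L) i ?f = cst (bar (Suc L) (?\<eta> t) i) * ?f" if "i \<le> L" for i
      using Suc that by simp
    show "lookup (?\<eta> (Suc t)) i = lookup (?\<eta> t) (Suc i)" if "i < L" for i
      using look'[of "Suc i"] that by simp
    show "lookup (?\<eta> (Suc t)) L = Suc (lookup (?\<eta> t) 0)"
      using look'[of 0] by simp
  qed (rule Suc.prems)
qed

definition casimir_eigenvalue :: "nat \<Rightarrow> mon \<Rightarrow> ratfun" where
  "casimir_eigenvalue n \<mu> = (\<Sum>i<n. bar n \<mu> i * bar n \<mu> i)"

text \<open>The state of the symmetrization when f is symmetric in the variables from k on and
  divisible by those before k. Each stage lowers k by one; the coefficient (N - k)! grows to N! at k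
  = 0.\<close>

definition sym_stage :: "nat \<Rightarrow> mon \<Rightarrow> ratfun \<Rightarrow> nat \<Rightarrow> ratfun mps \<Rightarrow> bool" where
  "sym_stage n l e k f \<longleftrightarrow>
     (\<forall>b. mps_coeff f b \<noteq> 0 \<longrightarrow> keys b \<subseteq> {..<n} \<and> psize b = psize l \<and>
        (norm2 b < norm2 l \<or> ms b = ms l) \<and> (\<forall>i<k. lookup b i \<noteq> 0)) \<and>
     (\<forall>b. mps_coeff f b \<in> range eval_alpha) \<and>
     casimir n f = cst e * f \<and>
     (\<forall>\<pi>. \<pi> permutes {k..<n} \<longrightarrow> pm \<pi> f = f) \<and>
     (\<forall>S. {..<k} \<subseteq> S \<longrightarrow> S \<subseteq> {..<n} \<longrightarrow> card S = psize l \<longrightarrow>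
        mps_coeff f (ind S) = fact (psize l - k))"

text \<open>The transpositions of k with j \<ge> k represent the cosets of the permutations of
  {k+1..<n} in those of {k..<n}. Their sum over f is symmetric without any division.\<close>

lemma sym_stage_step:
  assumes f: "sym_stage n l e (Suc k) f" and k: "Suc k \<le> psize l" "k < n"
  shows "sym_stage n l e k (\<Sum>j\<in>{k..<n}. pm (Transposition.transpose k j) f)"
proof -
  let ?\<tau> = "Transposition.transpose k"
  let ?g = "\<Sum>j\<in>{k..<n}. pm (?\<tau> j) f"
  have \<tau>: "?\<tau> j permutes {..<n}" if "j < n" for j
    using that k by (intro permutes_swap_id) auto
  have coeff: "mps_coeff ?g b = (\<Sum>j\<in>{k..<n}. mps_coeff f (map_key (?\<tau> j) b))" for b
    by (simp add: coeff_sum coeff_pm)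
  show ?thesis
    unfolding sym_stage_def
  proof (intro conjI allI impI)
    fix b assume "mps_coeff ?g b \<noteq> 0"
    then obtain j where j: "k \<le> j" "j < n" and nz: "mps_coeff f (map_key (?\<tau> j) b) \<noteq> 0"
      unfolding coeff by (metis (mono_tags, lifting) atLeastLessThan_iff sum.neutral)
    have *: "keys (map_key (?\<tau> j) b) \<subseteq> {..<n}" "psize (map_key (?\<tau> j) b) = psize l"
      "norm2 (map_key (?\<tau> j) b) < norm2 l \<or> ms (map_key (?\<tau> j) b) = ms l"
      "\<forall>i<Suc k. lookup (map_key (?\<tau> j) b) i \<noteq> 0"
      using f nz unfolding sym_stage_def by blast+
    show "keys b \<subseteq> {..<n}"
      using *(1) \<tau>[OF j(2)] by (simp add: keys_map_key_permutes)
    show "psize b = psize l"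
      using *(2) by (simp add: psize_map_key)
    show "norm2 b < norm2 l \<or> ms b = ms l"
      using *(3) by (simp add: norm2_map_key ms_map_key)
    fix i assume "i < k"
    then show "lookup b i \<noteq> 0"
      using *(4)[rule_format, of i] j by (simp add: lookup_map_key)
  next
    fix b show "mps_coeff ?g b \<in> range eval_alpha"
      unfolding coeff using f by (intro integral_sum) (simp add: sym_stage_def)
  next
    have "casimir n ?g = (\<Sum>j\<in>{k..<n}. cst e * pm (?\<tau> j) f)"
      unfolding casimir_sum using f \<tau>
      by (intro sum.cong) (auto simp: sym_stage_def pm_mult pm_cst simp flip: pm_casimir)
    then show "casimir n ?g = cst e * ?g"
      by (simp add: sum_distrib_left)
  next
    fix \<pi> assume \<pi>: "\<pi> permutes {k..<n}"
    have "pm \<pi> (pm (?\<tau> j) f) = pm (?\<tau> (\<pi> j)) f" if j: "j \<in> {k..<n}" for j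
    proof -
      \<comment> \<open>It compares the coset representative of \<pi> times (k j) with that product
        itself; it fixes k, so f absorbs it.\<close>
      define \<rho> where "\<rho> = ?\<tau> (\<pi> j) \<circ> \<pi> \<circ> ?\<tau> j"
      have bij: "bij \<pi>" "bij \<rho>"
        using \<pi> by (auto simp: \<rho>_def permutes_bij intro!: bij_comp)
      have pj: "\<pi> j \<in> {k..<n}"
        using permutes_in_image[OF \<pi>] j by blast
      have "\<rho> x = x" if "x \<notin> {Suc k..<n}" for x
        using that j pj permutes_not_in[OF \<pi>, of x]
        by (cases "x = k") (auto simp: \<rho>_def)
      then have "\<rho> permutes {Suc k..<n}"
        using bij by (auto simp: permutes_def bij_iff)
      then have "pm (?\<tau> (\<pi> j)) f = pm (?\<tau> (\<pi> j)) (pm \<rho> f)"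
        using f by (simp add: sym_stage_def)
      also have "\<dots> = pm \<pi> (pm (?\<tau> j) f)"
        using bij by (simp add: pm_comp \<rho>_def bij_comp flip: comp_assoc)
      finally show ?thesis by simp
    qed
    then have "pm \<pi> ?g = (\<Sum>j\<in>{k..<n}. pm (?\<tau> (\<pi> j)) f)"
      unfolding pm_sum by (rule sum.cong[OF refl])
    also have "\<dots> = ?g"
      using sum.permute[OF \<pi>, of "\<lambda>j. pm (?\<tau> j) f"] by (simp add: comp_def)
    finally show "pm \<pi> ?g = ?g" .
  next
    fix S assume S: "{..<k} \<subseteq> S" "S \<subseteq> {..<n}" "card S = psize l"
    then have fin: "finite S"
      using finite_subset by blast
    have ind: "map_key (?\<tau> j) (ind S) = ind (?\<tau> j -` S)" for j
      using fin by (simp add: map_key_ind)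
    have in_S: "mps_coeff f (ind (?\<tau> j -` S)) = fact (psize l - Suc k)" if "j \<in> S" "k \<le> j" for j
    proof -
      have "{..<Suc k} \<subseteq> ?\<tau> j -` S"
        using S that by (auto simp: less_Suc_eq Transposition.transpose_def)
      moreover have "?\<tau> j -` S \<subseteq> {..<n}"
        using S permutes_in_image[OF \<tau>, of j] that by (auto simp: subset_iff)
      moreover have "card (?\<tau> j -` S) = psize l"
        using S by (subst card_vimage_inj) (auto simp: surj_transpose)
      ultimately show ?thesis
        using f by (simp add: sym_stage_def)
    qed
    \<comment> \<open>All monomials of f contain x_k. So only the N - k indices of \<open>S\<close>
      not below k count, each giving (N - k - 1)!.\<close>
    have notin_S: "mps_coeff f (ind (?\<tau> j -` S)) = 0" if "j \<notin> S" for j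
    proof -
      have "lookup (ind (?\<tau> j -` S)) k = 0"
        using that fin by (simp add: lookup_ind finite_vimageI)
      then show ?thesis
        using f unfolding sym_stage_def by (metis lessI)
    qed
    have set: "{k..<n} \<inter> S = S - {..<k}"
      using S by auto
    have "mps_coeff ?g (ind S) = (\<Sum>j\<in>{k..<n} \<inter> S. mps_coeff f (ind (?\<tau> j -` S)))"
      unfolding coeff ind by (intro sum.mono_neutral_right) (auto simp: notin_S)
    also have "\<dots> = (\<Sum>j\<in>{k..<n} \<inter> S. fact (psize l - Suc k))"
      by (rule sum.cong) (auto simp: in_S)
    also have "\<dots> = of_nat (card (S - {..<k})) * fact (psize l - Suc k)"
      by (simp add: set)
    also have "card (S - {..<k}) = psize l - k"
      using S by (simp add: card_Diff_subset)
    also have "of_nat (psize l - k) * fact (psize l - Suc k) = (fact (psize l - k) :: ratfun)"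
      using k by (metis Suc_diff_Suc Suc_le_lessD fact_Suc)
    finally show "mps_coeff ?g (ind S) = fact (psize l - k)" .
  qed
qed

text \<open>The product x_0 ... x_{m-1} F is a joint eigenfunction only after rotation, with \<mu>
  the correspondingly rotated l. Support bound and Casimir eigenvalue are obtained there and carried
  back: \<open>norm2\<close>, \<open>ms\<close> and \<open>casimir\<close> are compatible with
  permutations.\<close>

lemma ex_sym_stage_start:
  assumes l: "l \<in> partitions"
  shows "\<exists>\<mu> f. keys \<mu> \<subseteq> {..<Suc (psize l)} \<and> ms \<mu> = ms l \<and>
    sym_stage (Suc (psize l)) l (casimir_eigenvalue (Suc (psize l)) \<mu>) (plength l) f"
proof -
  define L m where "L = psize l" and "m = plength l"
  define \<eta> where "\<eta> = l - ind {..<m}"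
  have m: "m \<le> L"
    by (simp add: L_def m_def plength_le_psize)
  have keys_l: "keys l = {..<m}"
    using keys_partition[OF l] by (simp add: m_def)
  have l_eq: "l = \<eta> + ind {..<m}"
  proof (rule poly_mapping_eqI)
    fix k
    have "k < m \<Longrightarrow> 0 < lookup l k"
      using keys_l by (metis in_keys_iff lessThan_iff neq0_conv)
    then show "lookup l k = lookup (\<eta> + ind {..<m}) k"
      by (simp add: \<eta>_def lookup_add lookup_minus lookup_ind)
  qed
  have psize_\<eta>: "psize l = psize \<eta> + m"
    by (metis l_eq psize_add psize_ind card_lessThan finite_lessThan)
  have keys_\<eta>: "keys \<eta> \<subseteq> {..<m}"
    unfolding keys_l[symmetric] by (auto simp: \<eta>_def in_keys_iff lookup_minus)
  have "keys \<eta> \<subseteq> {..<Suc L}"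
    by (rule order_trans[OF keys_\<eta>]) (use m in auto)
  then obtain F where F: "nonsym_jack (Suc L) \<eta> F"
    using ex_nonsym_jack by blast
  define f where "f = (\<Prod>i<m. X i) * F"
  define \<mu> where "\<mu> = map_key (inv (cyc L ^^ m)) l"
  define e where "e = casimir_eigenvalue (Suc L) \<mu>"
  have coeff: "mps_coeff f b = (if \<forall>i<m. lookup b i \<noteq> 0 then mps_coeff F (b - ind {..<m}) else 0)" for b
    by (simp add: f_def coeff_prod_X_mult Ball_def)
  have supp: "keys b \<subseteq> {..<Suc L} \<and> psize b = L \<and> (\<forall>i<m. lookup b i \<noteq> 0)" if "mps_coeff f b \<noteq> 0" for b
  proof -
    have pos: "\<forall>i<m. lookup b i \<noteq> 0" and "mps_coeff F (b - ind {..<m}) \<noteq> 0"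
      using that by (auto simp: coeff split: if_splits)
    then have c: "keys (b - ind {..<m}) \<subseteq> {..<Suc L}" "psize (b - ind {..<m}) = psize \<eta>"
      using F unfolding nonsym_jack_def by blast+
    have b: "b = (b - ind {..<m}) + ind {..<m}"
      using pos by (intro poly_mapping_eqI) (auto simp: lookup_add lookup_minus lookup_ind)
    have "psize b = L"
      by (subst b) (simp add: psize_add c psize_ind psize_\<eta> L_def)
    moreover have "keys b \<subseteq> {..<Suc L}"
      using c(1) Poly_Mapping.keys_add[of "b - ind {..<m}" "ind {..<m}"] m
      by (subst b) (auto simp: keys_ind)
    ultimately show ?thesis
      using pos by blast
  qed
  have eig: "xi (Suc L) i (pm (cyc L ^^ m) f) = cst (bar (Suc L) \<mu> i) * pm (cyc L ^^ m) f" if "i < Suc L" for i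
    unfolding f_def \<mu>_def
    by (subst l_eq, rule Phi_iterate_eigenvector) (use F m that in \<open>auto simp: nonsym_jack_def\<close>)
  have keys_\<mu>: "keys \<mu> \<subseteq> {..<Suc L}"
    unfolding \<mu>_def using keys_l m
    by (subst keys_map_key_permutes[OF permutes_inv[OF funpow_cyc_permutes]]) auto
  have norm: "norm2 b < norm2 l \<or> ms b = ms l" if nz: "mps_coeff f b \<noteq> 0" for b
  proof -
    have inv: "bij (inv (cyc L ^^ m))"
      by (simp add: bij_imp_bij_inv)
    let ?a = "map_key (inv (cyc L ^^ m)) b"
    have "norm2 ?a < norm2 \<mu> \<or> ms ?a = ms \<mu>"
    proof (rule xi_eigenvector_support[where f = "pm (cyc L ^^ m) f" and N = L, OF _ keys_\<mu> eig])
      show "keys a \<subseteq> {..<Suc L} \<and> psize a = L" if "mps_coeff (pm (cyc L ^^ m) f) a \<noteq> 0" for a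
        using supp[of "map_key (cyc L ^^ m) a"] that
        by (simp add: coeff_pm keys_map_key_permutes[OF funpow_cyc_permutes] psize_map_key)
      show "mps_coeff (pm (cyc L ^^ m) f) ?a \<noteq> 0"
        using nz by (simp add: coeff_pm)
    qed auto
    then show ?thesis
      using inv by (simp add: \<mu>_def norm2_map_key ms_map_key)
  qed
  have "casimir (Suc L) (pm (cyc L ^^ m) f) = cst e * pm (cyc L ^^ m) f"
  proof -
    have "casimir (Suc L) (pm (cyc L ^^ m) f)
        = (\<Sum>i<Suc L. cst (bar (Suc L) \<mu> i * bar (Suc L) \<mu> i) * pm (cyc L ^^ m) f)"
      unfolding casimir_def
      by (rule sum.cong) (simp_all add: eig xi_cst_mult cst_hom mult.assoc)
    also have "\<dots> = cst e * pm (cyc L ^^ m) f"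
      by (rule mps_eqI) (simp add: coeff_sum e_def casimir_eigenvalue_def sum_distrib_right distrib_right)
    finally show ?thesis .
  qed
  then have "pm (cyc L ^^ m) (casimir (Suc L) f) = pm (cyc L ^^ m) (cst e * f)"
    by (simp add: pm_casimir[OF funpow_cyc_permutes] pm_mult pm_cst)
  then have cas: "casimir (Suc L) f = cst e * f"
    by (metis bij_funpow_cyc pm_inv(1))
  have "sym_stage (Suc L) l e m f"
    unfolding sym_stage_def
  proof (intro conjI allI impI)
    fix b assume nz: "mps_coeff f b \<noteq> 0"
    show "keys b \<subseteq> {..<Suc L}" "psize b = psize l" "norm2 b < norm2 l \<or> ms b = ms l"
      using supp[OF nz] norm[OF nz] by (auto simp: L_def)
    show "lookup b i \<noteq> 0" if "i < m" for i
      using supp[OF nz] that by blast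
  next
    fix b show "mps_coeff f b \<in> range eval_alpha"
      using F by (auto simp: coeff nonsym_jack_def integral_0)
  next
    fix \<pi> assume \<pi>: "\<pi> permutes {m..<Suc L}"
    then have "pm \<pi> F = F"
      using F keys_\<eta> by (simp add: nonsym_jack_def)
    then show "pm \<pi> f = f"
      using \<pi> by (simp add: f_def pm_mult pm_prod permutes_bij pm_X permutes_not_in)
  next
    fix S assume S: "{..<m} \<subseteq> S" "S \<subseteq> {..<Suc L}" "card S = psize l"
    then have fin: "finite S"
      using finite_subset by blast
    have "ind S - ind {..<m} = ind (S - {..<m})"
      using S fin by (intro poly_mapping_eqI) (auto simp: lookup_minus lookup_ind)
    moreover have "S - {..<m} \<subseteq> {m..<Suc L}"
      using S by auto
    moreover have "card (S - {..<m}) = psize \<eta>"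
      using S by (simp add: card_Diff_subset psize_\<eta>)
    ultimately have "mps_coeff F (ind S - ind {..<m}) = fact (psize \<eta>)"
      using F keys_\<eta> by (simp add: nonsym_jack_def)
    moreover have "\<forall>i<m. lookup (ind S) i \<noteq> 0"
      using S fin by (auto simp: lookup_ind)
    ultimately show "mps_coeff f (ind S) = fact (psize l - m)"
      by (simp add: coeff psize_\<eta>)
  qed (rule cas)
  moreover have "ms \<mu> = ms l"
    by (simp add: \<mu>_def ms_map_key bij_imp_bij_inv)
  ultimately show ?thesis
    using keys_\<mu> unfolding e_def L_def m_def by blast
qed

lemma ex_sym_stage:
  assumes "l \<in> partitions"
  shows "\<exists>\<mu> f. keys \<mu> \<subseteq> {..<Suc (psize l)} \<and> ms \<mu> = ms l \<and>
    sym_stage (Suc (psize l)) l (casimir_eigenvalue (Suc (psize l)) \<mu>) 0 f"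
proof -
  have "\<exists>f. sym_stage (Suc (psize l)) l e 0 f"
    if "sym_stage (Suc (psize l)) l e k f" "k \<le> psize l" for e k f
    using that
  proof (induction k arbitrary: f)
    case (Suc k)
    then show ?case
      using sym_stage_step[OF Suc.prems(1)] by (metis Suc_leD le_imp_less_Suc)
  qed blast
  then show ?thesis
    using ex_sym_stage_start[OF assms] plength_le_psize by blast
qed

section \<open>The Laplace-Beltrami operator\<close>

text \<open>On symmetric f, s_ij exchanges \<open>Eu i f\<close> and \<open>Eu j f\<close>. So this
  is the sum of \<alpha> (x_i d/dx_i)^2 f over i and of x_j (\<open>Eu i f\<close> -
  \<open>Eu j f\<close>)/(x_i - x_j) over i \<noteq> j.\<close>

definition LB :: "nat \<Rightarrow> ratfun mps \<Rightarrow> ratfun mps" where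
  "LB n f = (\<Sum>i<n. Zop n i (Eu i f))"

definition symmetric_vars :: "nat \<Rightarrow> 'a mps \<Rightarrow> bool" where
  "symmetric_vars n f \<longleftrightarrow> (\<forall>\<pi>. \<pi> permutes {..<n} \<longrightarrow> pm \<pi> f = f)"

lemma LB_zero [simp]: "LB n 0 = 0"
  by (simp add: LB_def)

lemma LB_add: "LB n (f + g) = LB n f + LB n g"
  by (simp add: LB_def Zop_add sum.distrib)

lemma LB_cst_mult: "LB n (cst c * f) = cst c * LB n f"
  by (simp add: LB_def Zop_cst_mult sum_distrib_left)

lemma LB_sum: "LB n (sum f A) = (\<Sum>x\<in>A. LB n (f x))"
  by (induction A rule: infinite_finite_induct) (auto simp: LB_add)

text \<open>Each b_j occurs L - j times in the inner sums and j times through the second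
  summand.\<close>

lemma sum_staircase:
  fixes b :: "nat \<Rightarrow> ratfun"
  shows "(\<Sum>i<Suc L. (\<Sum>j<i. b j) + of_nat i * b i) = of_nat L * (\<Sum>i<Suc L. b i)"
  by (induction L) (simp_all add: algebra_simps)

text \<open>On symmetric f divided differences vanish, so \<open>xi\<close> acts as \<alpha>
  \<open>Eu i\<close> - i. A second application yields \<open>Zop\<close> of \<open>Eu i f\<close>
  and first-order terms, which add up to a multiple of the total degree N by
  \<open>sum_staircase\<close>.\<close>

lemma casimir_symmetric:
  assumes sym: "symmetric_vars (Suc L) f"
    and supp: "\<And>b. mps_coeff f b \<noteq> 0 \<Longrightarrow> keys b \<subseteq> {..<Suc L} \<and> psize b = N"
  shows "casimir (Suc L) f = cst jack_alpha * LB (Suc L) f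
    + cst ((\<Sum>i<Suc L. of_nat (i * i)) - jack_alpha * of_nat (L * N)) * f"
proof -
  let ?n = "Suc L"
  have tr: "pm (Transposition.transpose i j) f = f" if "i < ?n" "j < ?n" for i j
    using sym that unfolding symmetric_vars_def by (auto intro: permutes_swap_id)
  have xi_f: "xi ?n i f = cst jack_alpha * Eu i f - cst (of_nat i) * f" if "i < ?n" for i
  proof -
    have "(\<Sum>j\<in>{..<?n} - {i}. X j * dd i j f) = 0"
      using that by (intro sum.neutral) (auto simp: dd_eq_0 tr)
    moreover have "(\<Sum>j<i. pm (Transposition.transpose i j) f) = (\<Sum>j<i. f)"
      using that by (intro sum.cong) (auto simp: tr)
    ultimately show ?thesis
      by (simp add: xi_def Zop_def cst_of_nat)
  qed
  have xi_Eu: "xi ?n i (Eu i f) = Zop ?n i (Eu i f) - (\<Sum>j<i. Eu j f)" if "i < ?n" for i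
    unfolding xi_def using that by (intro arg_cong2[where f = "(-)"] sum.cong) (auto simp: pm_Eu tr)
  show ?thesis
  proof (rule mps_eqI)
    fix b
    define x z where "x = mps_coeff f b" and "z i = mps_coeff (Zop ?n i (Eu i f)) b" for i
    have sq: "mps_coeff (xi ?n i (xi ?n i f)) b = jack_alpha * z i
        - jack_alpha * (((\<Sum>j<i. of_nat (lookup b j)) + of_nat i * of_nat (lookup b i)) * x)
        + of_nat (i * i) * x" if "i < ?n" for i
    proof -
      have sq: "xi ?n i (xi ?n i f) = cst jack_alpha * (Zop ?n i (Eu i f) - (\<Sum>j<i. Eu j f))
          - cst (of_nat i) * (cst jack_alpha * Eu i f - cst (of_nat i) * f)"
        by (simp only: xi_f[OF that] xi_minus xi_cst_mult xi_Eu[OF that])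
      have "mps_coeff (xi ?n i (xi ?n i f)) b = jack_alpha * (z i - (\<Sum>j<i. of_nat (lookup b j) * x))
          - of_nat i * (jack_alpha * (of_nat (lookup b i) * x) - of_nat i * x)"
        unfolding sq by (simp only: coeff_simps coeff_cst_mult coeff_sum coeff_Eu x_def z_def)
      then show ?thesis
        by (simp only: sum_distrib_right[symmetric]) (simp add: algebra_simps)
    qed
    have size: "(\<Sum>i<?n. of_nat (lookup b i)) * x = of_nat N * x"
    proof (cases "x = 0")
      case False
      then have "keys b \<subseteq> {..<?n}" "psize b = N"
        using supp by (auto simp: x_def)
      then have "(\<Sum>i<?n. lookup b i) = N"
        by (metis psize_superset finite_lessThan)
      then show ?thesis
        by (simp only: flip: of_nat_sum)
    qed simp
    define s :: "nat \<Rightarrow> ratfun"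
      where "s i = (\<Sum>j<i. of_nat (lookup b j)) + of_nat i * of_nat (lookup b i)" for i
    have "mps_coeff (casimir ?n f) b
        = (\<Sum>i<?n. jack_alpha * z i - jack_alpha * (s i * x) + of_nat (i * i) * x)"
      unfolding casimir_def coeff_sum by (rule sum.cong) (auto simp: sq s_def)
    also have "\<dots> = jack_alpha * sum z {..<?n} - jack_alpha * (sum s {..<?n} * x)
        + (\<Sum>i<?n. of_nat (i * i)) * x"
      by (simp only: sum.distrib sum_subtractf sum_distrib_left sum_distrib_right)
    also have "sum s {..<?n} * x = of_nat L * (of_nat N * x)"
      unfolding s_def sum_staircase by (simp only: mult.assoc size)
    finally show "mps_coeff (casimir ?n f) b = mps_coeff (cst jack_alpha * LB ?n f
        + cst ((\<Sum>i<?n. of_nat (i * i)) - jack_alpha * of_nat (L * N)) * f) b"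
      by (simp only: LB_def coeff_simps coeff_cst_mult coeff_sum z_def x_def of_nat_mult)
        (simp add: algebra_simps)
  qed
qed

text \<open>Subtraction of naturals truncates, so only pairs with the larger entry at j
  contribute.\<close>

definition lb_shift :: "nat \<Rightarrow> mon \<Rightarrow> nat" where
  "lb_shift n b = (\<Sum>i<n. \<Sum>j\<in>{..<n} - {i}. lookup b j - lookup b i)"

definition lb_eigenvalue :: "nat \<Rightarrow> mon \<Rightarrow> ratfun" where
  "lb_eigenvalue n b = jack_alpha * of_nat (norm2 b) + of_nat (lb_shift n b)"

text \<open>By symmetry f has equal coefficients at b and at its swap, while \<open>Eu i\<close>
  weights them by the j-th and the i-th exponent. The term surviving in
  \<open>coeff_X_dd_maximal\<close> is then a multiple of the coefficient at b.\<close>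

lemma coeff_LB_maximal:
  assumes sym: "symmetric_vars n f" and b: "keys b \<subseteq> {..<n}"
    and max: "\<And>a. norm2 b < norm2 a \<Longrightarrow> mps_coeff f a = 0"
  shows "mps_coeff (LB n f) b = lb_eigenvalue n b * mps_coeff f b"
proof -
  have "mps_coeff (Zop n i (Eu i f)) b = (jack_alpha * of_nat ((lookup b i)\<^sup>2)
      + of_nat (\<Sum>j\<in>{..<n} - {i}. lookup b j - lookup b i)) * mps_coeff f b" if "i < n" for i
  proof -
    have "mps_coeff (X j * dd i j (Eu i f)) b = of_nat (lookup b j - lookup b i) * mps_coeff f b"
      if j: "j \<in> {..<n} - {i}" for j
    proof -
      have "pm (Transposition.transpose i j) f = f"
        using sym \<open>i < n\<close> j by (auto simp: symmetric_vars_def intro: permutes_swap_id)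
      then have "mps_coeff f (map_key (Transposition.transpose i j) b) = mps_coeff f b"
        by (metis coeff_pm)
      moreover have "mps_coeff (X j * dd i j (Eu i f)) b = (if lookup b i < lookup b j
          then mps_coeff (Eu i f) (map_key (Transposition.transpose i j) b) - mps_coeff (Eu i f) b else 0)"
        using j max by (intro coeff_X_dd_maximal) auto
      ultimately show ?thesis
        by (simp add: lookup_map_key of_nat_diff algebra_simps)
    qed
    then have "(\<Sum>j\<in>{..<n} - {i}. mps_coeff (X j * dd i j (Eu i f)) b)
        = (\<Sum>j\<in>{..<n} - {i}. of_nat (lookup b j - lookup b i) * mps_coeff f b)"
      by (rule sum.cong[OF refl])
    then show ?thesis
      by (simp add: Zop_def coeff_sum power2_eq_square distrib_right mult.assoc flip: sum_distrib_right)
  qed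
  then have "mps_coeff (LB n f) b = (\<Sum>i<n. (jack_alpha * of_nat ((lookup b i)\<^sup>2)
      + of_nat (\<Sum>j\<in>{..<n} - {i}. lookup b j - lookup b i)) * mps_coeff f b)"
    unfolding LB_def coeff_sum by (intro sum.cong) auto
  also have "\<dots> = (jack_alpha * of_nat (\<Sum>i<n. (lookup b i)\<^sup>2) + of_nat (lb_shift n b)) * mps_coeff f b"
    unfolding lb_shift_def of_nat_sum sum_distrib_left sum_distrib_right sum.distrib[symmetric]
    by (rule refl)
  also have "(\<Sum>i<n. (lookup b i)\<^sup>2) = norm2 b"
    using b by (simp add: norm2_superset[of "{..<n}"])
  finally show ?thesis
    by (simp add: lb_eigenvalue_def)
qed

lemma jack_alpha_quadratic_inj:
  assumes "jack_alpha * (jack_alpha * of_nat a + of_nat b) + of_nat c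
    = jack_alpha * (jack_alpha * of_nat a' + of_nat b') + of_nat c'"
  shows "a = a'"
proof -
  have *: False if eq: "jack_alpha * (jack_alpha * of_nat a + of_nat b) + of_nat c
      = jack_alpha * (jack_alpha * of_nat a' + of_nat b') + of_nat c'" and "a < a'" for a b c a' b' c'
  proof -
    have "jack_alpha * of_nat a + jack_alpha \<le> jack_alpha * of_nat a'"
      using mult_left_mono[of "of_nat (Suc a)" "of_nat a'" jack_alpha] that(2) jack_alpha_pos
        of_nat_mono[of "Suc a" a', where 'a = ratfun]
      by (simp add: distrib_left add.commute)
    then have "jack_alpha * of_nat a + of_nat (Suc b) \<le> jack_alpha * of_nat a' + of_nat b'"
      using of_nat_less_jack_alpha[of "Suc b"] of_nat_0_le_iff[of b', where 'a = ratfun] by linarith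
    then have "jack_alpha * (jack_alpha * of_nat a + of_nat (Suc b))
        \<le> jack_alpha * (jack_alpha * of_nat a' + of_nat b')"
      using jack_alpha_pos by (intro mult_left_mono) auto
    then show False
      using eq of_nat_less_jack_alpha[of c] of_nat_0_le_iff[of c', where 'a = ratfun]
      by (simp add: algebra_simps)
  qed
  then show ?thesis
    using assms by (metis linorder_neqE_nat)
qed

text \<open>Both sides are quadratic in \<alpha>, with \<alpha>^2 coefficients
  \<open>norm2 b\<close> and \<open>norm2 \<mu>\<close>. Negative terms are moved across so that all
  coefficients are naturals, as \<open>jack_alpha_quadratic_inj\<close> requires.\<close>

lemma lb_eigenvalue_norm2:
  assumes "keys \<mu> \<subseteq> {..<n}"
    and e: "jack_alpha * lb_eigenvalue n b = casimir_eigenvalue n \<mu> + (jack_alpha * of_nat p - of_nat q)"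
  shows "norm2 b = norm2 \<mu>"
proof -
  have "casimir_eigenvalue n \<mu> = (\<Sum>i<n. jack_alpha * (jack_alpha * of_nat ((lookup \<mu> i)\<^sup>2))
      - jack_alpha * of_nat (2 * lookup \<mu> i * cbar n \<mu> i) + of_nat (cbar n \<mu> i * cbar n \<mu> i))"
    unfolding casimir_eigenvalue_def bar_def by (rule sum.cong) (auto simp: power2_eq_square algebra_simps)
  also have "\<dots> = jack_alpha * (jack_alpha * of_nat (\<Sum>i<n. (lookup \<mu> i)\<^sup>2))
      - jack_alpha * of_nat (\<Sum>i<n. 2 * lookup \<mu> i * cbar n \<mu> i)
      + of_nat (\<Sum>i<n. cbar n \<mu> i * cbar n \<mu> i)"
    by (simp only: of_nat_sum sum_distrib_left sum.distrib sum_subtractf)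
  also have "(\<Sum>i<n. (lookup \<mu> i)\<^sup>2) = norm2 \<mu>"
    using assms(1) by (simp add: norm2_superset[of "{..<n}"])
  finally have "jack_alpha * (jack_alpha * of_nat (norm2 b)
        + of_nat (lb_shift n b + (\<Sum>i<n. 2 * lookup \<mu> i * cbar n \<mu> i))) + of_nat q
      = jack_alpha * (jack_alpha * of_nat (norm2 \<mu>) + of_nat p) + of_nat (\<Sum>i<n. cbar n \<mu> i * cbar n \<mu> i)"
    using e by (simp add: lb_eigenvalue_def algebra_simps)
  then show ?thesis
    by (rule jack_alpha_quadratic_inj)
qed

text \<open>The condition on e says that it is not a diagonal entry of the Laplace-Beltrami operator
  at any lower value of \<open>norm2\<close>; this separates f from the lower part in the uniqueness
  argument.\<close>

theorem ex_integral_LB_eigenfunction: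
  assumes l: "l \<in> partitions"
  defines "N \<equiv> psize l"
  defines "n \<equiv> Suc N"
  shows "\<exists>f e.
    (\<forall>b. mps_coeff f b \<noteq> 0 \<longrightarrow>
       keys b \<subseteq> {..<n} \<and> psize b = N \<and> (norm2 b < norm2 l \<or> ms b = ms l)) \<and>
    (\<forall>b. mps_coeff f b \<in> range eval_alpha) \<and>
    symmetric_vars n f \<and> LB n f = cst e * f \<and>
    (\<forall>b. e = lb_eigenvalue n b \<longrightarrow> norm2 b = norm2 l) \<and>
    mps_coeff f (pones N) = fact N"
proof -
  let ?n = "Suc N"
  obtain \<mu> f where \<mu>: "keys \<mu> \<subseteq> {..<?n}" "ms \<mu> = ms l"
    and stage: "sym_stage ?n l (casimir_eigenvalue ?n \<mu>) 0 f"
    using ex_sym_stage[OF l] unfolding N_def by blast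
  define c where "c = (\<Sum>i<?n. of_nat (i * i)) - jack_alpha * of_nat (N * N)"
  define e where "e = (casimir_eigenvalue ?n \<mu> - c) / jack_alpha"
  have supp: "keys b \<subseteq> {..<?n} \<and> psize b = N \<and> (norm2 b < norm2 l \<or> ms b = ms l)"
    if "mps_coeff f b \<noteq> 0" for b
    using stage that unfolding sym_stage_def N_def by blast
  have sym: "symmetric_vars ?n f"
    using stage by (simp add: sym_stage_def symmetric_vars_def lessThan_atLeast0)
  have "cst jack_alpha * LB ?n f + cst c * f = cst (casimir_eigenvalue ?n \<mu>) * f"
    using casimir_symmetric[OF sym, of N] supp stage unfolding c_def by (auto simp: sym_stage_def)
  then have "cst jack_alpha * LB ?n f = cst (casimir_eigenvalue ?n \<mu> - c) * f"
    by (simp add: cst_hom algebra_simps)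
  also have "casimir_eigenvalue ?n \<mu> - c = jack_alpha * e"
    using jack_alpha_pos by (simp add: e_def)
  finally have "cst jack_alpha * LB ?n f = cst jack_alpha * (cst e * f)"
    by (simp add: cst_hom mult.assoc)
  then have "LB ?n f = cst e * f"
    by (rule cst_mult_cancel[rotated]) (use jack_alpha_pos in simp)
  moreover have "norm2 b = norm2 l" if "e = lb_eigenvalue ?n b" for b
  proof -
    have "jack_alpha * lb_eigenvalue ?n b = casimir_eigenvalue ?n \<mu>
        + (jack_alpha * of_nat (N * N) - of_nat (\<Sum>i<?n. i * i))"
      using that jack_alpha_pos by (simp add: e_def c_def field_simps)
    then have "norm2 b = norm2 \<mu>"
      by (rule lb_eigenvalue_norm2[OF \<mu>(1)])
    then show ?thesis
      using \<mu>(2) by (simp add: norm2_eq_sum_ms)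
  qed
  moreover have "mps_coeff f (pones N) = fact N"
  proof -
    have "{..<N} \<subseteq> {..<?n}" by auto
    then show ?thesis
      using stage by (simp add: sym_stage_def pones_eq_ind N_def)
  qed
  moreover have "mps_coeff f b \<in> range eval_alpha" for b
    using stage by (simp add: sym_stage_def)
  ultimately show ?thesis
    using supp sym unfolding n_def by blast
qed

section \<open>Linear algebra\<close>

text \<open>An index with least \<nu> has a column whose only nonzero entry is the diagonal one. It
  determines one unknown, and induction handles the rest.\<close>

lemma triangular_system:
  fixes R :: "'i \<Rightarrow> 'i \<Rightarrow> 'k::field" and h :: "'i \<Rightarrow> 'k" and \<nu> :: "'i \<Rightarrow> nat"
  assumes "finite I" and "\<And>M. M \<in> I \<Longrightarrow> R M M \<noteq> 0"
    and "\<And>M K. M \<in> I \<Longrightarrow> K \<in> I \<Longrightarrow> R M K \<noteq> 0 \<Longrightarrow> M = K \<or> \<nu> M < \<nu> K"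
  shows "\<exists>c. \<forall>K\<in>I. (\<Sum>M\<in>I. c M * R M K) = h K"
    and "(\<And>K. K \<in> I \<Longrightarrow> (\<Sum>M\<in>I. c M * R M K) = 0) \<Longrightarrow> M \<in> I \<Longrightarrow> c M = 0"
proof -
  have "(\<exists>c. \<forall>K\<in>I. (\<Sum>M\<in>I. c M * R M K) = h K) \<and>
      (\<forall>c. (\<forall>K\<in>I. (\<Sum>M\<in>I. c M * R M K) = 0) \<longrightarrow> (\<forall>M\<in>I. c M = 0))"
    using assms
  proof (induction I arbitrary: h rule: finite_psubset_induct)
    case (psubset I)
    show ?case
    proof (cases "I = {}")
      case False
      then obtain M0 where M0: "M0 \<in> I" and min: "\<And>M. M \<in> I \<Longrightarrow> \<nu> M0 \<le> \<nu> M"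
        using ex_has_least_nat[of "\<lambda>M. M \<in> I" _ \<nu>] by auto
      let ?I = "I - {M0}"
      have IH: "(\<exists>c. \<forall>K\<in>?I. (\<Sum>M\<in>?I. c M * R M K) = h K) \<and>
          (\<forall>c. (\<forall>K\<in>?I. (\<Sum>M\<in>?I. c M * R M K) = 0) \<longrightarrow> (\<forall>M\<in>?I. c M = 0))" for h
        by (rule psubset.IH) (use M0 psubset.prems in auto)
      have split: "(\<Sum>M\<in>I. g M) = g M0 + (\<Sum>M\<in>?I. g M)" for g :: "'i \<Rightarrow> 'k"
        using M0 psubset.hyps by (simp add: sum.remove)
      have zero: "R M M0 = 0" if "M \<in> ?I" for M
        using psubset.prems(2)[of M M0] min[of M] M0 that by force
      have col: "(\<Sum>M\<in>I. c M * R M M0) = c M0 * R M0 M0" for c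
        unfolding split by (simp add: zero)
      \<comment> \<open>The value h M0 / R M0 M0 is forced by the column of M0; its contribution is
        subtracted from the remaining right-hand sides.\<close>
      obtain c where c: "\<forall>K\<in>?I. (\<Sum>M\<in>?I. c M * R M K) = h K - h M0 / R M0 M0 * R M0 K"
        using IH[of "\<lambda>K. h K - h M0 / R M0 M0 * R M0 K"] by blast
      have rest: "(\<Sum>M\<in>?I. (c(M0 := x)) M * R M K) = (\<Sum>M\<in>?I. c M * R M K)" for x K
        by (rule sum.cong) auto
      have "(\<Sum>M\<in>I. (c(M0 := h M0 / R M0 M0)) M * R M K) = h K" if "K \<in> I" for K
      proof (cases "K = M0")
        case True
        then show ?thesis
          using psubset.prems(1)[OF M0] by (simp only: col) simp
      next
        case False
        then have "K \<in> ?I"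
          using that by simp
        then show ?thesis
          unfolding split rest using c by simp
      qed
      then have "\<exists>c. \<forall>K\<in>I. (\<Sum>M\<in>I. c M * R M K) = h K"
        by blast
      moreover have "\<forall>M\<in>I. c M = 0" if c: "\<forall>K\<in>I. (\<Sum>M\<in>I. c M * R M K) = 0" for c
      proof -
        have c0: "c M0 = 0"
          using c[rule_format, OF M0] psubset.prems(1)[OF M0] unfolding col by simp
        then have "\<forall>K\<in>?I. (\<Sum>M\<in>?I. c M * R M K) = 0"
          using c by (simp add: split)
        then show ?thesis
          using IH c0 by blast
      qed
      ultimately show ?thesis by blast
    qed simp
  qed
  then show "\<exists>c. \<forall>K\<in>I. (\<Sum>M\<in>I. c M * R M K) = h K"
    and "(\<And>K. K \<in> I \<Longrightarrow> (\<Sum>M\<in>I. c M * R M K) = 0) \<Longrightarrow> M \<in> I \<Longrightarrow> c M = 0"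
    by blast+
qed

text \<open>An orthogonal family that is triangular with respect to a grading \<open>\<nu>\<close> spans every lower
  filtration step, so each member is determined up to a scalar by its shape and its orthogonality
  to the lower part. An eigenvector \<open>f\<close> of a self-adjoint triangular operator is orthogonal to the
  lower part as well, because its eigenvalue \<open>e\<close> does not occur there.\<close>

lemma triangular_eigenvector_unique:
  fixes B :: "('i \<Rightarrow> 'k::field) \<Rightarrow> ('i \<Rightarrow> 'k) \<Rightarrow> 'k" and \<nu> :: "'i \<Rightarrow> nat"
    and J :: "'i \<Rightarrow> 'i \<Rightarrow> 'k"
  defines "\<delta> \<equiv> \<lambda>k j. if j = k then 1 else 0"
  assumes fin: "finite I"
    and lin: "\<And>g h. B g h = (\<Sum>k\<in>I. g k * B (\<delta> k) h)"
    and sym: "\<And>g h. B g h = B h g"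
    and definite: "\<And>h k. B h h = 0 \<Longrightarrow> k \<in> I \<Longrightarrow> h k = 0"
    and J_supp: "\<And>i k. i \<in> I \<Longrightarrow> k \<in> I \<Longrightarrow> J i k \<noteq> 0 \<Longrightarrow> k = i \<or> \<nu> k < \<nu> i"
    and J_orth: "\<And>i j. i \<in> I \<Longrightarrow> j \<in> I \<Longrightarrow> i \<noteq> j \<Longrightarrow> B (J i) (J j) = 0"
    and J_nz: "\<And>i. i \<in> I \<Longrightarrow> \<exists>k\<in>I. J i k \<noteq> 0"
    and i: "i \<in> I"
    and f_supp: "\<And>k. k \<in> I \<Longrightarrow> f k \<noteq> 0 \<Longrightarrow> k = i \<or> \<nu> k < \<nu> i"
    and D: "\<And>k. k \<in> I \<Longrightarrow> \<nu> k < \<nu> i \<Longrightarrow> B f (D k) = e * B f (\<delta> k)"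
    and D_supp: "\<And>k j. k \<in> I \<Longrightarrow> j \<in> I \<Longrightarrow> D k j \<noteq> 0 \<Longrightarrow> j = k \<or> \<nu> j < \<nu> k"
    and D_diag: "\<And>k. k \<in> I \<Longrightarrow> \<nu> k < \<nu> i \<Longrightarrow> D k k \<noteq> e"
  shows "\<exists>c. \<forall>k\<in>I. f k = c * J i k"
proof -
  have lin1: "B g h = g k * B (\<delta> k) h"
    if "k \<in> I" and "\<And>j. j \<in> I \<Longrightarrow> j \<noteq> k \<Longrightarrow> g j * B (\<delta> j) h = 0" for g h k
  proof -
    have "(\<Sum>j\<in>I - {k}. g j * B (\<delta> j) h) = 0"
      using that by (intro sum.neutral) auto
    then show ?thesis
      using that(1) fin by (simp add: lin[of g] sum.remove)
  qed
  have J: "J i i \<noteq> 0 \<and> (\<forall>k\<in>I. \<nu> k < \<nu> i \<longrightarrow> B (J i) (\<delta> k) = 0)" if "i \<in> I" for i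
    using that
  proof (induction "\<nu> i" arbitrary: i rule: less_induct)
    case (less i)
    have orth: "B (\<delta> k) (J i) = 0" if "k \<in> I" "\<nu> k < \<nu> i" for k
      using that
    proof (induction "\<nu> k" arbitrary: k rule: less_induct)
      case (less k)
      have "0 = B (J k) (J i)"
        using J_orth[of k i] less.prems \<open>i \<in> I\<close> by auto
      also have "\<dots> = J k k * B (\<delta> k) (J i)"
        using less J_supp[of k] by (intro lin1) force+
      finally show ?case
        using less.prems \<open>\<And>j. \<nu> j < \<nu> i \<Longrightarrow> j \<in> I \<Longrightarrow> J j j \<noteq> 0 \<and> _\<close> by auto
    qed
    \<comment> \<open>Otherwise J i would lie in the lower part, to which it is orthogonal, and so
      be orthogonal to itself.\<close>
    have "J i i \<noteq> 0"
    proof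
      assume "J i i = 0"
      then have "B (J i) (J i) = 0"
        unfolding lin[of "J i" "J i"] using orth J_supp[OF less.prems] by (intro sum.neutral) force
      then show False
        using J_nz[OF less.prems] definite by blast
    qed
    then show ?case
      using orth sym by metis
  qed
  have f_orth: "B (\<delta> k) f = 0" if "k \<in> I" "\<nu> k < \<nu> i" for k
    using that
  proof (induction "\<nu> k" arbitrary: k rule: less_induct)
    case (less k)
    \<comment> \<open>Of the expansion of D k only the diagonal term is left, since the lower terms
      are orthogonal to f by induction. As \<open>D k k\<close> differs from e, the product
      vanishes.\<close>
    have "e * B (\<delta> k) f = B (D k) f"
      using D[OF less.prems] by (simp add: sym)
    also have "\<dots> = D k k * B (\<delta> k) f"
      using less D_supp[of k] by (intro lin1) force+
    finally show ?case
      using D_diag[OF less.prems] by simp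
  qed
  \<comment> \<open>The combination h cancels the coordinate i, so it lies in the lower part while
    being orthogonal to it. Definiteness gives h = 0.\<close>
  define a b where "a = J i i" and "b = f i"
  define h where "h k = a * f k - b * J i k" for k
  have "h k = 0 \<or> \<nu> k < \<nu> i" if "k \<in> I" for k
  proof (cases "k = i")
    case False
    then have "\<not> \<nu> k < \<nu> i \<Longrightarrow> f k = 0 \<and> J i k = 0"
      using f_supp[of k] J_supp[of i k] i that by auto
    then show ?thesis
      by (auto simp: h_def)
  qed (simp add: h_def a_def b_def)
  moreover have "B (\<delta> k) h = 0" if "k \<in> I" "\<nu> k < \<nu> i" for k
  proof -
    have "B h (\<delta> k) = a * B f (\<delta> k) - b * B (J i) (\<delta> k)"
      unfolding lin[of h] lin[of f] lin[of "J i"]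
      by (simp add: h_def sum_distrib_left sum_subtractf algebra_simps)
    then show ?thesis
      using f_orth[OF that] J[OF i] that by (simp add: sym)
  qed
  ultimately have "B h h = 0"
    unfolding lin[of h h] by (intro sum.neutral) force
  then have "h k = 0" if "k \<in> I" for k
    using definite that by blast
  moreover have "a \<noteq> 0"
    using J[OF i] by (simp add: a_def)
  ultimately have "\<forall>k\<in>I. f k = b / a * J i k"
    by (simp add: h_def field_simps)
  then show ?thesis by blast
qed

section \<open>Power sums\<close>

definition pw :: "nat \<Rightarrow> nat \<Rightarrow> ratfun mps" where
  "pw n k = (\<Sum>i<n. X i ^ k)"

definition PP :: "nat \<Rightarrow> nat multiset \<Rightarrow> ratfun mps" where
  "PP n M = (\<Prod>k\<in>#M. pw n k)"

lemma PP_empty [simp]: "PP n {#} = 1"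
  by (simp add: PP_def)

lemma PP_add [simp]: "PP n (add_mset k M) = pw n k * PP n M"
  by (simp add: PP_def)

lemma pm_pw: "\<pi> permutes {..<n} \<Longrightarrow> pm \<pi> (pw n k) = pw n k"
  using sum.permute[of \<pi> "{..<n}" "\<lambda>i. X i ^ k :: ratfun mps", symmetric]
  by (simp add: pw_def pm_sum pm_power pm_X permutes_bij comp_def)

lemma pm_PP: "\<pi> permutes {..<n} \<Longrightarrow> pm \<pi> (PP n M) = PP n M"
  by (induction M) (simp_all add: pm_one pm_mult pm_pw permutes_bij)

lemma sum_mset_eq_sum_count:
  fixes g :: "'b \<Rightarrow> 'a::comm_semiring_1"
  assumes "finite A" "set_mset M \<subseteq> A"
  shows "(\<Sum>k\<in>#M. g k) = (\<Sum>k\<in>A. of_nat (count M k) * g k)"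
  using assms(2)
proof (induction M)
  case (add x M)
  have "(\<Sum>k\<in>A. of_nat (count (add_mset x M) k) * g k)
      = (\<Sum>k\<in>A. of_nat (count M k) * g k + (if k = x then g k else 0))"
    by (rule sum.cong) (auto simp: algebra_simps)
  also have "\<dots> = (\<Sum>k\<in>A. of_nat (count M k) * g k) + g x"
    using add.prems assms(1) by (simp add: sum.distrib)
  finally show ?case
    using add by (simp add: add.commute)
qed simp

lemma Eu_PP:
  assumes "i < n"
  shows "Eu i (PP n M) = (\<Sum>k\<in>#M. of_nat k * (X i ^ k * PP n (M - {#k#})))"
proof (induction M)
  case (add k M)
  have pw: "Eu i (pw n k) = of_nat k * X i ^ k"
    using assms by (simp add: pw_def Eu_sum Eu_X_power)
  have "(\<Sum>l\<in>#M. of_nat l * (X i ^ l * PP n (add_mset k M - {#l#})))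
      = (\<Sum>l\<in>#M. pw n k * (of_nat l * (X i ^ l * PP n (M - {#l#}))))"
  proof (rule arg_cong[where f = sum_mset], rule image_mset_cong)
    fix l assume "l \<in># M"
    then have "add_mset k M - {#l#} = add_mset k (M - {#l#})"
      by (metis add_mset_add_single multiset_diff_union_assoc single_subset_iff union_mset_add_mset_right union_commute)
    then show "of_nat l * (X i ^ l * PP n (add_mset k M - {#l#}))
        = pw n k * (of_nat l * (X i ^ l * PP n (M - {#l#})))"
      by (simp add: mult_ac)
  qed
  then show ?case
    by (simp add: Eu_mult pw add sum_mset_distrib_left mult_ac)
qed simp

lemma X_mult_dd_power:
  assumes "i \<noteq> j"
  shows "X j * dd i j (X i ^ k) = (\<Sum>a\<in>{1..k}. X j ^ a * X i ^ (k - a) :: ratfun mps)"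
proof -
  have "dd i j (X i ^ k) = (\<Sum>a<k. X j ^ (k - Suc a) * X i ^ a :: ratfun mps)"
    by (rule dd_unique[OF assms]) (simp add: pm_power pm_X power_diff_sumr2)
  moreover have "X j * (X j ^ (k - Suc a) * X i ^ a) = (X j ^ (k - a) * X i ^ a :: ratfun mps)" if "a < k" for a
  proof -
    have "k - a = Suc (k - Suc a)"
      using that by simp
    then show ?thesis
      by (simp add: mult.assoc)
  qed
  ultimately have "X j * dd i j (X i ^ k) = (\<Sum>a<k. X j ^ (k - a) * X i ^ a :: ratfun mps)"
    by (simp add: sum_distrib_left)
  also have "\<dots> = (\<Sum>a\<in>{1..k}. X j ^ a * X i ^ (k - a) :: ratfun mps)"
    by (rule sum.reindex_bij_witness[of _ "\<lambda>a. k - a" "\<lambda>a. k - a"]) auto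
  finally show ?thesis .
qed

text \<open>Differentiating \<open>PP n K\<close> merges k with another part l. The divided
  differences of x_i^k give products p_a p_{k-a}, which split k, minus the diagonal terms i =
  j.\<close>

lemma sum_Zop_power:
  assumes "0 < k" "finite A" "set_mset K \<subseteq> A"
  shows "(\<Sum>i<n. Zop n i (X i ^ k * PP n K))
    = cst (jack_alpha * of_nat k + of_nat n - of_nat k) * PP n (add_mset k K)
      + (\<Sum>l\<in>A. cst (jack_alpha * of_nat (count K l * l)) * PP n (add_mset (k + l) (K - {#l#})))
      + (\<Sum>a\<in>{1..<k}. PP n (add_mset a (add_mset (k - a) K)))"
proof -
  define S where "S i = (\<Sum>j\<in>{..<n} - {i}. \<Sum>a\<in>{1..k}. X j ^ a * X i ^ (k - a) :: ratfun mps)" for i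
  have Z: "Zop n i (X i ^ k * PP n K) = cst jack_alpha * (of_nat k * (X i ^ k * PP n K))
      + cst jack_alpha * (X i ^ k * Eu i (PP n K)) + S i * PP n K" if "i < n" for i
  proof -
    have "X j * dd i j (X i ^ k * PP n K) = (\<Sum>a\<in>{1..k}. X j ^ a * X i ^ (k - a)) * PP n K"
      if j: "j \<in> {..<n} - {i}" for j
    proof -
      have "Transposition.transpose i j permutes {..<n}"
        using j \<open>i < n\<close> by (intro permutes_swap_id) auto
      then have "dd i j (PP n K * X i ^ k) = PP n K * dd i j (X i ^ k)"
        using j by (intro dd_mult_sym) (auto simp: pm_PP)
      then have "X j * dd i j (X i ^ k * PP n K) = (X j * dd i j (X i ^ k)) * PP n K"
        by (simp only: mult.commute mult.left_commute)
      then show ?thesis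
        using j by (simp only: X_mult_dd_power[of i j k]) (simp add: X_mult_dd_power)
    qed
    then have "(\<Sum>j\<in>{..<n} - {i}. X j * dd i j (X i ^ k * PP n K)) = S i * PP n K"
      unfolding S_def sum_distrib_right[of _ _ "PP n K"] by (intro sum.cong) auto
    then show ?thesis
      by (simp add: Zop_def Eu_mult Eu_X_power distrib_left mult.assoc)
  qed
  have "(\<Sum>i<n. S i) = (\<Sum>i<n. \<Sum>a\<in>{1..k}. (\<Sum>j<n. X j ^ a * X i ^ (k - a)) - X i ^ k)"
  proof (rule sum.cong)
    fix i assume i: "i \<in> {..<n}"
    have "(\<Sum>j\<in>{..<n} - {i}. X j ^ a * X i ^ (k - a)) = (\<Sum>j<n. X j ^ a * X i ^ (k - a)) - (X i ^ k :: ratfun mps)"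
      if "a \<in> {1..k}" for a
      using i that by (simp add: sum_diff1 flip: power_add)
    then show "S i = (\<Sum>a\<in>{1..k}. (\<Sum>j<n. X j ^ a * X i ^ (k - a)) - X i ^ k)"
      unfolding S_def by (subst sum.swap) (auto intro: sum.cong)
  qed simp
  also have "\<dots> = (\<Sum>a\<in>{1..k}. pw n a * pw n (k - a)) - of_nat k * pw n k"
  proof -
    have "(\<Sum>i<n. \<Sum>j<n. X j ^ a * X i ^ (k - a)) = pw n a * pw n (k - a)" for a
      unfolding pw_def sum_product by (rule sum.swap)
    then show ?thesis
      by (subst sum.swap) (simp add: sum_subtractf pw_def[of n k])
  qed
  also have "(\<Sum>a\<in>{1..k}. pw n a * pw n (k - a)) = (\<Sum>a\<in>{1..<k}. pw n a * pw n (k - a)) + of_nat n * pw n k"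
  proof -
    \<comment> \<open>The boundary term a = k is a multiple of p_k because the power sum of exponent
      0 equals n.\<close>
    have "{1..k} = insert k {1..<k}"
      using assms(1) by auto
    then show ?thesis
      by (simp add: pw_def[of n 0] mult.commute add.commute)
  qed
  finally have S: "(\<Sum>i<n. S i) = (\<Sum>a\<in>{1..<k}. pw n a * pw n (k - a)) + of_nat n * pw n k - of_nat k * pw n k" .
  have E: "(\<Sum>i<n. X i ^ k * Eu i (PP n K)) = (\<Sum>l\<in>A. cst (of_nat (count K l * l)) * PP n (add_mset (k + l) (K - {#l#})))"
  proof -
    have "(\<Sum>i<n. X i ^ k * Eu i (PP n K))
        = (\<Sum>i<n. \<Sum>l\<in>A. cst (of_nat (count K l * l)) * (X i ^ (k + l) * PP n (K - {#l#})))"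
      by (rule sum.cong) (auto simp: Eu_PP sum_mset_eq_sum_count[OF assms(2,3)] sum_distrib_left
          power_add cst_hom(5) cst_of_nat mult_ac)
    also have "\<dots> = (\<Sum>l\<in>A. cst (of_nat (count K l * l)) * PP n (add_mset (k + l) (K - {#l#})))"
      by (subst sum.swap) (simp add: pw_def sum_distrib_left sum_distrib_right)
    finally show ?thesis .
  qed
  have "(\<Sum>i<n. Zop n i (X i ^ k * PP n K)) = cst jack_alpha * (of_nat k * (pw n k * PP n K))
      + cst jack_alpha * (\<Sum>i<n. X i ^ k * Eu i (PP n K)) + (\<Sum>i<n. S i) * PP n K"
    by (simp add: Z sum.distrib pw_def sum_distrib_left sum_distrib_right)
  then show ?thesis
    unfolding S E
    by (simp add: cst_hom cst_of_nat sum_distrib_left sum_distrib_right algebra_simps)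
qed

definition theta :: "nat \<Rightarrow> nat \<Rightarrow> (nat multiset \<Rightarrow> ratfun) \<Rightarrow> ratfun mps" where
  "theta n N c = (\<Sum>M\<in>mpartitions N. cst (c M) * PP n M)"

lemma theta_add: "theta n N (\<lambda>M. c M + d M) = theta n N c + theta n N d"
  by (simp add: theta_def cst_hom distrib_right sum.distrib)

lemma theta_scale: "theta n N (\<lambda>M. x * c M) = cst x * theta n N c"
  by (simp add: theta_def cst_hom sum_distrib_left mult.assoc)

lemma theta_zero: "theta n N (\<lambda>M. 0) = 0"
  by (simp add: theta_def cst_hom)

lemma theta_sum: "theta n N (\<lambda>M. \<Sum>x\<in>A. c x M) = (\<Sum>x\<in>A. theta n N (c x))"
  by (induction A rule: infinite_finite_induct) (simp_all add: theta_zero theta_add)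

lemma theta_delta: "Q \<in> mpartitions N \<Longrightarrow> theta n N (\<lambda>M. if Q = M then 1 else 0) = PP n Q"
proof -
  assume Q: "Q \<in> mpartitions N"
  have "theta n N (\<lambda>M. if Q = M then 1 else 0) = (\<Sum>M\<in>{Q}. cst (if Q = M then 1 else 0) * PP n M)"
    unfolding theta_def using Q by (intro sum.mono_neutral_right) (auto simp: cst_hom)
  then show ?thesis
    by (simp add: cst_hom)
qed

text \<open>The cut-and-join matrix of \<open>LB\<close> (\<open>LB_PP\<close>): a part k is kept,
  merged with a part l, or split into a and k - a. The multiplicity of l is taken after removing k,
  which matters for l = k.\<close>

definition dmat :: "nat \<Rightarrow> nat \<Rightarrow> nat multiset \<Rightarrow> nat multiset \<Rightarrow> ratfun" where
  "dmat n N M M' = (\<Sum>k\<in>{1..N}. of_nat (count M k * k) *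
     ((jack_alpha * of_nat k + of_nat n - of_nat k) * (if M = M' then 1 else 0)
      + (\<Sum>l\<in>{1..N}. jack_alpha * of_nat (count (M - {#k#}) l * l) *
           (if add_mset (k + l) (M - {#k#} - {#l#}) = M' then 1 else 0))
      + (\<Sum>a\<in>{1..<k}. if add_mset a (add_mset (k - a) (M - {#k#})) = M' then 1 else 0)))"

lemma mpartitions_parts:
  assumes "M \<in> mpartitions N"
  shows "set_mset M \<subseteq> {1..N}"
proof
  fix x assume x: "x \<in># M"
  then have "x \<noteq> 0"
    using assms by (metis (mono_tags) mem_Collect_eq mpartitions_def)
  moreover have "x \<le> N"
    using x assms sum_mset.remove[OF x] by (simp add: mpartitions_def)
  ultimately show "x \<in> {1..N}" by simp
qed

lemma LB_PP:
  assumes M: "M \<in> mpartitions N"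
  shows "LB n (PP n M) = theta n N (dmat n N M)"
proof -
  have parts: "set_mset M \<subseteq> {1..N}"
    by (rule mpartitions_parts[OF M])
  have "LB n (PP n M) = (\<Sum>i<n. Zop n i (\<Sum>k\<in>{1..N}. cst (of_nat (count M k * k)) * (X i ^ k * PP n (M - {#k#}))))"
    unfolding LB_def
    by (intro sum.cong arg_cong[where f = "Zop n _"])
      (auto simp: Eu_PP sum_mset_eq_sum_count[OF _ parts] cst_hom(5) cst_of_nat mult_ac)
  also have "\<dots> = (\<Sum>k\<in>{1..N}. cst (of_nat (count M k * k)) * (\<Sum>i<n. Zop n i (X i ^ k * PP n (M - {#k#}))))"
    unfolding Zop_sum Zop_cst_mult sum_distrib_left by (rule sum.swap)
  also have "\<dots> = (\<Sum>k\<in>{1..N}. theta n N (\<lambda>M'. of_nat (count M k * k) *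
     ((jack_alpha * of_nat k + of_nat n - of_nat k) * (if M = M' then 1 else 0)
      + (\<Sum>l\<in>{1..N}. jack_alpha * of_nat (count (M - {#k#}) l * l) *
           (if add_mset (k + l) (M - {#k#} - {#l#}) = M' then 1 else 0))
      + (\<Sum>a\<in>{1..<k}. if add_mset a (add_mset (k - a) (M - {#k#})) = M' then 1 else 0))))"
  proof (rule sum.cong)
    fix k assume "k \<in> {1..N}"
    then have "0 < k" by simp
    show "cst (of_nat (count M k * k)) * (\<Sum>i<n. Zop n i (X i ^ k * PP n (M - {#k#})))
      = theta n N (\<lambda>M'. of_nat (count M k * k) *
        ((jack_alpha * of_nat k + of_nat n - of_nat k) * (if M = M' then 1 else 0)
        + (\<Sum>l\<in>{1..N}. jack_alpha * of_nat (count (M - {#k#}) l * l) *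
             (if add_mset (k + l) (M - {#k#} - {#l#}) = M' then 1 else 0))
        + (\<Sum>a\<in>{1..<k}. if add_mset a (add_mset (k - a) (M - {#k#})) = M' then 1 else 0)))"
    proof (cases "k \<in># M")
      case True
      then have M': "add_mset k (M - {#k#}) = M"
        by simp
      have sub: "set_mset (M - {#k#}) \<subseteq> {1..N}"
        using parts by (meson in_diffD subset_iff)
      have sumM: "sum_mset (M - {#k#}) + k = N"
        using M sum_mset.remove[OF True] by (simp add: mpartitions_def)
      have z: "0 \<notin># M"
        using M by (simp add: mpartitions_def)
      have l: "theta n N (\<lambda>M'. jack_alpha * of_nat (count (M - {#k#}) l * l) *
             (if add_mset (k + l) (M - {#k#} - {#l#}) = M' then 1 else 0))
          = cst (jack_alpha * of_nat (count (M - {#k#}) l * l)) * PP n (add_mset (k + l) (M - {#k#} - {#l#}))" for l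
      proof (cases "l \<in># M - {#k#}")
        case True
        then have "sum_mset (M - {#k#}) = l + sum_mset (M - {#k#} - {#l#})"
          by (rule sum_mset.remove)
        then have "add_mset (k + l) (M - {#k#} - {#l#}) \<in> mpartitions N"
          using sumM z \<open>0 < k\<close> by (auto simp: mpartitions_def dest!: in_diffD)
        then show ?thesis
          by (simp add: theta_scale theta_delta)
      next
        case False
        then have "count (M - {#k#}) l = 0"
          by (simp only: not_in_iff)
        then show ?thesis
          by (simp only: mult_zero_left mult_zero_right of_nat_0 theta_zero cst_hom)
      qed
      have a: "theta n N (\<lambda>M'. if add_mset a (add_mset (k - a) (M - {#k#})) = M' then 1 else 0)
          = PP n (add_mset a (add_mset (k - a) (M - {#k#})))" if "a \<in> {1..<k}" for a
        using that sumM z by (intro theta_delta) (auto simp: mpartitions_def dest!: in_diffD)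
      show ?thesis
        unfolding theta_scale[of n N "of_nat (count M k * k)"] theta_add theta_sum l
          theta_scale[of n N "jack_alpha * of_nat k + of_nat n - of_nat k"] theta_delta[OF M]
          sum_Zop_power[OF \<open>0 < k\<close> finite_atLeastAtMost sub] M'
        by (simp only: a cong: sum.cong)
    next
      case False
      then have "count M k = 0"
        by (simp only: not_in_iff)
      then show ?thesis
        by (simp add: cst_hom theta_zero)
    qed
  qed simp
  finally show ?thesis
    unfolding dmat_def theta_sum .
qed

text \<open>The squared norm of a product of power sums in the Jack scalar product
  (\<open>pzee_eq_wgt\<close>).\<close>

definition wgt :: "nat \<Rightarrow> nat multiset \<Rightarrow> ratfun" where
  "wgt N M = (\<Prod>i\<in>{1..N}. of_nat (i ^ count M i * fact (count M i))) * jack_alpha ^ size M"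

lemma wgt_add:
  assumes "k \<in> {1..N}"
  shows "wgt N (add_mset k M) = jack_alpha * of_nat k * of_nat (Suc (count M k)) * wgt N M"
proof -
  let ?g = "\<lambda>M i. of_nat (i ^ count M i * fact (count M i)) :: ratfun"
  have split: "(\<Prod>i\<in>{1..N}. ?g M i) = ?g M k * (\<Prod>i\<in>{1..N} - {k}. ?g M i)" for M
    using assms by (simp add: prod.remove)
  have "(\<Prod>i\<in>{1..N} - {k}. ?g (add_mset k M) i) = (\<Prod>i\<in>{1..N} - {k}. ?g M i)"
    by (rule prod.cong) auto
  then show ?thesis
    unfolding wgt_def split by (simp add: algebra_simps)
qed

lemma wgt_pos: "0 < wgt N M"
  unfolding wgt_def using jack_alpha_pos
  by (intro mult_pos_pos prod_pos zero_less_power) (auto simp: zero_less_mult_iff)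

lemma sum_split_pairs:
  fixes h :: "nat \<Rightarrow> nat \<Rightarrow> 'a::comm_monoid_add"
  assumes "\<And>a b. N < a + b \<Longrightarrow> h a b = 0"
  shows "(\<Sum>k\<in>{1..N}. \<Sum>a\<in>{1..<k}. h a (k - a)) = (\<Sum>a\<in>{1..N}. \<Sum>b\<in>{1..N}. h a b)"
proof -
  have "(\<Sum>k\<in>{1..N}. \<Sum>a\<in>{1..<k}. h a (k - a)) = (\<Sum>(k, a)\<in>(SIGMA k:{1..N}. {1..<k}). h a (k - a))"
    by (subst sum.Sigma) auto
  also have "\<dots> = (\<Sum>(a, b)\<in>{p \<in> {1..N} \<times> {1..N}. fst p + snd p \<le> N}. h a b)"
    by (rule sum.reindex_bij_witness[of _ "\<lambda>(a, b). (a + b, a)" "\<lambda>(k, a). (a, k - a)"]) auto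
  also have "\<dots> = (\<Sum>(a, b)\<in>{1..N} \<times> {1..N}. h a b)"
    using assms by (intro sum.mono_neutral_left) (auto, metis not_le)
  finally show ?thesis
    by (simp add: sum.cartesian_product)
qed

text \<open>With M = M0 + {k, l} and M' = M0 + {k + l}, \<open>wgt_add\<close> expresses both
  weights through that of M0. Both sides become \<alpha>^2 k l (k + l) times the same multiplicities
  and the weight of M0.\<close>

lemma merge_split_adjoint:
  assumes M: "M \<in> mpartitions N" and M': "M' \<in> mpartitions N" and kl: "k \<in> {1..N}" "l \<in> {1..N}"
  shows "wgt N M' * (of_nat (count M k * k) * (jack_alpha * of_nat (count (M - {#k#}) l * l) *
      (if add_mset (k + l) (M - {#k#} - {#l#}) = M' then 1 else 0)))
    = wgt N M * (of_nat (count M' (k + l) * (k + l)) *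
      (if add_mset k (add_mset l (M' - {#k + l#})) = M then 1 else 0))"
proof (cases "k \<in># M \<and> l \<in># M - {#k#} \<and> add_mset (k + l) (M - {#k#} - {#l#}) = M'")
  case True
  define M0 where "M0 = M - {#k#} - {#l#}"
  have M_eq: "M = add_mset k (add_mset l M0)"
    using True unfolding M0_def by (metis insert_DiffM)
  have M'_eq: "M' = add_mset (k + l) M0"
    using True by (simp add: M0_def)
  have "k + l \<in> {1..N}"
    using mpartitions_parts[OF M'] by (simp add: M'_eq)
  then show ?thesis
    using kl by (simp add: M_eq M'_eq wgt_add) (simp add: algebra_simps)
next
  case False
  have "count M k = 0 \<or> count (M - {#k#}) l = 0 \<or> add_mset (k + l) (M - {#k#} - {#l#}) \<noteq> M'"
    using False unfolding not_in_iff[symmetric] by blast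
  then have left: "of_nat (count M k * k) * (jack_alpha * of_nat (count (M - {#k#}) l * l) *
      (if add_mset (k + l) (M - {#k#} - {#l#}) = M' then 1 else 0)) = (0::ratfun)"
    by (elim disjE) simp_all
  have "count M' (k + l) = 0 \<or> add_mset k (add_mset l (M' - {#k + l#})) \<noteq> M"
  proof (rule ccontr)
    assume "\<not> ?thesis"
    then have "k + l \<in># M'" and M_eq: "M = add_mset k (add_mset l (M' - {#k + l#}))"
      by (auto simp: not_in_iff)
    then show False
      using False by simp
  qed
  then have "of_nat (count M' (k + l) * (k + l)) *
      (if add_mset k (add_mset l (M' - {#k + l#})) = M then 1 else 0) = (0::ratfun)"
    by (elim disjE) simp_all
  then show ?thesis
    unfolding left by simp
qed

text \<open>The diagonal part D is symmetric, and the merging part A is adjoint to the splitting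
  part B once B is indexed by the pair of new parts.\<close>

lemma dmat_adjoint:
  assumes M: "M \<in> mpartitions N" and M': "M' \<in> mpartitions N"
  shows "wgt N M' * dmat n N M M' = wgt N M * dmat n N M' M"
proof -
  define D where "D M M' = (\<Sum>k\<in>{1..N}. of_nat (count M k * k) *
     ((jack_alpha * of_nat k + of_nat n - of_nat k) * (if M = M' then 1 else 0)))" for M M'
  define A where "A M M' = (\<Sum>k\<in>{1..N}. \<Sum>l\<in>{1..N}. of_nat (count M k * k) *
     (jack_alpha * of_nat (count (M - {#k#}) l * l) *
      (if add_mset (k + l) (M - {#k#} - {#l#}) = M' then 1 else 0)))" for M M'
  define B where "B M M' = (\<Sum>a\<in>{1..N}. \<Sum>b\<in>{1..N}. of_nat (count M (a + b) * (a + b)) *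
      (if add_mset a (add_mset b (M - {#a + b#})) = M' then 1 else 0) :: ratfun)" for M M'
  have dmat: "dmat n N M M' = D M M' + A M M' + B M M'" if "M \<in> mpartitions N" for M M'
  proof -
    have "count M k = 0" if "N < k" for k
      using mpartitions_parts[OF \<open>M \<in> mpartitions N\<close>] that by (auto simp: subset_iff count_eq_zero_iff)
    then have "B M M' = (\<Sum>k\<in>{1..N}. \<Sum>a\<in>{1..<k}. of_nat (count M (a + (k - a)) * (a + (k - a))) *
        (if add_mset a (add_mset (k - a) (M - {#a + (k - a)#})) = M' then 1 else 0))"
      unfolding B_def by (intro sum_split_pairs[symmetric]) simp
    also have "\<dots> = (\<Sum>k\<in>{1..N}. of_nat (count M k * k) *
        (\<Sum>a\<in>{1..<k}. if add_mset a (add_mset (k - a) (M - {#k#})) = M' then 1 else 0))"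
      unfolding sum_distrib_left by (intro sum.cong) auto
    finally show ?thesis
      by (simp add: dmat_def D_def A_def distrib_left sum.distrib sum_distrib_left)
  qed
  have AB: "wgt N Q' * A Q Q' = wgt N Q * B Q' Q" if "Q \<in> mpartitions N" "Q' \<in> mpartitions N" for Q Q'
    unfolding A_def B_def sum_distrib_left using that by (intro sum.cong merge_split_adjoint) auto
  have "wgt N M' * D M M' = wgt N M * D M' M"
    by (auto simp: D_def)
  then show ?thesis
    using AB[OF M M'] AB[OF M' M] by (simp add: dmat M M' distrib_left)
qed

lemma LB_theta: "LB n (theta n N c) = theta n N (\<lambda>M'. \<Sum>M\<in>mpartitions N. c M * dmat n N M M')"
  unfolding theta_sum theta_scale by (subst theta_def) (simp add: LB_sum LB_cst_mult LB_PP)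

definition ip :: "nat \<Rightarrow> (nat multiset \<Rightarrow> ratfun) \<Rightarrow> (nat multiset \<Rightarrow> ratfun) \<Rightarrow> ratfun" where
  "ip N c d = (\<Sum>M\<in>mpartitions N. c M * d M * wgt N M)"

lemma ip_commute: "ip N c d = ip N d c"
  by (simp add: ip_def mult.commute)

text \<open>As \<alpha> is positive in the ordered field, so are the weights, and a vanishing sum of
  nonnegative terms has vanishing terms.\<close>

lemma ip_definite:
  assumes "ip N c c = 0" "M \<in> mpartitions N"
  shows "c M = 0"
proof -
  have "c M * c M * wgt N M = 0"
    using assms wgt_pos[of N]
    by (intro sum_nonneg_eq_0_iff[THEN iffD1, rule_format, of "mpartitions N" "\<lambda>M. c M * c M * wgt N M"])
      (auto simp: ip_def less_imp_le)
  then show ?thesis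
    using wgt_pos[of N M] by simp
qed

lemma ip_dmat_adjoint:
  "ip N (\<lambda>M'. \<Sum>M\<in>mpartitions N. c M * dmat n N M M') d
    = ip N c (\<lambda>M'. \<Sum>M\<in>mpartitions N. d M * dmat n N M M')"
proof -
  have "ip N (\<lambda>M'. \<Sum>M\<in>mpartitions N. c M * dmat n N M M') d
      = (\<Sum>M'\<in>mpartitions N. \<Sum>M\<in>mpartitions N. c M * d M' * (wgt N M' * dmat n N M M'))"
    by (simp add: ip_def sum_distrib_left sum_distrib_right mult_ac)
  also have "\<dots> = (\<Sum>M'\<in>mpartitions N. \<Sum>M\<in>mpartitions N. c M * d M' * (wgt N M * dmat n N M' M))"
    by (intro sum.cong) (auto simp: dmat_adjoint)
  also have "\<dots> = ip N c (\<lambda>M'. \<Sum>M\<in>mpartitions N. d M * dmat n N M M')"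
    by (subst sum.swap) (simp add: ip_def sum_distrib_left sum_distrib_right mult_ac)
  finally show ?thesis .
qed

lemma norm2_add_single: "norm2 (b + single i k) = norm2 b + 2 * lookup b i * k + k\<^sup>2"
proof -
  let ?A = "insert i (keys b)"
  have sub: "keys (b + single i k) \<subseteq> ?A" "keys b \<subseteq> ?A"
    using Poly_Mapping.keys_add[of b "single i k"] by (auto split: if_splits)
  have fin: "finite ?A" by simp
  have split: "sum g ?A = g i + sum g (?A - {i})" for g :: "nat \<Rightarrow> nat"
    by (rule sum.remove) auto
  have "(\<Sum>x\<in>?A - {i}. (lookup (b + single i k) x)\<^sup>2) = (\<Sum>x\<in>?A - {i}. (lookup b x)\<^sup>2)"
    by (rule sum.cong) (auto simp: lookup_add lookup_single)
  then show ?thesis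
    unfolding norm2_superset[OF fin sub(1)] norm2_superset[OF fin sub(2)] split
    by (simp add: lookup_add power2_eq_square algebra_simps)
qed

lemma ms_add_single:
  assumes "lookup b i = 0" "0 < k"
  shows "ms (b + single i k) = add_mset k (ms b)"
proof -
  have i: "i \<notin> keys b"
    using assms by (simp add: in_keys_iff)
  have keys: "keys (b + single i k) = insert i (keys b)"
    using assms by (auto simp: in_keys_iff lookup_add lookup_single when_def split: if_splits)
  have "image_mset (lookup (b + single i k)) (mset_set (keys b)) = ms b"
    unfolding ms_def using i by (intro image_mset_cong) (auto simp: lookup_add lookup_single when_def)
  then show ?thesis
    unfolding ms_def keys using i assms by (simp add: lookup_add ms_def)
qed

lemma coeff_X_power_mult:
  "mps_coeff (X i ^ k * f) b = (if k \<le> lookup b i then mps_coeff f (b - single i k) else 0)"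
proof (induction k arbitrary: b)
  case (Suc k)
  have "b - single i 1 - single i k = b - single i (Suc k)"
    by (rule poly_mapping_eqI) (auto simp: lookup_minus lookup_single when_def)
  then show ?case
    by (auto simp: mult.assoc coeff_X_mult Suc lookup_minus)
qed simp

lemma coeff_pw_mult:
  "mps_coeff (pw n k * f) b = (\<Sum>i<n. if k \<le> lookup b i then mps_coeff f (b - single i k) else 0)"
  by (simp add: pw_def sum_distrib_right coeff_sum coeff_X_power_mult)

text \<open>A factor p_k either puts k on a fresh variable, adding k to the shape, or adds it to an
  occupied one, which pushes \<open>norm2\<close> above the sum of squares by the cross term.
  Nonnegativity of all coefficients is carried along to exclude cancellation in the leading
  one.\<close>

lemma
  assumes "0 \<notin># M"
  shows coeff_PP_support: "mps_coeff (PP n M) b \<noteq> 0 \<Longrightarrow>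
      keys b \<subseteq> {..<n} \<and> psize b = sum_mset M \<and> ((\<Sum>x\<in>#M. x\<^sup>2) < norm2 b \<or> ms b = M)"
    and coeff_PP_pos: "ms b = M \<Longrightarrow> keys b \<subseteq> {..<n} \<Longrightarrow> 0 < mps_coeff (PP n M) b"
proof -
  have "0 \<le> mps_coeff (PP n M) b \<and>
    (mps_coeff (PP n M) b \<noteq> 0 \<longrightarrow> keys b \<subseteq> {..<n} \<and> psize b = sum_mset M \<and>
      ((\<Sum>x\<in>#M. x\<^sup>2) < norm2 b \<or> ms b = M)) \<and>
    (ms b = M \<longrightarrow> keys b \<subseteq> {..<n} \<longrightarrow> 0 < mps_coeff (PP n M) b)"
    using assms
  proof (induction M arbitrary: b)
    case empty
    then show ?case
      by (auto simp: coeff_one ms_def) (metis mset_set_empty_iff finite_keys keys_eq_empty)+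
  next
    case (add k M)
    have k: "0 < k" and IH: "\<And>b. 0 \<le> mps_coeff (PP n M) b \<and>
      (mps_coeff (PP n M) b \<noteq> 0 \<longrightarrow> keys b \<subseteq> {..<n} \<and> psize b = sum_mset M \<and>
        ((\<Sum>x\<in>#M. x\<^sup>2) < norm2 b \<or> ms b = M)) \<and>
      (ms b = M \<longrightarrow> keys b \<subseteq> {..<n} \<longrightarrow> 0 < mps_coeff (PP n M) b)"
      using add by auto
    define t where "t i = (if k \<le> lookup b i then mps_coeff (PP n M) (b - single i k) else 0)" for i
    have coeff: "mps_coeff (PP n (add_mset k M)) b = (\<Sum>i<n. t i)"
      by (simp add: coeff_pw_mult t_def)
    have nonneg: "0 \<le> t i" for i
      using IH by (simp add: t_def)
    have "keys b \<subseteq> {..<n} \<and> psize b = sum_mset (add_mset k M) \<and>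
        ((\<Sum>x\<in>#add_mset k M. x\<^sup>2) < norm2 b \<or> ms b = add_mset k M)"
      if nz: "mps_coeff (PP n (add_mset k M)) b \<noteq> 0"
    proof -
      obtain i where i: "i < n" "t i \<noteq> 0"
        using nz unfolding coeff by (metis lessThan_iff sum.neutral)
      define c where "c = b - single i k"
      have le: "k \<le> lookup b i" and nz: "mps_coeff (PP n M) c \<noteq> 0"
        using i by (auto simp: t_def c_def split: if_splits)
      have b: "b = c + single i k"
        using minus_single_add[OF le] by (simp add: c_def)
      have c: "keys c \<subseteq> {..<n}" "psize c = sum_mset M" "(\<Sum>x\<in>#M. x\<^sup>2) < norm2 c \<or> ms c = M"
        using IH[of c] nz by auto
      have "keys b \<subseteq> {..<n}"
        unfolding b using Poly_Mapping.keys_add[of c "single i k"] c(1) i(1) by (auto split: if_splits)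
      moreover have "psize b = sum_mset (add_mset k M)"
        by (simp add: b psize_add c)
      moreover have "(\<Sum>x\<in>#add_mset k M. x\<^sup>2) < norm2 b \<or> ms b = add_mset k M"
      proof (cases "ms c = M \<and> lookup c i = 0")
        case True
        then show ?thesis
          using k by (simp add: b ms_add_single)
      next
        case False
        have "(\<Sum>x\<in>#M. x\<^sup>2) \<le> norm2 c"
          using c(3) by (auto simp: norm2_eq_sum_ms)
        then have "(\<Sum>x\<in>#M. x\<^sup>2) < norm2 c + 2 * lookup c i * k"
        proof (cases "lookup c i = 0")
          case True
          then show ?thesis
            using False c(3) by simp
        next
          case False
          then have "0 < 2 * lookup c i * k"
            using k by simp
          then show ?thesis
            using \<open>(\<Sum>x\<in>#M. x\<^sup>2) \<le> norm2 c\<close> by linarith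
        qed
        then show ?thesis
          by (simp add: b norm2_add_single)
      qed
      ultimately show ?thesis by blast
    qed
    moreover have "0 < mps_coeff (PP n (add_mset k M)) b"
      if b: "ms b = add_mset k M" "keys b \<subseteq> {..<n}"
    proof -
      have "k \<in># ms b"
        by (simp add: b)
      then obtain i where i: "i \<in> keys b" "lookup b i = k"
        by (auto simp: ms_def)
      define c where "c = b - single i k"
      have b_eq: "b = c + single i k"
        using minus_single_add[of k b i] i by (simp add: c_def)
      have ci: "lookup c i = 0"
        using i by (simp add: c_def lookup_minus)
      then have "ms c = M"
        using b(1) k by (simp add: b_eq ms_add_single)
      moreover have "keys c \<subseteq> {..<n}"
        by (rule order_trans[OF _ b(2)]) (auto simp: c_def in_keys_iff lookup_minus)
      ultimately have "0 < t i"
        using IH[of c] i by (simp add: t_def c_def)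
      then show ?thesis
        unfolding coeff using i b(2) nonneg by (intro sum_pos2[of _ i]) auto
    qed
    moreover have "0 \<le> mps_coeff (PP n (add_mset k M)) b"
      unfolding coeff using nonneg by (intro sum_nonneg) auto
    ultimately show ?case by blast
  qed
  then show "mps_coeff (PP n M) b \<noteq> 0 \<Longrightarrow>
      keys b \<subseteq> {..<n} \<and> psize b = sum_mset M \<and> ((\<Sum>x\<in>#M. x\<^sup>2) < norm2 b \<or> ms b = M)"
    and "ms b = M \<Longrightarrow> keys b \<subseteq> {..<n} \<Longrightarrow> 0 < mps_coeff (PP n M) b"
    by blast+
qed

section \<open>The power sum basis and the scalar product\<close>

text \<open>Sets x_n, x_{n+1}, ... to zero; a ring homomorphism from symmetric functions to n
  variables.\<close>

definition trunc :: "nat \<Rightarrow> 'a::comm_ring_1 mps \<Rightarrow> 'a mps" where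
  "trunc n f = Abs_mps (\<lambda>a. if keys a \<subseteq> {..<n} then mps_coeff f a else 0)"

lemma coeff_trunc: "mps_coeff (trunc n f) a = (if keys a \<subseteq> {..<n} then mps_coeff f a else 0)"
  by (simp add: trunc_def)

lemma keys_add_nat: "keys (a + b) = keys a \<union> keys (b :: mon)"
  by (auto simp: in_keys_iff lookup_add)

lemma trunc_mult: "trunc n (f * g) = trunc n f * trunc n g"
proof (rule mps_eqI)
  fix a
  show "mps_coeff (trunc n (f * g)) a = mps_coeff (trunc n f * trunc n g) a"
  proof (cases "keys a \<subseteq> {..<n}")
    case True
    then show ?thesis
      by (auto simp: coeff_trunc coeff_mult monom_splits_def keys_add_nat intro!: sum.cong)
  next
    case False
    then have "(\<Sum>(b, c)\<in>monom_splits a. mps_coeff (trunc n f) b * mps_coeff (trunc n g) c) = 0"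
      by (intro sum.neutral) (auto simp: coeff_trunc monom_splits_def keys_add_nat)
    then show ?thesis
      using False by (simp add: coeff_trunc coeff_mult)
  qed
qed

lemma trunc_one: "trunc n 1 = 1"
  by (rule mps_eqI) (auto simp: coeff_trunc coeff_one)

lemma trunc_prod: "trunc n (prod f A) = (\<Prod>x\<in>A. trunc n (f x))"
  by (induction A rule: infinite_finite_induct) (auto simp: trunc_one trunc_mult)

lemma trunc_sum: "trunc n (sum f A) = (\<Sum>x\<in>A. trunc n (f x))"
  by (rule mps_eqI) (simp add: coeff_trunc coeff_sum)

lemma trunc_scale: "trunc n (mps_scale c f) = cst c * trunc n f"
  by (rule mps_eqI) (simp add: coeff_trunc)

lemma coeff_X_power: "mps_coeff (X i ^ k) a = (if a = single i k then 1 else 0)"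
proof -
  have "k \<le> lookup a i \<and> a - single i k = 0 \<longleftrightarrow> a = single i k"
    using minus_single_add[of k a i] by auto
  then show ?thesis
    using coeff_X_power_mult[of i k 1 a] by (auto simp: coeff_one)
qed

lemma trunc_power_sum:
  assumes "0 < k"
  shows "trunc n (power_sum k) = pw n k"
proof (rule mps_eqI)
  fix a
  show "mps_coeff (trunc n (power_sum k)) a = mps_coeff (pw n k) a"
  proof (cases "\<exists>i<n. a = single i k")
    case True
    then obtain i where i: "i < n" "a = single i k" by blast
    have "single i k = single j k \<longleftrightarrow> j = i" for j
      using assms by (metis lookup_single_eq lookup_single_not_eq less_irrefl)
    then have "mps_coeff (pw n k) a = 1"
      using i by (simp add: pw_def coeff_sum coeff_X_power)
    moreover have "keys a \<subseteq> {..<n}"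
      using i by simp
    ultimately show ?thesis
      using i by (auto simp: coeff_trunc power_sum_def)
  next
    case False
    then have "mps_coeff (pw n k) a = 0"
      by (simp add: pw_def coeff_sum coeff_X_power)
    moreover have "mps_coeff (trunc n (power_sum k)) a = (0 :: ratfun)"
      using False assms by (auto simp: coeff_trunc power_sum_def)
    ultimately show ?thesis by simp
  qed
qed

lemma trunc_power_sum_part: "trunc n (power_sum_part l) = PP n (ms l)"
proof -
  have "trunc n (power_sum_part l) = (\<Prod>k\<in>keys l. pw n (lookup l k))"
    unfolding power_sum_part_def trunc_prod
    by (rule prod.cong) (auto simp: in_keys_iff trunc_power_sum)
  then show ?thesis
    by (simp add: PP_def ms_def prod_unfold_prod_mset image_mset.compositionality comp_def)
qed

lemma coeff_power_sum_part:
  "keys a \<subseteq> {..<n} \<Longrightarrow> mps_coeff (power_sum_part l) a = mps_coeff (PP n (ms l)) a"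
  by (simp flip: trunc_power_sum_part add: coeff_trunc)

lemma pm_power_sum:
  assumes "bij \<pi>"
  shows "pm \<pi> (power_sum k) = power_sum k"
proof (rule mps_eqI)
  fix a
  have "(\<exists>j. map_key \<pi> a = single j k) \<longleftrightarrow> (\<exists>j. a = single j k)"
    using map_key_single[OF bij_is_inj[OF assms]] assms
    by (metis map_key_inv(1) map_key_single_bij bij_imp_bij_inv)
  then show "mps_coeff (pm \<pi> (power_sum k)) a = mps_coeff (power_sum k) a"
    by (simp add: coeff_pm power_sum_def)
qed

lemma pm_power_sum_part: "bij \<pi> \<Longrightarrow> pm \<pi> (power_sum_part l) = power_sum_part l"
  by (simp add: power_sum_part_def pm_prod pm_power_sum)

lemma keys_bounded:
  obtains n where "keys (a :: mon) \<subseteq> {..<n}"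
  using finite_nat_bounded[of "keys a"] by auto

lemma power_sum_part_support:
  assumes "mps_coeff (power_sum_part l) a \<noteq> (0 :: ratfun)"
  shows "psize a = psize l \<and> (norm2 l < norm2 a \<or> ms a = ms l)"
proof -
  obtain n where "keys a \<subseteq> {..<n}"
    by (rule keys_bounded)
  then show ?thesis
    using assms coeff_PP_support[of "ms l" n a]
    by (simp add: coeff_power_sum_part psize_eq_sum_ms norm2_eq_sum_ms)
qed

lemma power_sum_part_diagonal: "mps_coeff (power_sum_part l) l \<noteq> (0 :: ratfun)"
proof -
  obtain n where "keys l \<subseteq> {..<n}"
    by (rule keys_bounded)
  then show ?thesis
    using coeff_PP_pos[of "ms l" l n] by (simp add: coeff_power_sum_part)
qed

lemma power_sum_part_triangular:
  assumes "l \<in> partitions" "k \<in> partitions" "mps_coeff (power_sum_part l) k \<noteq> (0 :: ratfun)"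
  shows "l = k \<or> norm2 l < norm2 k"
  using power_sum_part_support[OF assms(3)] partition_ms_inj[OF assms(1,2)] by auto

abbreviation psp :: "mon \<Rightarrow> ratfun mps" where
  "psp \<equiv> power_sum_part"

lemma inj_on_power_sum_part: "inj_on psp partitions"
proof (rule inj_onI)
  fix l l' assume l: "l \<in> partitions" "l' \<in> partitions" and eq: "psp l = psp l'"
  have "l' = l \<or> norm2 l' < norm2 l"
    using power_sum_part_triangular[OF l(2,1)] power_sum_part_diagonal[of l] eq by simp
  moreover have "l = l' \<or> norm2 l < norm2 l'"
    using power_sum_part_triangular[OF l] power_sum_part_diagonal[of l'] eq by simp
  ultimately show "l = l'"
    by auto
qed

lemma independent_power_sums: "mps.independent (psp ` partitions)"
  unfolding mps.independent_explicit_module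
proof (intro allI impI)
  fix t and u :: "ratfun mps \<Rightarrow> ratfun" and w
  assume t: "finite t" "t \<subseteq> psp ` partitions" and eq: "(\<Sum>x\<in>t. mps_scale (u x) x) = 0" and w: "w \<in> t"
  obtain S where S: "S \<subseteq> partitions" "t = psp ` S"
    using t(2) by (meson subset_imageE)
  have inj: "inj_on psp S"
    using inj_on_power_sum_part S(1) inj_on_subset by blast
  have fin: "finite S"
    using t(1) inj S(2) finite_image_iff by blast
  have "(\<Sum>l\<in>S. mps_scale (u (psp l)) (psp l)) = 0"
    using eq by (simp add: S(2) sum.reindex[OF inj])
  then have zero: "(\<Sum>l\<in>S. u (psp l) * mps_coeff (psp l) k) = 0" for k
    by (simp add: mps_eq_iff coeff_sum)
  obtain l where l: "l \<in> S" "w = psp l"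
    using w S by blast
  have "u (psp l) = 0"
    by (rule triangular_system(2)[where I = S and R = "\<lambda>l. mps_coeff (psp l)" and \<nu> = norm2
          and c = "\<lambda>l. u (psp l)", OF fin])
      (use S(1) l zero power_sum_part_diagonal power_sum_part_triangular in blast)+
  then show "u w = 0"
    by (simp add: l)
qed

text \<open>The counterpart of \<open>theta\<close> in infinitely many variables
  (\<open>trunc_thetaI\<close>).\<close>

definition thetaI :: "nat \<Rightarrow> (nat multiset \<Rightarrow> ratfun) \<Rightarrow> ratfun mps" where
  "thetaI N c = (\<Sum>M\<in>mpartitions N. mps_scale (c M) (psp (part M)))"

lemma mpartitions_zero: "M \<in> mpartitions N \<Longrightarrow> 0 \<notin># M"
  by (simp add: mpartitions_def)

lemma part_mpartitions:
  assumes "M \<in> mpartitions N"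
  shows "part M \<in> partitions" "ms (part M) = M" "psize (part M) = N"
  using part_in_partitions[OF mpartitions_zero[OF assms]] ms_part[OF mpartitions_zero[OF assms]] assms
  by (simp_all add: psize_eq_sum_ms mpartitions_def)

lemma keys_part:
  assumes "M \<in> mpartitions N" "N \<le> n"
  shows "keys (part M) \<subseteq> {..<n}"
  using keys_partition[OF part_mpartitions(1)[OF assms(1)]] plength_le_psize[of "part M"]
    part_mpartitions(3)[OF assms(1)] assms(2) by auto

lemma trunc_thetaI: "trunc n (thetaI N c) = theta n N c"
  unfolding thetaI_def theta_def trunc_sum trunc_scale trunc_power_sum_part
  by (rule sum.cong) (auto simp: part_mpartitions)

lemma power_sum_coeff_thetaI:
  assumes "l \<in> partitions"
  shows "power_sum_coeff (thetaI N c) l = (if psize l = N then c (ms l) else 0)"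
proof -
  let ?b = "psp ` partitions"
  have base: "psp (part M) \<in> ?b" if "M \<in> mpartitions N" for M
    using part_mpartitions(1)[OF that] by blast
  have "power_sum_coeff (thetaI N c) l
      = (\<Sum>M\<in>mpartitions N. mps.representation ?b (mps_scale (c M) (psp (part M))) (psp l))"
    unfolding power_sum_coeff_def thetaI_def
    by (subst mps.representation_sum[OF independent_power_sums])
      (simp_all add: mps.span_scale mps.span_base base)
  also have "\<dots> = (\<Sum>M\<in>mpartitions N. if M = ms l then c M else 0)"
  proof (rule sum.cong)
    fix M assume M: "M \<in> mpartitions N"
    have "psp l = psp (part M) \<longleftrightarrow> M = ms l"
      using inj_onD[OF inj_on_power_sum_part, of l "part M"] part_mpartitions[OF M] assms by auto
    then show "mps.representation ?b (mps_scale (c M) (psp (part M))) (psp l) = (if M = ms l then c M else 0)"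
      by (simp add: mps.representation_scale mps.representation_basis independent_power_sums base[OF M]
          mps.span_base)
  qed simp
  also have "\<dots> = (if psize l = N then c (ms l) else 0)"
    by simp
  finally show ?thesis .
qed

lemma thetaI_inj:
  assumes "thetaI N c = thetaI N d" "M \<in> mpartitions N"
  shows "c M = d M"
  using power_sum_coeff_thetaI[of "part M" N c] power_sum_coeff_thetaI[of "part M" N d]
    part_mpartitions[OF assms(2)] assms(1) by simp

lemma pzee_eq_wgt:
  assumes "psize l = N"
  shows "of_nat (pzee l) * jack_alpha ^ plength l = wgt N (ms l)"
proof -
  have "(\<Prod>i=1..N. i ^ pmult i l * fact (pmult i l))
      = (\<Prod>i=1..N. i ^ count (ms l) i * fact (count (ms l) i) :: nat)"
    by (rule prod.cong) (auto simp: pmult_def count_ms)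
  then show ?thesis
    by (simp only: pzee_def assms wgt_def plength_eq_size of_nat_prod)
qed

lemma jack_inner_thetaI: "jack_inner (thetaI N c) (thetaI N d) = ip N c d"
proof -
  let ?P = "{l \<in> partitions. psize l = N}"
  have "jack_inner (thetaI N c) (thetaI N d) = (\<Sum>l\<in>?P. c (ms l) * d (ms l) * wgt N (ms l))"
    unfolding jack_inner_def
    by (rule sum.mono_neutral_cong_left)
      (auto simp: power_sum_coeff_thetaI pzee_eq_wgt mult.assoc split: if_splits)
  also have "\<dots> = ip N c d"
    unfolding ip_def by (rule sum.reindex_bij_betw[OF bij_betw_ms])
  finally show ?thesis .
qed

text \<open>The combination of the monomial symmetric functions of degree N with coefficients
  \<open>h\<close>.\<close>

definition hatf :: "nat \<Rightarrow> (nat multiset \<Rightarrow> ratfun) \<Rightarrow> ratfun mps" where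
  "hatf N h = Abs_mps (\<lambda>a. if psize a = N then h (ms a) else 0)"

lemma coeff_hatf: "mps_coeff (hatf N h) a = (if psize a = N then h (ms a) else 0)"
  by (simp add: hatf_def)

lemma coeff_hatf_part: "K \<in> mpartitions N \<Longrightarrow> mps_coeff (hatf N h) (part K) = h K"
  by (simp add: coeff_hatf part_mpartitions)

lemma hatf_thetaI:
  assumes "\<And>K. K \<in> mpartitions N \<Longrightarrow> mps_coeff (thetaI N c) (part K) = h K"
  shows "thetaI N c = hatf N h"
proof (rule mps_eqI)
  fix a
  show "mps_coeff (thetaI N c) a = mps_coeff (hatf N h) a"
  proof (cases "psize a = N")
    case True
    then have K: "ms a \<in> mpartitions N" by simp
    have "ms (part (ms a)) = ms a"
      using part_mpartitions[OF K] by simp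
    then obtain \<pi> where \<pi>: "bij \<pi>" "part (ms a) = map_key \<pi> a"
      using ms_eq_iff by blast
    have "pm \<pi> (thetaI N c) = thetaI N c"
      using \<pi>(1) by (simp add: thetaI_def pm_sum pm_scale pm_power_sum_part)
    then have "mps_coeff (thetaI N c) a = mps_coeff (thetaI N c) (part (ms a))"
      by (metis \<pi>(2) coeff_pm)
    then show ?thesis
      using assms[OF K] True by (simp add: coeff_hatf)
  next
    case False
    have "mps_coeff (psp (part M)) a = 0" if "M \<in> mpartitions N" for M
      using power_sum_part_support[of "part M" a] part_mpartitions(3)[OF that] False by auto
    then show ?thesis
      using False by (simp add: thetaI_def coeff_sum coeff_hatf)
  qed
qed

text \<open>By symmetry only coefficients at sorted exponents have to be matched, and there products
  of power sums form a triangular matrix with nonzero diagonal.\<close>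

lemma ex_thetaI: "\<exists>c. thetaI N c = hatf N h"
proof -
  have "\<exists>c. \<forall>K\<in>mpartitions N. (\<Sum>M\<in>mpartitions N. c M * mps_coeff (psp (part M)) (part K)) = h K"
  proof (rule triangular_system(1)[where \<nu> = "\<lambda>M. norm2 (part M)"])
    show "M = K \<or> norm2 (part M) < norm2 (part K)"
      if "M \<in> mpartitions N" "K \<in> mpartitions N" "mps_coeff (psp (part M)) (part K) \<noteq> 0" for M K
      using power_sum_part_triangular[OF part_mpartitions(1)[OF that(1)] part_mpartitions(1)[OF that(2)] that(3)]
        part_mpartitions(2)[OF that(1)] part_mpartitions(2)[OF that(2)] by metis
  qed (use power_sum_part_diagonal in auto)
  then obtain c where "\<forall>K\<in>mpartitions N. (\<Sum>M\<in>mpartitions N. c M * mps_coeff (psp (part M)) (part K)) = h K"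
    by blast
  then have "thetaI N c = hatf N h"
    by (intro hatf_thetaI) (simp add: thetaI_def coeff_sum)
  then show ?thesis by blast
qed

text \<open>Power sum coordinates of a monomial symmetric function. Choosing them on this basis only
  makes the extension \<open>coords\<close> linear by construction.\<close>

definition coord :: "nat \<Rightarrow> nat multiset \<Rightarrow> nat multiset \<Rightarrow> ratfun" where
  "coord N K = (SOME c. thetaI N c = hatf N (\<lambda>M. if M = K then 1 else 0))"

definition coords :: "nat \<Rightarrow> (nat multiset \<Rightarrow> ratfun) \<Rightarrow> nat multiset \<Rightarrow> ratfun" where
  "coords N h M = (\<Sum>K\<in>mpartitions N. h K * coord N K M)"

lemma thetaI_coord: "thetaI N (coord N K) = hatf N (\<lambda>M. if M = K then 1 else 0)"
  unfolding coord_def using ex_thetaI by (rule someI_ex)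

lemma thetaI_coords: "thetaI N (coords N h) = hatf N h"
proof (rule hatf_thetaI)
  fix K assume K: "K \<in> mpartitions N"
  have "mps_coeff (thetaI N (coords N h)) (part K)
      = (\<Sum>K'\<in>mpartitions N. h K' * mps_coeff (thetaI N (coord N K')) (part K))"
    unfolding thetaI_def coords_def coeff_sum coeff_scale sum_distrib_left sum_distrib_right
    by (subst sum.swap) (simp add: mult_ac)
  also have "\<dots> = h K"
    using K by (simp add: thetaI_coord coeff_hatf_part if_distrib[of "\<lambda>x. _ * x"] cong: if_cong)
  finally show "mps_coeff (thetaI N (coords N h)) (part K) = h K" .
qed

text \<open>A partition of N has at most N parts, so for N \<le> n its sorted monomial survives
  truncation and determines the coefficients in infinitely many variables.\<close>

lemma theta_inj:
  assumes "theta n N c = theta n N d" "N \<le> n" "M \<in> mpartitions N"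
  shows "c M = d M"
proof -
  have "mps_coeff (thetaI N c) (part K) = mps_coeff (thetaI N d) (part K)" if "K \<in> mpartitions N" for K
    using assms(1) keys_part[OF that assms(2)] by (metis coeff_trunc trunc_thetaI)
  then have "thetaI N c = hatf N (\<lambda>K. mps_coeff (thetaI N d) (part K))"
    by (rule hatf_thetaI)
  also have "\<dots> = thetaI N d"
    by (rule hatf_thetaI[symmetric]) simp
  finally have "thetaI N c = thetaI N d" .
  then show ?thesis
    using assms(3) by (rule thetaI_inj)
qed

definition lb_coords :: "nat \<Rightarrow> nat \<Rightarrow> (nat multiset \<Rightarrow> ratfun) \<Rightarrow> nat multiset \<Rightarrow> ratfun" where
  "lb_coords n N c M' = (\<Sum>M\<in>mpartitions N. c M * dmat n N M M')"

lemma LB_trunc_hatf: "LB n (trunc n (hatf N h)) = theta n N (lb_coords n N (coords N h))"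
  by (subst thetaI_coords[symmetric]) (simp add: trunc_thetaI LB_theta lb_coords_def[abs_def])

lemma symmetric_vars_trunc_hatf: "symmetric_vars n (trunc n (hatf N h))"
  unfolding symmetric_vars_def
proof (intro allI impI mps_eqI)
  fix \<pi> a assume "\<pi> permutes {..<n}"
  then show "mps_coeff (pm \<pi> (trunc n (hatf N h))) a = mps_coeff (trunc n (hatf N h)) a"
    by (simp add: coeff_pm coeff_trunc coeff_hatf keys_map_key_permutes psize_map_key ms_map_key permutes_bij)
qed

lemma symmetric_vars_eq_hatf:
  assumes sym: "symmetric_vars n f" and "N \<le> n"
    and supp: "\<And>a. mps_coeff f a \<noteq> 0 \<Longrightarrow> keys a \<subseteq> {..<n} \<and> psize a = N"
  shows "f = trunc n (hatf N (\<lambda>K. mps_coeff f (part K)))"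
proof (rule mps_eqI)
  fix a
  show "mps_coeff f a = mps_coeff (trunc n (hatf N (\<lambda>K. mps_coeff f (part K)))) a"
  proof (cases "keys a \<subseteq> {..<n} \<and> psize a = N")
    case True
    then have K: "ms a \<in> mpartitions N" by simp
    have "ms (part (ms a)) = ms a"
      using part_mpartitions[OF K] by simp
    then obtain \<pi> where \<pi>: "\<pi> permutes {..<n}" "part (ms a) = map_key \<pi> a"
      using True keys_part[OF K assms(2)] by (elim ms_eq_imp_permutes) auto
    then have "mps_coeff f a = mps_coeff f (part (ms a))"
      using sym by (metis coeff_pm symmetric_vars_def)
    then show ?thesis
      using True by (simp add: coeff_trunc coeff_hatf)
  next
    case False
    then show ?thesis
      using supp[of a] by (auto simp: coeff_trunc coeff_hatf)
  qed
qed

lemma dominated_pones: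
  assumes "l \<in> partitions"
  shows "dominated (pones (psize l)) l"
proof -
  have "(\<Sum>k<i. lookup (pones (psize l)) k) \<le> (\<Sum>k<i. lookup l k)" for i
  proof (cases "i \<le> plength l")
    case True
    have "(\<Sum>k<i. lookup (pones (psize l)) k) \<le> (\<Sum>k<i. 1)"
      by (rule sum_mono) (simp add: pones_eq_ind lookup_ind)
    also have "\<dots> \<le> (\<Sum>k<i. lookup l k)"
    proof (rule sum_mono)
      fix k assume "k \<in> {..<i}"
      then have "k \<in> keys l"
        using True keys_partition[OF assms] by auto
      then show "1 \<le> lookup l k"
        by (simp add: in_keys_iff)
    qed
    finally show ?thesis .
  next
    case False
    then have "(\<Sum>k<i. lookup l k) = psize l"
      using keys_partition[OF assms] by (intro psize_superset[symmetric]) auto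
    moreover have "(\<Sum>k<i. lookup (pones (psize l)) k) = card ({..<i} \<inter> {..<psize l})"
      by (simp add: pones_eq_ind lookup_ind sum.If_cases Int_def)
    moreover have "card ({..<i} \<inter> {..<psize l}) \<le> psize l"
      by (metis card_lessThan card_mono finite_lessThan inf_le2)
    ultimately show ?thesis by simp
  qed
  then show ?thesis
    by (simp add: dominated_def pones_eq_ind psize_ind)
qed

lemma coeff_monomial_sym: "mps_coeff (monomial_sym m) a = (if ms a = ms m then 1 else 0)"
  by (simp add: monomial_sym_def ms_eq_iff)

section \<open>Integrality\<close>

lemma jack_family_eq_hatf:
  assumes J: "jack_family J v" and l: "l \<in> partitions" "psize l = N"
  shows "J l = hatf N (\<lambda>K. if dominated (part K) l then v l (part K) else 0)"
proof (rule mps_eqI)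
  fix a
  let ?S = "{m \<in> partitions. dominated m l}"
  have size: "psize m = N" if "m \<in> ?S" for m
    using that l(2) by (simp add: dominated_def)
  then have fin: "finite ?S"
    by (intro finite_subset[OF _ finite_partitions_psize[of N]]) auto
  have "mps_coeff (J l) a = (\<Sum>m\<in>?S. v l m * (if ms a = ms m then 1 else 0))"
    using J l by (simp add: jack_family_def coeff_sum coeff_monomial_sym)
  also have "\<dots> = (\<Sum>m\<in>?S. if m = part (ms a) then if psize a = N then v l m else 0 else 0)"
  proof (rule sum.cong)
    fix m assume m: "m \<in> ?S"
    have "ms a = ms m \<longleftrightarrow> m = part (ms a) \<and> psize a = N"
    proof
      assume eq: "ms a = ms m"
      then have "psize a = N"
        using size[OF m] by (simp add: psize_eq_sum_ms)
      then show "m = part (ms a) \<and> psize a = N"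
        using m eq by simp
    next
      assume "m = part (ms a) \<and> psize a = N"
      then show "ms a = ms m"
        by (simp add: ms_part)
    qed
    then show "v l m * (if ms a = ms m then 1 else 0)
        = (if m = part (ms a) then if psize a = N then v l m else 0 else 0)"
      by simp
  qed simp
  also have "\<dots> = (if part (ms a) \<in> ?S then if psize a = N then v l (part (ms a)) else 0 else 0)"
    using fin by (rule sum.delta)
  also have "\<dots> = mps_coeff (hatf N (\<lambda>K. if dominated (part K) l then v l (part K) else 0)) a"
    using part_in_partitions[of "ms a"] by (auto simp: coeff_hatf)
  finally show "mps_coeff (J l) a
      = mps_coeff (hatf N (\<lambda>K. if dominated (part K) l then v l (part K) else 0)) a" .
qed

theorem theorem2:
  fixes J :: "(nat \<Rightarrow>\<^sub>0 nat) \<Rightarrow> ratfun mps"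
    and v :: "(nat \<Rightarrow>\<^sub>0 nat) \<Rightarrow> (nat \<Rightarrow>\<^sub>0 nat) \<Rightarrow> ratfun"
  assumes "jack_family J v"
    and "l \<in> partitions" and "m \<in> partitions" and "dominated m l"
  shows "\<exists>q :: int poly. v l m = poly (map_poly of_int q) jack_alpha"
proof -
  define N n where "N = psize l" and "n = Suc N"
  let ?I = "mpartitions N"
  let ?\<delta> = "\<lambda>k j :: nat multiset. if j = k then 1 else 0 :: ratfun"
  \<comment> \<open>\<open>jack_family\<close> does not constrain \<open>v\<close> off the dominance
    order; the coefficient of J there is 0.\<close>
  define H where "H M K = (if dominated (part K) (part M) then v (part M) (part K) else 0)" for M K
  define B where "B g h = ip N (coords N g) (coords N h)" for g h
  obtain f e where f_supp: "\<And>b. mps_coeff f b \<noteq> 0 \<Longrightarrow>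
        keys b \<subseteq> {..<n} \<and> psize b = N \<and> (norm2 b < norm2 l \<or> ms b = ms l)"
    and f_int: "\<And>b. mps_coeff f b \<in> range eval_alpha"
    and f_sym: "symmetric_vars n f"
    and f_eig: "LB n f = cst e * f"
    and e: "\<And>b. e = lb_eigenvalue n b \<Longrightarrow> norm2 b = norm2 l"
    and f_ones: "mps_coeff f (pones N) = fact N"
    using ex_integral_LB_eigenfunction[OF assms(2)] unfolding n_def N_def by blast
  define fh where "fh K = mps_coeff f (part K)" for K
  \<comment> \<open>The Laplace-Beltrami operator in n variables, as a matrix on monomial symmetric
    functions.\<close>
  define D where "D k K = mps_coeff (LB n (trunc n (hatf N (?\<delta> k)))) (part K)" for k K
  have l: "ms l \<in> ?I" "part (ms l) = l"
    using assms(2) by (simp_all add: N_def)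
  have f_eq: "f = trunc n (hatf N fh)"
    unfolding fh_def using f_sym f_supp by (intro symmetric_vars_eq_hatf) (auto simp: n_def)
  have keys: "keys (part K) \<subseteq> {..<n}" if "K \<in> ?I" for K
    using that by (rule keys_part) (simp add: n_def)
  have coords_\<delta>: "coords N (?\<delta> k) = coord N k" if "k \<in> ?I" for k
  proof
    fix M
    have "coords N (?\<delta> k) M = (\<Sum>K\<in>?I. if K = k then coord N K M else 0)"
      unfolding coords_def by (rule sum.cong) auto
    then show "coords N (?\<delta> k) M = coord N k M"
      using that by simp
  qed
  have J_hat: "J (part M) = hatf N (H M)" if "M \<in> ?I" for M
    using jack_family_eq_hatf[OF assms(1) part_mpartitions(1,3)[OF that]] by (simp add: H_def[abs_def])
  have ones: "part (ms (pones N)) = pones N" "ms (pones N) \<in> ?I"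
  proof -
    have "pones N \<in> partitions"
      by (auto simp: partitions_def pones_eq_ind lookup_ind intro!: antimonoI)
    then show "part (ms (pones N)) = pones N" by simp
    show "ms (pones N) \<in> ?I"
      by (simp add: pones_eq_ind psize_ind)
  qed
  have H_ones: "H M (ms (pones N)) = fact N" if "M \<in> ?I" for M
  proof -
    have "v (part M) (pones (psize (part M))) = fact (psize (part M))"
      using assms(1) part_mpartitions(1)[OF that] unfolding jack_family_def by blast
    then show ?thesis
      using dominated_pones[OF part_mpartitions(1)[OF that]]
      by (simp add: H_def ones part_mpartitions(3)[OF that])
  qed
  \<comment> \<open>The eigenvalue equation holds in n = N + 1 variables; \<open>theta_inj\<close>
    turns it into an equation between power sum coordinates.\<close>
  have lb_f: "lb_coords n N (coords N fh) M = e * coords N fh M" if "M \<in> ?I" for M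
  proof (rule theta_inj)
    have "theta n N (lb_coords n N (coords N fh)) = cst e * f"
      using f_eig LB_trunc_hatf[of n N fh] by (simp flip: f_eq)
    also have "\<dots> = theta n N (\<lambda>M. e * coords N fh M)"
      unfolding theta_scale by (subst f_eq) (simp flip: trunc_thetaI thetaI_coords)
    finally show "theta n N (lb_coords n N (coords N fh)) = theta n N (\<lambda>M. e * coords N fh M)" .
  qed (use that in \<open>auto simp: n_def\<close>)
  have coords_D: "coords N (D k) M = lb_coords n N (coord N k) M" if "k \<in> ?I" "M \<in> ?I" for k M
  proof (rule thetaI_inj[OF _ that(2)])
    have "mps_coeff (thetaI N (lb_coords n N (coord N k))) (part K) = D k K" if K: "K \<in> ?I" for K
      using keys[OF K] LB_trunc_hatf[of n N "?\<delta> k"] coords_\<delta>[OF \<open>k \<in> ?I\<close>]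
      by (simp add: D_def coeff_trunc flip: trunc_thetaI)
    then show "thetaI N (coords N (D k)) = thetaI N (lb_coords n N (coord N k))"
      unfolding thetaI_coords by (rule hatf_thetaI[symmetric])
  qed
  \<comment> \<open>The monomial function of shape k vanishes above \<open>norm2\<close> of j, so
    \<open>coeff_LB_maximal\<close> applies at j and leaves only the diagonal entry.\<close>
  have coeff_D: "D k j = lb_eigenvalue n (part j) * ?\<delta> k j"
    if "k \<in> ?I" "j \<in> ?I" "norm2 (part k) \<le> norm2 (part j)" for k j
  proof -
    have "D k j = lb_eigenvalue n (part j) * mps_coeff (trunc n (hatf N (?\<delta> k))) (part j)"
      unfolding D_def
    proof (rule coeff_LB_maximal[OF symmetric_vars_trunc_hatf keys[OF that(2)]])
      fix a assume "norm2 (part j) < norm2 a"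
      then have "ms a \<noteq> k"
        using that part_mpartitions(2)[OF that(1)] by (auto simp: norm2_eq_sum_ms)
      then show "mps_coeff (trunc n (hatf N (?\<delta> k))) a = 0"
        by (simp add: coeff_trunc coeff_hatf)
    qed
    then show ?thesis
      using keys[OF that(2)] that(2) by (simp add: coeff_trunc coeff_hatf_part)
  qed
  have "\<exists>c. \<forall>k\<in>?I. fh k = c * H (ms l) k"
  proof (rule triangular_eigenvector_unique[where B = B and \<nu> = "\<lambda>M. norm2 (part M)" and D = D and e = e])
    show "B g h = (\<Sum>k\<in>?I. g k * B (?\<delta> k) h)" for g h
    proof -
      have "B g h = (\<Sum>k\<in>?I. g k * ip N (coord N k) (coords N h))"
        unfolding B_def ip_def coords_def[of N g] sum_distrib_left sum_distrib_right
        by (subst sum.swap) (simp add: mult_ac)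
      then show ?thesis
        by (simp add: B_def coords_\<delta>)
    qed
    show "B g h = B h g" for g h
      unfolding B_def by (rule ip_commute)
    show "h k = 0" if "B h h = 0" "k \<in> ?I" for h k
    proof -
      have "coords N h M = 0" if "M \<in> ?I" for M
        using \<open>B h h = 0\<close> that unfolding B_def by (rule ip_definite)
      then have "thetaI N (coords N h) = 0"
        by (simp add: thetaI_def)
      then show ?thesis
        using coeff_hatf_part[OF that(2), of h] by (simp add: thetaI_coords)
    qed
    show "k = i \<or> norm2 (part k) < norm2 (part i)" if "i \<in> ?I" "k \<in> ?I" "H i k \<noteq> 0" for i k
      using norm2_less_if_dominated[OF part_mpartitions(1)[OF that(2)]] that(3)
        part_mpartitions(2)[OF that(1)] part_mpartitions(2)[OF that(2)]
      by (metis H_def)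
    show "B (H i) (H j) = 0" if "i \<in> ?I" "j \<in> ?I" "i \<noteq> j" for i j
    proof -
      have "part i \<noteq> part j"
        using that part_mpartitions(2) by metis
      then have "jack_inner (J (part i)) (J (part j)) = 0"
        using assms(1) part_mpartitions(1) that unfolding jack_family_def by blast
      then show ?thesis
        by (simp add: B_def J_hat that jack_inner_thetaI flip: thetaI_coords)
    qed
    show "\<exists>k\<in>?I. H i k \<noteq> 0" if "i \<in> ?I" for i
      using H_ones[OF that] ones(2) by (metis fact_nonzero)
    show "k = ms l \<or> norm2 (part k) < norm2 (part (ms l))" if "k \<in> ?I" "fh k \<noteq> 0" for k
      using f_supp[of "part k"] that part_mpartitions(2)[OF that(1)] by (auto simp: fh_def l)
    show "B fh (D k) = e * B fh (?\<delta> k)" if k: "k \<in> ?I" for k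
    proof -
      \<comment> \<open>Self-adjointness moves the operator from the monomial function to f, where
        it acts as e.\<close>
      have "B fh (D k) = ip N (coords N fh) (lb_coords n N (coord N k))"
        unfolding B_def ip_def by (rule sum.cong) (auto simp: coords_D k)
      also have "\<dots> = ip N (lb_coords n N (coords N fh)) (coord N k)"
        unfolding lb_coords_def[abs_def] by (rule ip_dmat_adjoint[symmetric])
      also have "\<dots> = e * B fh (?\<delta> k)"
        unfolding B_def coords_\<delta>[OF k] ip_def sum_distrib_left by (rule sum.cong) (auto simp: lb_f)
      finally show ?thesis .
    qed
    show "j = k \<or> norm2 (part j) < norm2 (part k)" if "k \<in> ?I" "j \<in> ?I" "D k j \<noteq> 0" for k j
      using coeff_D[OF that(1,2)] that(3) by (cases "norm2 (part k) \<le> norm2 (part j)") (auto split: if_splits)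
    show "D k k \<noteq> e" if "k \<in> ?I" "norm2 (part k) < norm2 (part (ms l))" for k
      using coeff_D[OF that(1,1)] e[of "part k"] that(2) by (auto simp: l)
  qed (use l in auto)
  then obtain c where c: "\<And>k. k \<in> ?I \<Longrightarrow> fh k = c * H (ms l) k"
    by blast
  \<comment> \<open>Both f and J_l have coefficient N! at the squarefree monomial of degree
    N.\<close>
  have "c = 1"
    using c[OF ones(2)] H_ones[OF l(1)] f_ones by (simp add: fh_def ones)
  have m: "ms m \<in> ?I" "part (ms m) = m"
    using assms(3,4) by (simp_all add: N_def dominated_def)
  have "v l m = H (ms l) (ms m)"
    using assms(4) by (simp add: H_def l m)
  also have "\<dots> = mps_coeff f m"
    using c[OF m(1)] \<open>c = 1\<close> by (simp add: fh_def m)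
  finally show ?thesis
    using f_int[of m] by (auto simp: eval_alpha_def)
qed

end
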